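(* Let $L(Q,A,h)$ and $L(\widetilde Q,\widetilde A,\widetilde h)$ be two matrix Schrödinger boundary value problems on the half-line (same size $n$) with Weyl matrices $M(\lambda)$ and $\widetilde M(\lambda)$ respectively. If $M(\lambda)=\widetilde M(\lambda)$ (as functions of $\lambda$), then $Q=\widetilde Q$ (a.e. on $(0,\infty)$), $h=\widetilde h$ and $A=\widetilde A$.
   Context: Problem $L(Q,A,h)$: $n\ge 1$; $Q$ is a complex $n\times n$ matrix-valued function on $(0,\infty)$ with entries in $L^1(0,\infty)$; $A\in\mathbb C^{n\times n}$ is an orthogonal projection matrix ($A^\dagger=A=A^2$), $A^\perp:=I_n-A$; $h\in\mathbb C^{n\times n}$ satisfies $h=AhA=Ah=hA$. Neither $Q(x)^\dagger=Q(x)$ nor $h^\dagger=h$ is assumed. $L(Q,A,h)$ denotes the equation $-Y''+Q(x)Y=\lambda Y$, $x>0$, with boundary condition $T(Y):=A(Y'(0)-hY(0))-A^\perp Y(0)=0$. The data $(\widetilde Q,\widetilde A,\widetilde h)$ satisfy the same assumptions, and objects with a tilde are those built from $(\widetilde Q,\widetilde A,\widetilde h)$ in the same way. Let $\lambda=\rho^2$ and $\Omega:=\{\rho\in\mathbb C:\operatorname{Im}\rho\ge 0,\ \rho\ne 0\}$. The Jost solution $e(x,\rho)$, $x\ge 0$, $\rho\in\Omega$, is the $n\times n$ matrix solution of the equation given by the integral equation $$e(x,\rho)=e^{i\rho x}I_n+\int_x^\infty\frac{\sin\rho(t-x)}{\rho}Q(t)e(t,\rho)\,dt$$ (the solution with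 $e^{-i\rho x}e(x,\rho)$ bounded in $x$). The Jost matrix is $J(\rho):=T(e(\cdot,\rho))=A(e'(0,\rho)-he(0,\rho))-A^\perp e(0,\rho)$. The Weyl solution is $\phi(x,\lambda):=e(x,\rho)J(\rho)^{-1}$ for $\rho\in\Omega$ with $\det J(\rho)\ne0$, and the Weyl matrix is $$M(\lambda):=A\phi(0,\lambda)+A^\perp\phi'(0,\lambda)=[Ae(0,\rho)+A^\perp e'(0,\rho)]J(\rho)^{-1}.$$ Prime denotes $d/dx$. For $\lambda\in\mathbb C\setminus[0,\infty)$, $\rho$ is the square root of $\lambda$ with $\operatorname{Im}\rho>0$; equality of Weyl matrices is understood at all $\lambda$ where both are defined. *)

theory Defs
  imports "HOL-Analysis.Analysis"
begin

definition hermitian_adjoint :: "complex^'n^'n \<Rightarrow> complex^'n^'n"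
  where "hermitian_adjoint A = map_matrix cnj (transpose A)"

definition orthogonal_projection :: "complex^'n^'n \<Rightarrow> bool"
  where "orthogonal_projection A \<longleftrightarrow> hermitian_adjoint A = A \<and> A ** A = A"

definition compl_projection :: "complex^'n^'n \<Rightarrow> complex^'n^'n"
  where "compl_projection A = mat 1 - A"

text \<open>
  The standing assumptions on the data of the problem \<open>L(Q,A,h)\<close>: the equation
  \<open>-Y'' + Q(x) Y = z Y\<close> for \<open>x > 0\<close> with the boundary condition \<open>T(Y) = 0\<close>, where \<open>T\<close> is
  \<open>boundary_form A h\<close> below. The values of \<open>Q\<close> outside \<open>(0,\<infinity>)\<close> are never used.
\<close>

definition bvp_data :: "(real \<Rightarrow> complex^'n^'n) \<Rightarrow> complex^'n^'n \<Rightarrow> complex^'n^'n \<Rightarrow> bool"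
  where "bvp_data Q A h \<longleftrightarrow>
    (\<forall>i j. (\<lambda>x. Q x $ i $ j) absolutely_integrable_on {0<..}) \<and>
    orthogonal_projection A \<and>
    h = A ** h ** A \<and> h = A ** h \<and> h = h ** A"

text \<open>Functions live on \<open>[0,\<infinity>)\<close>, so the derivative at \<open>0\<close> is one-sided.\<close>

definition deriv_at_0 :: "(real \<Rightarrow> complex^'n^'n) \<Rightarrow> complex^'n^'n"
  where "deriv_at_0 Y = vector_derivative Y (at 0 within {0..})"

definition boundary_form ::
    "complex^'n^'n \<Rightarrow> complex^'n^'n \<Rightarrow> (real \<Rightarrow> complex^'n^'n) \<Rightarrow> complex^'n^'n"
  where "boundary_form A h Y =
    A ** (deriv_at_0 Y - h ** Y 0) - compl_projection A ** Y 0"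

text \<open>
  The type of complex matrices has no complex scalar multiplication; multiplication by the
  scalar matrix \<open>mat c\<close> (that is, \<open>c I\<close>) is used instead. Integrability of the integrand is
  required explicitly because the Bochner integral of a non-integrable function is \<open>0\<close>.
\<close>

definition is_jost_solution ::
    "(real \<Rightarrow> complex^'n^'n) \<Rightarrow> complex \<Rightarrow> (real \<Rightarrow> complex^'n^'n) \<Rightarrow> bool"
  where "is_jost_solution Q \<rho> e \<longleftrightarrow>
    bounded ((\<lambda>x. mat (exp (- (\<i> * \<rho> * of_real x))) ** e x) ` {0..}) \<and>
    (\<forall>x\<ge>0.
      (\<lambda>t. mat (sin (\<rho> * of_real (t - x)) / \<rho>) ** Q t ** e t) absolutely_integrable_on {x<..} \<and>
      e x = mat (exp (\<i> * \<rho> * of_real x)) +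
        (LINT t:{x<..}|lebesgue. mat (sin (\<rho> * of_real (t - x)) / \<rho>) ** Q t ** e t))"

text \<open>
  For \<open>Q\<close> integrable on \<open>(0,\<infinity>)\<close>, \<open>Im \<rho> \<ge> 0\<close> and \<open>\<rho> \<noteq> 0\<close>, the restriction of the Jost
  solution to \<open>[0,\<infinity>)\<close> exists and is unique. Its (arbitrary) values at negative arguments
  are never used, which is why it is chosen by \<open>SOME\<close> and not by \<open>THE\<close>.
\<close>

definition jost_solution ::
    "(real \<Rightarrow> complex^'n^'n) \<Rightarrow> complex \<Rightarrow> real \<Rightarrow> complex^'n^'n"
  where "jost_solution Q \<rho> = (SOME e. is_jost_solution Q \<rho> e)"

definition jost_matrix ::
    "(real \<Rightarrow> complex^'n^'n) \<Rightarrow> complex^'n^'n \<Rightarrow> complex^'n^'n \<Rightarrow> complex \<Rightarrow> complex^'n^'n"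
  where "jost_matrix Q A h \<rho> = boundary_form A h (jost_solution Q \<rho>)"

text \<open>The square root with positive imaginary part; it exists exactly for \<open>z\<close> outside \<open>[0,\<infinity>)\<close>.\<close>

definition upper_sqrt :: "complex \<Rightarrow> complex"
  where "upper_sqrt z = (THE \<rho>. \<rho> ^ 2 = z \<and> Im \<rho> > 0)"

definition weyl_solution ::
    "(real \<Rightarrow> complex^'n^'n) \<Rightarrow> complex^'n^'n \<Rightarrow> complex^'n^'n \<Rightarrow> complex \<Rightarrow> real \<Rightarrow> complex^'n^'n"
  where "weyl_solution Q A h z x =
    jost_solution Q (upper_sqrt z) x ** matrix_inv (jost_matrix Q A h (upper_sqrt z))"

definition weyl_matrix ::
    "(real \<Rightarrow> complex^'n^'n) \<Rightarrow> complex^'n^'n \<Rightarrow> complex^'n^'n \<Rightarrow> complex \<Rightarrow> complex^'n^'n"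
  where "weyl_matrix Q A h z =
    A ** weyl_solution Q A h z 0 + compl_projection A ** deriv_at_0 (weyl_solution Q A h z)"

definition weyl_domain ::
    "(real \<Rightarrow> complex^'n^'n) \<Rightarrow> complex^'n^'n \<Rightarrow> complex^'n^'n \<Rightarrow> complex set"
  where "weyl_domain Q A h =
    {z. \<not> (z \<in> \<real> \<and> 0 \<le> Re z) \<and> det (jost_matrix Q A h (upper_sqrt z)) \<noteq> 0}"

end

theory Submission
  imports Defs "HOL-Complex_Analysis.Cauchy_Integral_Formula"
begin

text \<open>
  Let \<open>e(x,\<rho>)\<close> be the Jost solution and \<open>m(\<rho>) = e'(0,\<rho>) e(0,\<rho>)\<^sup>-\<^sup>1\<close> its logarithmic derivative. With
  \<open>N = m - h\<close> and \<open>B = I - A\<close>, the definition of the Weyl matrix \<open>M\<close> becomes \<open>A + B N = M (A N - B)\<close>. As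
  \<open>\<rho> \<rightarrow> \<infinity>\<close> in the upper half-plane, \<open>e(0,\<rho>) \<rightarrow> I\<close> and \<open>e'(0,\<rho>) / (i\<rho>) \<rightarrow> I\<close>, hence \<open>M / (i\<rho>) \<rightarrow> -B\<close>
  (\<open>weyl_matrix_limit\<close>). So \<open>M\<close> determines \<open>A\<close>, and then the relation above determines \<open>N\<close>
  (\<open>fractional_linear_injective\<close>).

  It remains to recover \<open>Q\<close> and \<open>h\<close> from \<open>N\<close> (locale \<open>two_potentials\<close>). Let \<open>S\<close> and \<open>C\<close> solve the first
  equation with initial data \<open>(0, I)\<close> and \<open>(I, h)\<close>; the decaying solution with value \<open>I\<close> at \<open>0\<close> is
  \<open>\<psi> = C + S N\<close>. Let \<open>T\<close> and \<open>D\<close> solve the adjoint \<open>Z'' = Z Q' - z Z\<close> of the second equation, with data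
  \<open>(0, I)\<close> and \<open>(I, h')\<close>. Its decaying solution is \<open>\<phi> = D + N T\<close> with the same \<open>N\<close>, because the Wronskian
  of two decaying solutions vanishes (\<open>jost_wronskian\<close>). Put \<open>P = C T' - S D'\<close> and \<open>R = S D - C T\<close>, where
  the prime on a solution means \<open>d/dx\<close>. For fixed \<open>x\<close> both are entire in \<open>z = \<rho>\<^sup>2\<close>. They also equal
  \<open>\<psi> T' - S \<phi>'\<close> and \<open>S \<phi> - \<psi> T\<close>, since the terms with \<open>N\<close> cancel, and there the growth of \<open>S\<close> and \<open>T\<close> is
  compensated by the decay of \<open>\<psi>\<close> and \<open>\<phi>\<close>: \<open>P \<rightarrow> I\<close> and \<open>R \<rightarrow> 0\<close> at infinity (\<open>transition_limits\<close>). By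
  Liouville's theorem \<open>P = I\<close> and \<open>R = 0\<close>. Since Wronskians are constant, \<open>P\<close> and \<open>R\<close> express the first
  decaying solution through the second one and its derivative; so the two decaying solutions agree
  (\<open>solutions_agree\<close>). A solution that is invertible everywhere determines its equation, and its
  derivative \<open>h + N\<close> at \<open>0\<close> determines \<open>h\<close>.

  The coefficients are merely integrable. Solutions are therefore pairs of locally absolutely
  continuous functions, and the product rule for such functions is Fubini's theorem on a square
  divided along its diagonal. Both kinds of solutions, from infinity and from \<open>0\<close>, come from Neumann
  series of integral equations whose operator has norm at most \<open>1/2\<close> (locale \<open>small_kernel\<close>); for the
  Jost solution this holds when \<open>\<bar>\<rho>\<bar>\<close> is large, which suffices for an argument at infinity.
\<close>

section \<open>Complex matrices as a normed algebra\<close>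

text \<open>
  A constant of its own, instead of \<open>mat c ** X\<close>, lets rewriting collect scalars in front without
  the loops that arise because scalar matrices commute with each other.
\<close>

definition cscale :: "complex \<Rightarrow> complex^'n^'m \<Rightarrow> complex^'n^'m" (infixr "*\<^sub>C" 75)
  where "c *\<^sub>C X = (\<chi> i j. c * X $ i $ j)"

lemma cscale_component [simp]: "(c *\<^sub>C X) $ i $ j = c * X $ i $ j"
  by (simp add: cscale_def)

lemma mat_mult_eq_cscale: "mat c ** X = c *\<^sub>C X"
  by (simp add: vec_eq_iff matrix_matrix_mult_def mat_def if_distrib if_distribR cong: if_cong)

lemma mat_eq_cscale: "mat c = c *\<^sub>C mat 1"
  by (simp add: vec_eq_iff mat_def)

lemma cscale_mult_left [simp]: "(c *\<^sub>C X) ** Y = c *\<^sub>C (X ** Y)"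
  by (simp add: vec_eq_iff matrix_matrix_mult_def sum_distrib_left mult.assoc)

lemma cscale_mult_right [simp]: "X ** (c *\<^sub>C Y) = c *\<^sub>C (X ** Y)"
  by (simp add: vec_eq_iff matrix_matrix_mult_def sum_distrib_left mult_ac)

lemma cscale_cscale [simp]: "a *\<^sub>C b *\<^sub>C X = (a * b) *\<^sub>C X"
  by (simp add: vec_eq_iff)

lemma cscale_one [simp]: "1 *\<^sub>C X = X" and cscale_zero [simp]: "0 *\<^sub>C X = 0" "c *\<^sub>C 0 = 0"
  by (simp_all add: vec_eq_iff)

lemma cscale_distribs:
  "c *\<^sub>C (X + Y) = c *\<^sub>C X + c *\<^sub>C Y" "c *\<^sub>C (X - Y) = c *\<^sub>C X - c *\<^sub>C Y"
  "(a + b) *\<^sub>C X = a *\<^sub>C X + b *\<^sub>C X" "(a - b) *\<^sub>C X = a *\<^sub>C X - b *\<^sub>C X"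
  "c *\<^sub>C (- X) = - (c *\<^sub>C X)" "(- c) *\<^sub>C X = - (c *\<^sub>C X)"
  by (simp_all add: vec_eq_iff algebra_simps)

lemma matrix_mult_distribs:
  fixes X Y Z :: "complex^'n^'n"
  shows "X ** (Y + Z) = X ** Y + X ** Z" "(X + Y) ** Z = X ** Z + Y ** Z"
    "X ** (Y - Z) = X ** Y - X ** Z" "(X - Y) ** Z = X ** Z - Y ** Z"
    "X ** (- Y) = - (X ** Y)" "(- X) ** Y = - (X ** Y)"
  by (simp_all add: vec_eq_iff matrix_matrix_mult_def algebra_simps sum.distrib sum_subtractf
      sum_negf)

lemmas cmatrix_simps = cscale_distribs matrix_mult_distribs matrix_mul_assoc

lemma norm_cscale [simp]: "norm (c *\<^sub>C X) = norm c * norm X"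
proof -
  have "norm ((c *\<^sub>C X) $ i) = norm c * norm (X $ i)" for i
    by (simp add: norm_vec_def norm_mult L2_set_right_distrib)
  then show ?thesis
    by (subst (1 2) norm_vec_def) (simp add: L2_set_right_distrib)
qed

text \<open>The norm is the Frobenius norm, so Cauchy--Schwarz applied to rows gives the constant \<open>1\<close>.\<close>

lemma norm_matrix_mult_le: "norm (X ** Y) \<le> norm X * norm (Y :: complex^'n^'n)"
proof -
  have row: "norm ((X ** Y) $ i) \<le> norm (X $ i) * norm Y" for i
  proof -
    have "(X ** Y) $ i = (\<Sum>k\<in>UNIV. X $ i $ k *s Y $ k)"
      by (simp add: vec_eq_iff matrix_matrix_mult_def)
    also have "norm \<dots> \<le> (\<Sum>k\<in>UNIV. norm (X $ i $ k) * norm (Y $ k))"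
    proof (rule sum_norm_le)
      fix k
      show "norm (X $ i $ k *s Y $ k) \<le> norm (X $ i $ k) * norm (Y $ k)"
        by (simp add: norm_vec_def norm_mult L2_set_right_distrib)
    qed
    also have "\<dots> \<le> norm (X $ i) * norm Y"
      using L2_set_mult_ineq[of "\<lambda>k. norm (X $ i $ k)" "\<lambda>k. norm (Y $ k)" UNIV]
      by (simp add: norm_vec_def)
    finally show ?thesis .
  qed
  have "norm (X ** Y) \<le> L2_set (\<lambda>i. norm (X $ i) * norm Y) UNIV"
    unfolding norm_vec_def[of "X ** Y"] by (rule L2_set_mono) (use row in auto)
  also have "\<dots> = norm X * norm Y"
    by (simp add: norm_vec_def[of X] L2_set_left_distrib)
  finally show ?thesis .
qed

lemma bounded_bilinear_matrix_mult:
  "bounded_bilinear ((**) :: complex^'n^'n \<Rightarrow> complex^'n^'n \<Rightarrow> complex^'n^'n)"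
proof
  show "\<exists>K. \<forall>a b. norm (a ** b) \<le> norm a * norm (b :: complex^'n^'n) * K"
    by (rule exI[of _ 1]) (simp add: norm_matrix_mult_le)
qed (simp_all add: matrix_mult_distribs, simp_all add: vec_eq_iff matrix_matrix_mult_def
    scaleR_sum_right)

lemma bounded_bilinear_cscale:
  "bounded_bilinear ((*\<^sub>C) :: complex \<Rightarrow> complex^'n^'n \<Rightarrow> complex^'n^'n)"
proof
  show "\<exists>K. \<forall>a b. norm (a *\<^sub>C b) \<le> norm a * norm (b :: complex^'n^'n) * K"
    by (rule exI[of _ 1]) simp
qed (simp_all add: cscale_distribs vec_eq_iff)

lemmas continuous_on_matrix_mult [continuous_intros] =
  bounded_bilinear.continuous_on[OF bounded_bilinear_matrix_mult]
lemmas continuous_on_cscale [continuous_intros] =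
  bounded_bilinear.continuous_on[OF bounded_bilinear_cscale]
lemmas tendsto_matrix_mult [tendsto_intros] =
  bounded_bilinear.tendsto[OF bounded_bilinear_matrix_mult]
lemmas tendsto_cscale [tendsto_intros] =
  bounded_bilinear.tendsto[OF bounded_bilinear_cscale]
lemmas bounded_linear_mult_matrix_left =
  bounded_bilinear.bounded_linear_right[OF bounded_bilinear_matrix_mult]
lemmas bounded_linear_mult_matrix_right =
  bounded_bilinear.bounded_linear_left[OF bounded_bilinear_matrix_mult]
lemmas bounded_linear_cscale =
  bounded_bilinear.bounded_linear_right[OF bounded_bilinear_cscale]

lemma bounded_linear_entry: "bounded_linear (\<lambda>X :: complex^'n^'n. X $ i $ j)"
  by (intro bounded_linear_compose[OF bounded_linear_vec_nth] bounded_linear_vec_nth)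

lemma bounded_linear_transpose:
  "bounded_linear (transpose :: complex^'n^'n \<Rightarrow> complex^'n^'n)"
  by (simp add: linear_conv_bounded_linear[symmetric] linear_iff transpose_def vec_eq_iff)

lemma tendsto_matrix_iff:
  fixes f :: "'a \<Rightarrow> complex^'n^'n"
  shows "(f \<longlongrightarrow> L) F \<longleftrightarrow> (\<forall>i j. ((\<lambda>x. f x $ i $ j) \<longlongrightarrow> L $ i $ j) F)"
  by (auto intro!: vec_tendstoI) (intro tendsto_vec_nth)

section \<open>Locally absolutely continuous functions on the half-line\<close>

lemmas hk_integral_cong = Henstock_Kurzweil_Integration.integral_cong
lemmas hk_integral_add = Henstock_Kurzweil_Integration.integral_add
lemmas hk_integral_diff = Henstock_Kurzweil_Integration.integral_diff

lemma absolutely_integrable_map: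
  fixes f :: "'a::euclidean_space \<Rightarrow> 'b::euclidean_space" and h :: "'b \<Rightarrow> 'c::euclidean_space"
  assumes "f absolutely_integrable_on S" "bounded_linear h"
  shows "(\<lambda>t. h (f t)) absolutely_integrable_on S"
  using absolutely_integrable_linear[OF assms] by (simp add: o_def)

lemma integral_map:
  assumes "f integrable_on S" "bounded_linear h"
  shows "(\<lambda>t. h (f t)) integrable_on S" "integral S (\<lambda>t. h (f t)) = h (integral S f)"
  using integrable_linear[OF assms] integral_linear[OF assms] by (simp_all add: o_def)

lemmas integral_cscale = integral_map[OF _ bounded_linear_cscale]
lemmas integral_entry = integral_map[OF _ bounded_linear_entry]

text \<open>
  Local absolute continuity in the form of the fundamental theorem of calculus, with a density that
  is determined up to null sets only.
\<close>

definition has_ac_deriv :: "(real \<Rightarrow> 'a::euclidean_space) \<Rightarrow> (real \<Rightarrow> 'a) \<Rightarrow> bool"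
  where "has_ac_deriv f f' \<longleftrightarrow>
    (\<forall>x\<ge>0. f' absolutely_integrable_on {0..x} \<and> f x = f 0 + integral {0..x} f')"

lemma lebesgue_on_integrable_iff:
  fixes f :: "real \<Rightarrow> 'a::euclidean_space"
  shows "integrable (lebesgue_on {a..b}) f \<longleftrightarrow> f absolutely_integrable_on {a..b}"
  by (simp add: set_integrable_def integrable_restrict_space)

text \<open>
  The product of the integrals is an integral over the square \<open>[0,x]\<^sup>2\<close>. The diagonal cuts the square
  into two triangles, and Fubini's theorem on each of them gives one of the two summands.
\<close>

lemma integral_product_indefinite_integrals:
  fixes h :: "'a::euclidean_space \<Rightarrow> 'b::euclidean_space \<Rightarrow> 'c::euclidean_space"
    and u v and x :: real
  assumes h: "bounded_bilinear h"
    and u: "u absolutely_integrable_on {0..x}" and v: "v absolutely_integrable_on {0..x}"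
  shows "(\<lambda>s. h (u s) (integral {0..s} v)) absolutely_integrable_on {0..x}"
    and "(\<lambda>t. h (integral {0..t} u) (v t)) absolutely_integrable_on {0..x}"
    and "h (integral {0..x} u) (integral {0..x} v) =
      integral {0..x} (\<lambda>s. h (u s) (integral {0..s} v)) +
      integral {0..x} (\<lambda>t. h (integral {0..t} u) (v t))"
proof -
  interpret h: bounded_bilinear h by fact
  have cu: "continuous_on {0..x} (\<lambda>t. integral {0..t} u)"
    by (rule indefinite_integral_continuous_1[OF set_lebesgue_integral_eq_integral(1)[OF u]])
  have cv: "continuous_on {0..x} (\<lambda>t. integral {0..t} v)"
    by (rule indefinite_integral_continuous_1[OF set_lebesgue_integral_eq_integral(1)[OF v]])
  have bil: "bilinear h"
    using h by (simp add: bilinear_conv_bounded_bilinear)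
  show A1: "(\<lambda>s. h (u s) (integral {0..s} v)) absolutely_integrable_on {0..x}"
    by (rule absolutely_integrable_bounded_measurable_product[where h="\<lambda>a b. h b a"])
      (use cv u in \<open>auto intro!: continuous_imp_measurable_on_sets_lebesgue compact_imp_bounded
        compact_continuous_image h.flip simp: bilinear_conv_bounded_bilinear\<close>)
  show A2: "(\<lambda>t. h (integral {0..t} u) (v t)) absolutely_integrable_on {0..x}"
    by (rule absolutely_integrable_bounded_measurable_product)
      (use bil cu v in \<open>auto intro!: continuous_imp_measurable_on_sets_lebesgue compact_imp_bounded
        compact_continuous_image\<close>)
  let ?M = "lebesgue_on {0..x}"
  interpret fin: finite_measure ?M
    by (rule finite_measure_lebesgue_on) (metis box_real(2) lmeasurable_cbox)
  interpret P: pair_sigma_finite ?M ?M ..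
  let ?MM = "?M \<Otimes>\<^sub>M ?M" and ?w = "\<lambda>p. h (u (fst p)) (v (snd p))"
  have iu: "integrable ?M u" and iv: "integrable ?M v"
    using u v by (simp_all add: lebesgue_on_integrable_iff)
  have mu [measurable]: "u \<in> borel_measurable ?M" and mv [measurable]: "v \<in> borel_measurable ?M"
    using iu iv by auto
  have mid [measurable]: "(\<lambda>s. s) \<in> borel_measurable ?M"
    by (simp add: measurable_restrict_space1 measurable_completion)
  have mh: "?w \<in> borel_measurable ?MM"
    by (rule borel_measurable_continuous_Pair) (auto intro!: h.continuous_on continuous_intros)
  obtain K where K: "\<And>a b. norm (h a b) \<le> norm a * norm b * K"
    using h.bounded by blast
  have dom: "integrable ?MM (\<lambda>p. norm (u (fst p)) * norm (v (snd p)) * K)"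
  proof (rule P.Fubini_integrable)
    show "integrable ?M (\<lambda>s. \<integral>t. norm (norm (u (fst (s, t))) * norm (v (snd (s, t))) * K) \<partial>?M)"
      using iu iv by (simp add: abs_mult)
  qed (use iv in \<open>auto intro!: AE_I2\<close>)
  have int: "integrable ?MM ?w"
  proof (rule Bochner_Integration.integrable_bound[OF dom mh], rule AE_I2)
    show "norm (?w p) \<le> norm (norm (u (fst p)) * norm (v (snd p)) * K)" for p
      using K[of "u (fst p)" "v (snd p)"] by (metis abs_ge_self order_trans real_norm_def)
  qed
  define D where "D = {p \<in> space ?MM. snd p \<le> fst p}"
  have D: "D \<in> sets ?MM"
    unfolding D_def by measurable
  let ?d = "\<lambda>p. indicator D p *\<^sub>R h (u (fst p)) (v (snd p))"
  have int1: "integrable ?MM ?d"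
    by (rule integrable_mult_indicator[OF D int])
  have int2: "integrable ?MM (\<lambda>p. ?w p - ?d p)"
    by (rule Bochner_Integration.integrable_diff[OF int int1])
  have lint: "integral\<^sup>L ?M w = integral {0..x} w"
    if "w absolutely_integrable_on {0..x}" for w :: "real \<Rightarrow> 'd::euclidean_space"
    using that by (intro lebesgue_integral_eq_integral) (auto simp: lebesgue_on_integrable_iff)
  have restr: "integral {0..x} (\<lambda>t. if t \<in> {0..s} then w t else 0) = integral {0..s} w"
    and restr_int: "(\<lambda>t. if t \<in> {0..s} then w t else 0) absolutely_integrable_on {0..x}"
    if "s \<in> {0..x}" "w absolutely_integrable_on {0..x}" for s and w :: "real \<Rightarrow> 'd::euclidean_space"
  proof -
    show "integral {0..x} (\<lambda>t. if t \<in> {0..s} then w t else 0) = integral {0..s} w"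
      using that by (simp add: integral_restrict_Int del: atLeastAtMost_iff) (simp add: min_def)
    have "w absolutely_integrable_on {0..s}"
      using that by (intro absolutely_integrable_on_subinterval[OF that(2)]) auto
    then have "(\<lambda>t. if t \<in> {0..s} then w t else 0) absolutely_integrable_on UNIV"
      by (simp only: absolutely_integrable_restrict_UNIV)
    then show "(\<lambda>t. if t \<in> {0..s} then w t else 0) absolutely_integrable_on {0..x}"
      by (rule absolutely_integrable_on_subinterval) auto
  qed
  have "integral\<^sup>L ?MM ?w = h (integral {0..x} u) (integral {0..x} v)"
  proof -
    have "integral\<^sup>L ?MM ?w = (\<integral>s. (\<integral>t. h (u s) (v t) \<partial>?M) \<partial>?M)"
      using P.integral_fst'[OF int] by simp
    also have "\<dots> = (\<integral>s. h (u s) (integral {0..x} v) \<partial>?M)"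
      using iv v by (intro Bochner_Integration.integral_cong refl)
        (simp add: integral_bounded_linear[OF h.bounded_linear_right] lint)
    also have "\<dots> = h (integral {0..x} u) (integral {0..x} v)"
      using iu u by (simp add: integral_bounded_linear[OF h.bounded_linear_left] lint)
    finally show ?thesis .
  qed
  moreover have "integral\<^sup>L ?MM ?d =
      integral {0..x} (\<lambda>s. h (u s) (integral {0..s} v))"
  proof -
    have "integral\<^sup>L ?MM ?d =
        (\<integral>s. (\<integral>t. indicator D (s, t) *\<^sub>R h (u s) (v t) \<partial>?M) \<partial>?M)"
      using P.integral_fst'[OF int1] by simp
    also have "\<dots> = (\<integral>s. h (u s) (integral {0..s} v) \<partial>?M)"
    proof (intro Bochner_Integration.integral_cong refl)
      fix s assume "s \<in> space ?M"
      then have s: "s \<in> {0..x}" by simp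
      have "(\<integral>t. indicator D (s, t) *\<^sub>R h (u s) (v t) \<partial>?M) =
          (\<integral>t. h (u s) (if t \<in> {0..s} then v t else 0) \<partial>?M)"
        using s by (intro Bochner_Integration.integral_cong refl)
          (auto simp: D_def space_pair_measure indicator_def h.zero_right)
      also have "\<dots> = h (u s) (\<integral>t. (if t \<in> {0..s} then v t else 0) \<partial>?M)"
        using restr_int[OF s v]
        by (intro integral_bounded_linear[OF h.bounded_linear_right])
          (simp add: lebesgue_on_integrable_iff)
      also have "(\<integral>t. (if t \<in> {0..s} then v t else 0) \<partial>?M) = integral {0..s} v"
        using restr[OF s v] restr_int[OF s v] by (simp only: lint)
      finally show "(\<integral>t. indicator D (s, t) *\<^sub>R h (u s) (v t) \<partial>?M) = h (u s) (integral {0..s} v)" .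
    qed
    also have "\<dots> = integral {0..x} (\<lambda>s. h (u s) (integral {0..s} v))"
      by (rule lint[OF A1])
    finally show ?thesis .
  qed
  moreover have "integral\<^sup>L ?MM (\<lambda>p. ?w p - ?d p) =
      integral {0..x} (\<lambda>t. h (integral {0..t} u) (v t))"
  proof -
    have "integral\<^sup>L ?MM (\<lambda>p. ?w p - ?d p) =
        (\<integral>t. (\<integral>s. h (u s) (v t) - indicator D (s, t) *\<^sub>R h (u s) (v t) \<partial>?M) \<partial>?M)"
      using P.integral_snd[of "\<lambda>s t. h (u s) (v t) - indicator D (s, t) *\<^sub>R h (u s) (v t)"] int2
      by (simp add: case_prod_unfold)
    also have "\<dots> = (\<integral>t. h (integral {0..t} u) (v t) \<partial>?M)"
    proof (intro Bochner_Integration.integral_cong refl)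
      fix t assume "t \<in> space ?M"
      then have t: "t \<in> {0..x}" by simp
      have "(\<integral>s. h (u s) (v t) - indicator D (s, t) *\<^sub>R h (u s) (v t) \<partial>?M) =
          (\<integral>s. h (if s \<in> {0..t} then u s else 0) (v t) \<partial>?M)"
      proof (intro integral_cong_AE)
        show "AE s in ?M. h (u s) (v t) - indicator D (s, t) *\<^sub>R h (u s) (v t) =
            h (if s \<in> {0..t} then u s else 0) (v t)"
        proof -
          \<comment> \<open>the diagonal belongs to the other triangle\<close>
          have "AE s in ?M. s \<noteq> t"
          proof -
            have "{t} \<in> null_sets lebesgue"
              using negligible_iff_null_sets by blast
            then have "AE s in lebesgue. s \<notin> {t}"
              by (rule AE_not_in)
            then have "AE s in lebesgue. s \<in> {0..x} \<longrightarrow> s \<noteq> t"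
              by (rule AE_mp) (rule AE_I2, blast)
            then show ?thesis
              by (simp add: AE_restrict_space_iff)
          qed
          then show ?thesis
            by (rule AE_mp) (use t in \<open>auto intro!: AE_I2 simp: D_def space_pair_measure
                indicator_def h.zero_left\<close>)
        qed
        have hs: "(\<lambda>s. h (u s) (v t)) \<in> borel_measurable ?M"
          by (rule borel_measurable_continuous_Pair) (auto intro!: h.continuous_on continuous_intros)
        moreover have "(\<lambda>s. indicator D (s, t) *\<^sub>R h (u s) (v t)) \<in> borel_measurable ?M"
        proof -
          have "(\<lambda>s. (indicator D (s, t) :: real)) \<in> borel_measurable ?M"
            using D t by (intro measurable_compose[OF measurable_Pair2'] borel_measurable_indicator) auto
          then show ?thesis using hs by (rule borel_measurable_scaleR)
        qed
        ultimately show "(\<lambda>s. h (u s) (v t) - indicator D (s, t) *\<^sub>R h (u s) (v t)) \<in> borel_measurable ?M"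
          by (intro borel_measurable_diff)
        have "(\<lambda>s. if s \<in> {0..t} then u s else 0) \<in> borel_measurable ?M"
          using restr_int[OF t u] unfolding lebesgue_on_integrable_iff[symmetric] by (rule borel_measurable_integrable)
        then show "(\<lambda>s. h (if s \<in> {0..t} then u s else 0) (v t)) \<in> borel_measurable ?M"
          by (rule borel_measurable_continuous_Pair) (auto intro!: h.continuous_on continuous_intros)
      qed
      also have "\<dots> = h (\<integral>s. (if s \<in> {0..t} then u s else 0) \<partial>?M) (v t)"
        using restr_int[OF t u]
        by (intro integral_bounded_linear[OF h.bounded_linear_left])
          (simp add: lebesgue_on_integrable_iff)
      also have "(\<integral>s. (if s \<in> {0..t} then u s else 0) \<partial>?M) = integral {0..t} u"
        using restr[OF t u] restr_int[OF t u] by (simp only: lint)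
      finally show "(\<integral>s. h (u s) (v t) - indicator D (s, t) *\<^sub>R h (u s) (v t) \<partial>?M) = h (integral {0..t} u) (v t)" .
    qed
    also have "\<dots> = integral {0..x} (\<lambda>t. h (integral {0..t} u) (v t))"
      by (rule lint[OF A2])
    finally show ?thesis .
  qed
  ultimately show "h (integral {0..x} u) (integral {0..x} v) =
      integral {0..x} (\<lambda>s. h (u s) (integral {0..s} v)) +
      integral {0..x} (\<lambda>t. h (integral {0..t} u) (v t))"
    using int int1 by (simp add: algebra_simps)
qed

lemma absolutely_integrable_integrable:
  fixes f :: "'a::euclidean_space \<Rightarrow> 'b::euclidean_space"
  shows "f absolutely_integrable_on S \<Longrightarrow> f integrable_on S"
  by (simp add: absolutely_integrable_on_def)

lemma has_ac_derivD:
  assumes "has_ac_deriv f f'" "x \<ge> 0"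
  shows "f' absolutely_integrable_on {0..x}" "f' integrable_on {0..x}"
    "f x = f 0 + integral {0..x} f'"
  using assms unfolding has_ac_deriv_def
  by (blast intro: absolutely_integrable_integrable)+

lemma has_ac_deriv_cong:
  assumes "has_ac_deriv f f'" "\<And>x. x \<ge> 0 \<Longrightarrow> f x = g x" "\<And>x. x \<ge> 0 \<Longrightarrow> f' x = g' x"
  shows "has_ac_deriv g g'"
  unfolding has_ac_deriv_def
proof (intro allI impI conjI)
  fix x :: real assume x: "x \<ge> 0"
  show "g' absolutely_integrable_on {0..x}"
    by (rule absolutely_integrable_spike[OF has_ac_derivD(1)[OF assms(1) x], of "{}"])
      (use assms(3) in auto)
  have "integral {0..x} f' = integral {0..x} g'"
    by (rule hk_integral_cong) (use assms(3) in auto)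
  then show "g x = g 0 + integral {0..x} g'"
    using has_ac_derivD(3)[OF assms(1) x] assms(2)[of x] assms(2)[of 0] x by simp
qed

lemma has_ac_deriv_integral:
  assumes "\<And>x. x \<ge> 0 \<Longrightarrow> g absolutely_integrable_on {0..x}"
  shows "has_ac_deriv (\<lambda>x. c + integral {0..x} g) g"
  using assms by (simp add: has_ac_deriv_def)

lemma has_ac_deriv_linear:
  assumes h: "bounded_linear h" and f: "has_ac_deriv f f'"
  shows "has_ac_deriv (\<lambda>x. h (f x)) (\<lambda>x. h (f' x))"
  unfolding has_ac_deriv_def
proof (intro allI impI conjI)
  fix x :: real assume x: "x \<ge> 0"
  show "(\<lambda>x. h (f' x)) absolutely_integrable_on {0..x}"
    by (rule absolutely_integrable_map[OF has_ac_derivD(1)[OF f x] h])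
  have "integral {0..x} (\<lambda>x. h (f' x)) = h (integral {0..x} f')"
    by (rule integral_map(2)[OF has_ac_derivD(2)[OF f x] h])
  then show "h (f x) = h (f 0) + integral {0..x} (\<lambda>x. h (f' x))"
    using has_ac_derivD(3)[OF f x] by (simp add: linear_add[OF bounded_linear.linear[OF h]])
qed

lemma has_ac_deriv_add:
  assumes f: "has_ac_deriv f f'" and g: "has_ac_deriv g g'"
  shows "has_ac_deriv (\<lambda>x. f x + g x) (\<lambda>x. f' x + g' x)"
  unfolding has_ac_deriv_def
proof (intro allI impI conjI)
  fix x :: real assume x: "x \<ge> 0"
  show "(\<lambda>x. f' x + g' x) absolutely_integrable_on {0..x}"
    using has_ac_derivD(1)[OF f x] has_ac_derivD(1)[OF g x] by (rule set_integral_add(1))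
  show "f x + g x = f 0 + g 0 + integral {0..x} (\<lambda>x. f' x + g' x)"
    using has_ac_derivD(2,3)[OF f x] has_ac_derivD(2,3)[OF g x]
    by (simp add: hk_integral_add)
qed

lemma has_ac_deriv_diff:
  assumes f: "has_ac_deriv f f'" and g: "has_ac_deriv g g'"
  shows "has_ac_deriv (\<lambda>x. f x - g x) (\<lambda>x. f' x - g' x)"
  using has_ac_deriv_add[OF f has_ac_deriv_linear[OF bounded_linear_minus[OF bounded_linear_ident] g]]
  by simp

text \<open>
  Writing both factors as initial value plus indefinite integral reduces the Leibniz rule to the
  division of the square above.
\<close>

lemma has_ac_deriv_bilinear:
  assumes h: "bounded_bilinear h" and f: "has_ac_deriv f f'" and g: "has_ac_deriv g g'"
  shows "has_ac_deriv (\<lambda>x. h (f x) (g x)) (\<lambda>x. h (f' x) (g x) + h (f x) (g' x))"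
  unfolding has_ac_deriv_def
proof (intro allI impI)
  interpret h: bounded_bilinear h by fact
  fix x :: real assume x: "x \<ge> 0"
  note F = has_ac_derivD[OF f x] and G = has_ac_derivD[OF g x]
  define u where "u = (\<lambda>s. h (f' s) (integral {0..s} g'))"
  define v where "v = (\<lambda>t. h (integral {0..t} f') (g' t))"
  note split = integral_product_indefinite_integrals[OF h F(1) G(1), folded u_def v_def]
  have split': "u integrable_on {0..x}" "v integrable_on {0..x}"
    using split(1,2) by (auto intro: absolutely_integrable_integrable)
  have a1: "(\<lambda>s. h (f' s) (g 0)) absolutely_integrable_on {0..x}"
    by (rule absolutely_integrable_map[OF F(1) h.bounded_linear_left])
  have a2: "(\<lambda>s. h (f 0) (g' s)) absolutely_integrable_on {0..x}"
    by (rule absolutely_integrable_map[OF G(1) h.bounded_linear_right])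
  have e1: "integral {0..x} (\<lambda>s. h (f' s) (g 0)) = h (integral {0..x} f') (g 0)"
    by (rule integral_map(2)[OF F(2) h.bounded_linear_left])
  have e2: "integral {0..x} (\<lambda>s. h (f 0) (g' s)) = h (f 0) (integral {0..x} g')"
    by (rule integral_map(2)[OF G(2) h.bounded_linear_right])
  have i1: "(\<lambda>s. h (f' s) (g 0)) integrable_on {0..x}" and i2: "(\<lambda>s. h (f 0) (g' s)) integrable_on {0..x}"
    using a1 a2 by (auto intro: absolutely_integrable_integrable)
  have expand: "h (f' s) (g s) + h (f s) (g' s) = (h (f' s) (g 0) + u s) + (h (f 0) (g' s) + v s)"
    if "s \<in> {0..x}" for s
    using has_ac_derivD(3)[OF f, of s] has_ac_derivD(3)[OF g, of s] that
    by (simp add: u_def v_def h.add_left h.add_right)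
  have "(\<lambda>s. (h (f' s) (g 0) + u s) + (h (f 0) (g' s) + v s)) absolutely_integrable_on {0..x}"
    by (intro set_integral_add(1) a1 a2 split(1,2))
  then have "(\<lambda>x. h (f' x) (g x) + h (f x) (g' x)) absolutely_integrable_on {0..x}"
    by (rule absolutely_integrable_spike[of _ _ "{}"]) (use expand in auto)
  moreover have "integral {0..x} (\<lambda>x. h (f' x) (g x) + h (f x) (g' x)) =
      integral {0..x} (\<lambda>s. (h (f' s) (g 0) + u s) + (h (f 0) (g' s) + v s))"
    by (rule hk_integral_cong) (rule expand)
  moreover have "\<dots> = h (integral {0..x} f') (g 0) + integral {0..x} u +
      (h (f 0) (integral {0..x} g') + integral {0..x} v)"
    using split' i1 i2 by (simp add: hk_integral_add integrable_add e1 e2)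
  ultimately show "(\<lambda>x. h (f' x) (g x) + h (f x) (g' x)) absolutely_integrable_on {0..x} \<and>
      h (f x) (g x) = h (f 0) (g 0) + integral {0..x} (\<lambda>x. h (f' x) (g x) + h (f x) (g' x))"
    using F(3) G(3) split(3) by (simp add: h.add_left h.add_right algebra_simps)
qed

lemmas has_ac_deriv_matrix_mult = has_ac_deriv_bilinear[OF bounded_bilinear_matrix_mult]
lemmas has_ac_deriv_cscale = has_ac_deriv_bilinear[OF bounded_bilinear_cscale]

lemma has_ac_deriv_smooth:
  fixes f f' :: "real \<Rightarrow> 'a::euclidean_space"
  assumes "\<And>x. (f has_vector_derivative f' x) (at x)" "continuous_on UNIV f'"
  shows "has_ac_deriv f f'"
  unfolding has_ac_deriv_def
proof (intro allI impI conjI)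
  fix x :: real assume x: "x \<ge> 0"
  show "f' absolutely_integrable_on {0..x}"
    by (rule absolutely_integrable_continuous_real[OF continuous_on_subset[OF assms(2)]]) simp
  have "(f' has_integral (f x - f 0)) {0..x}"
    by (rule fundamental_theorem_of_calculus[OF x])
      (rule has_vector_derivative_at_within[OF assms(1)])
  then show "f x = f 0 + integral {0..x} f'"
    by (simp add: integral_unique)
qed

lemma has_ac_deriv_exp:
  "has_ac_deriv (\<lambda>x. exp (c * of_real x)) (\<lambda>x. c * exp (c * of_real x) :: complex)"
proof (rule has_ac_deriv_smooth)
  fix x :: real
  have "((\<lambda>z. exp (c * z)) has_field_derivative c * exp (c * of_real x)) (at (of_real x))"
    by (auto intro!: derivative_eq_intros)
  then show "((\<lambda>x. exp (c * of_real x)) has_vector_derivative c * exp (c * of_real x)) (at x)"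
    by (rule has_vector_derivative_real_field)
qed (intro continuous_intros)

lemma has_ac_deriv_const: "has_ac_deriv (\<lambda>x. c) (\<lambda>x. 0)"
  by (simp add: has_ac_deriv_def)

lemma has_ac_deriv_of_real: "has_ac_deriv (\<lambda>x. of_real x :: complex) (\<lambda>x. 1)"
  by (rule has_ac_deriv_smooth)
    (auto intro!: continuous_intros simp: has_vector_derivative_def bounded_linear_of_real
      intro: has_derivative_eq_rhs[OF bounded_linear_imp_has_derivative[OF bounded_linear_of_real]]
      simp: scaleR_conv_of_real)

lemma has_ac_deriv_continuous_on:
  assumes "has_ac_deriv f f'"
  shows "continuous_on {0..x} f"
proof (cases "x \<ge> 0")
  case True
  have "continuous_on {0..x} (\<lambda>x. f 0 + integral {0..x} f')"
    by (intro continuous_intros indefinite_integral_continuous_1 has_ac_derivD(2)[OF assms True])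
  then show ?thesis
    by (rule continuous_on_eq) (simp add: has_ac_derivD(3)[OF assms, symmetric])
qed simp

lemma has_ac_deriv_continuous_on_atLeast:
  assumes "has_ac_deriv f f'"
  shows "continuous_on {0..} f"
  unfolding continuous_on_eq_continuous_within
proof
  fix x :: real assume x: "x \<in> {0..}"
  have "continuous (at x within {0..x + 1}) f"
    using has_ac_deriv_continuous_on[OF assms, of "x + 1"] x
    by (auto simp: continuous_on_eq_continuous_within)
  moreover have "at x within {0..x + 1} = at x within {0..}"
    by (rule at_within_nhd[of _ "{..<x + 1}"]) auto
  ultimately show "continuous (at x within {0..}) f" by simp
qed

text \<open>
  A continuous density is a derivative at every point. In this way the derivative at \<open>0\<close> in the
  boundary condition is read off from the first-order system.
\<close>

lemma has_ac_deriv_vector_derivative: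
  assumes f: "has_ac_deriv f f'" and c: "continuous_on {0..} f'" and x: "x \<ge> 0"
  shows "vector_derivative f (at x within {0..}) = f' x"
proof (rule vector_derivative_within)
  have "((\<lambda>y. integral {0..y} f') has_vector_derivative f' x) (at x within {0..x + 1})"
    by (rule integral_has_vector_derivative[OF continuous_on_subset[OF c]]) (use x in auto)
  then have "((\<lambda>y. f 0 + integral {0..y} f') has_vector_derivative f' x) (at x within {0..x + 1})"
    by (intro derivative_eq_intros) auto
  then have "(f has_vector_derivative f' x) (at x within {0..x + 1})"
    by (rule has_vector_derivative_transform[rotated 2])
      (use x in \<open>auto simp: has_ac_derivD(3)[OF f, symmetric]\<close>)
  moreover have at: "at x within {0..x + 1} = at x within {0..}"
    by (rule at_within_nhd[of _ "{..<x + 1}"]) auto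
  ultimately show "(f has_vector_derivative f' x) (at x within {0..})"
    by simp
  have "x \<in> {0..x + 1} \<and> (0::real) < x + 1" using x by simp
  then have "at x within {0..x + 1} \<noteq> bot"
    by (metis at_within_Icc_at at_within_Icc_at_left at_within_Icc_at_right at_neq_bot
        atLeastAtMost_iff order_le_less trivial_limit_at_left_real trivial_limit_at_right_real)
  then show "at x within {0..} \<noteq> bot"
    by (simp add: at)
qed

lemma has_ac_deriv_zero_imp_constant:
  assumes "has_ac_deriv f (\<lambda>x. 0)" "x \<ge> 0"
  shows "f x = f 0"
  using has_ac_derivD(3)[OF assms] by simp

text \<open>
  Henstock's lemma makes the sum of \<open>norm (\<bar>k\<bar> g x - integral k g)\<close> over fine tagged divisions small.
  As the integrals over subintervals vanish, these sums are Riemann sums of \<open>norm g\<close>, whose integral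
  is therefore \<open>0\<close>.
\<close>

lemma indefinite_integral_zero_imp_AE_zero:
  fixes g :: "real \<Rightarrow> 'a::euclidean_space"
  assumes int: "g absolutely_integrable_on {0..b}"
    and zero: "\<And>x. x \<in> {0..b} \<Longrightarrow> integral {0..x} g = 0"
  shows "AE x in lebesgue. x \<in> {0..b} \<longrightarrow> g x = 0"
proof -
  have gi: "g integrable_on {0..b}"
    using int by (rule absolutely_integrable_integrable)
  have sub: "integral {c..d} g = 0" if "{c..d} \<subseteq> {0..b}" for c d
  proof (cases "c \<le> d")
    case True
    then have "integral {0..c} g + integral {c..d} g = integral {0..d} g"
      using that by (intro Henstock_Kurzweil_Integration.integral_combine
          integrable_subinterval_real[OF gi]) auto
    then show ?thesis using zero that True by auto
  qed simp
  have "((\<lambda>x. norm (g x)) has_integral 0) {0..b}"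
    unfolding has_integral_real
  proof (intro allI impI)
    fix e :: real assume e: "e > 0"
    obtain \<gamma> where \<gamma>: "gauge \<gamma>" and fine: "\<And>p. p tagged_partial_division_of cbox 0 b \<Longrightarrow> \<gamma> fine p \<Longrightarrow>
        (\<Sum>(x,k)\<in>p. norm (measure lborel k *\<^sub>R g x - integral k g)) < e"
      using Henstock_lemma[of g 0 b e] gi e by auto
    show "\<exists>\<gamma>. gauge \<gamma> \<and> (\<forall>p. p tagged_division_of {0..b} \<and> \<gamma> fine p \<longrightarrow>
        norm ((\<Sum>(x,k)\<in>p. measure lborel k *\<^sub>R norm (g x)) - 0) < e)"
    proof (intro exI conjI allI impI)
      fix p assume p: "p tagged_division_of {0..b} \<and> \<gamma> fine p"
      have "(\<Sum>(x,k)\<in>p. measure lborel k *\<^sub>R norm (g x)) = (\<Sum>(x,k)\<in>p. norm (measure lborel k *\<^sub>R g x - integral k g))"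
      proof (rule sum.cong, simp, clarify)
        fix x k assume xk: "(x, k) \<in> p"
        then obtain c d where k: "k = {c..d}"
          using tagged_division_ofD(4)[of p "{0..b}" x k] p by (auto simp: box_real)
        then have "integral k g = 0"
          using sub tagged_division_ofD(3)[of p "{0..b}" x k] p xk by auto
        then show "measure lborel k *\<^sub>R norm (g x) = norm (measure lborel k *\<^sub>R g x - integral k g)"
          by simp
      qed
      moreover have "(\<Sum>(x,k)\<in>p. norm (measure lborel k *\<^sub>R g x - integral k g)) < e"
        using p fine by (auto simp: tagged_division_of_def)
      moreover have "0 \<le> (\<Sum>(x,k)\<in>p. norm (measure lborel k *\<^sub>R g x - integral k g))"
        by (rule sum_nonneg) auto
      ultimately show "norm ((\<Sum>(x,k)\<in>p. measure lborel k *\<^sub>R norm (g x)) - 0) < e"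
        by simp
    qed (rule \<gamma>)
  qed
  then have "integral {0..b} (\<lambda>x. norm (g x)) = 0"
    by (rule integral_unique)
  moreover have n: "(\<lambda>x. norm (g x)) absolutely_integrable_on {0..b}"
    by (rule set_integrable_norm[OF int])
  ultimately have "integral\<^sup>L (lebesgue_on {0..b}) (\<lambda>x. norm (g x)) = 0"
    by (subst lebesgue_integral_eq_integral) (auto simp: lebesgue_on_integrable_iff)
  then have "AE x in lebesgue_on {0..b}. norm (g x) = 0"
    by (subst (asm) integral_nonneg_eq_0_iff_AE) (use n in \<open>auto simp: lebesgue_on_integrable_iff\<close>)
  then show ?thesis
    by (simp add: AE_restrict_space_iff)
qed

lemma has_ac_deriv_unique:
  fixes f f' g' :: "real \<Rightarrow> 'a::euclidean_space"
  assumes "has_ac_deriv f f'" "has_ac_deriv f g'"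
  shows "AE x in lebesgue. x > 0 \<longrightarrow> f' x = g' x"
proof -
  have d: "has_ac_deriv (\<lambda>x. 0) (\<lambda>x. f' x - g' x)"
    using has_ac_deriv_diff[OF assms] by simp
  have "AE x in lebesgue. x \<in> {0..real n} \<longrightarrow> f' x - g' x = 0" for n
    using has_ac_derivD[OF d] by (intro indefinite_integral_zero_imp_AE_zero) auto
  then have "AE x in lebesgue. \<forall>n. x \<in> {0..real n} \<longrightarrow> f' x - g' x = 0"
    by (subst AE_all_countable) blast
  then show ?thesis
  proof (rule AE_mp, intro AE_I2 impI)
    fix x :: real assume "\<forall>n. x \<in> {0..real n} \<longrightarrow> f' x - g' x = 0" "x > 0"
    moreover obtain n where "x \<le> real n" using real_arch_simple by blast
    ultimately show "f' x = g' x" by auto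
  qed
qed

section \<open>Integral equations with a small kernel\<close>

lemma absolutely_integrable_bilinear:
  fixes h :: "'a::euclidean_space \<Rightarrow> 'b::euclidean_space \<Rightarrow> 'c::euclidean_space"
    and f :: "real \<Rightarrow> 'a"
  assumes h: "bounded_bilinear h" and X: "X \<in> sets lebesgue"
    and f: "f \<in> borel_measurable (lebesgue_on X)" "\<And>t. t \<in> X \<Longrightarrow> norm (f t) \<le> B"
    and g: "g absolutely_integrable_on X"
  shows "(\<lambda>t. h (f t) (g t)) absolutely_integrable_on X"
  by (rule absolutely_integrable_bounded_measurable_product)
    (use assms in \<open>auto simp: bilinear_conv_bounded_bilinear bounded_iff\<close>)

text \<open>
  Cauchy's inequality on discs of radius \<open>r\<close> bounds all difference quotients near a point by \<open>g / r\<close>,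
  so dominated convergence allows differentiation under the integral sign.
\<close>

lemma holomorphic_on_integral:
  fixes f :: "complex \<Rightarrow> real \<Rightarrow> complex"
  assumes D: "open D"
    and hol: "\<And>t. t \<in> X \<Longrightarrow> (\<lambda>z. f z t) holomorphic_on D"
    and int: "\<And>z. z \<in> D \<Longrightarrow> f z integrable_on X"
    and bound: "\<And>z t. z \<in> D \<Longrightarrow> t \<in> X \<Longrightarrow> norm (f z t) \<le> g t"
    and g: "g integrable_on X"
  shows "(\<lambda>z. integral X (f z)) holomorphic_on D"
  unfolding holomorphic_on_def
proof
  fix z assume z: "z \<in> D"
  obtain e where e: "e > 0" "ball z e \<subseteq> D"
    using D z open_contains_ball by blast
  \<comment> \<open>a disc of radius \<open>r\<close> about a point of \<open>ball z r\<close> stays inside \<open>ball z e\<close>\<close>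
  define r where "r = e / 3"
  have r: "r > 0" using e by (simp add: r_def)
  have cball_sub: "cball u r \<subseteq> D" if "u \<in> ball z r" for u
  proof -
    have "cball u r \<subseteq> ball z e"
    proof
      fix v assume "v \<in> cball u r"
      with that have "dist z u < r" "dist u v \<le> r" by auto
      then have "dist z v < e"
        using dist_triangle[of z v u] e(1) by (simp add: r_def)
      then show "v \<in> ball z e" by simp
    qed
    then show ?thesis using e by blast
  qed
  have sub: "ball z r \<subseteq> D"
    using cball_sub r by (meson centre_in_cball less_imp_le subset_iff)
  have quotient: "norm ((f w t - f z t) / (w - z)) \<le> g t / r"
    if t: "t \<in> X" and w: "w \<in> ball z r" "w \<noteq> z" for w t
  proof -
    have "norm (f w t - f z t) \<le> (g t / r) * norm (w - z)"
    proof (rule field_differentiable_bound[of "ball z r"])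
      fix u assume u: "u \<in> ball z r"
      then have uD: "u \<in> D" using sub by blast
      have "(\<lambda>z. f z t) field_differentiable at u"
        using hol[OF t] uD D holomorphic_on_imp_differentiable_at by blast
      then show "((\<lambda>z. f z t) has_field_derivative deriv (\<lambda>z. f z t) u) (at u within ball z r)"
        using DERIV_deriv_iff_field_differentiable has_field_derivative_at_within by blast
      have hc: "(\<lambda>z. f z t) holomorphic_on cball u r"
        by (rule holomorphic_on_subset[OF hol[OF t] cball_sub[OF u]])
      have "norm ((deriv ^^ 1) (\<lambda>z. f z t) u) \<le> fact 1 * g t / r ^ 1"
      proof (rule Cauchy_inequality)
        show "(\<lambda>z. f z t) holomorphic_on ball u r"
          by (rule holomorphic_on_subset[OF hc]) auto
        show "continuous_on (cball u r) (\<lambda>z. f z t)"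
          by (rule holomorphic_on_imp_continuous_on[OF hc])
        show "norm (f v t) \<le> g t" if "norm (u - v) = r" for v
          using bound[OF _ t] cball_sub[OF u] that by (auto simp: dist_norm)
      qed (rule r)
      then show "norm (deriv (\<lambda>z. f z t) u) \<le> g t / r" by simp
    qed (use w r in auto)
    then show ?thesis
      using w r by (simp add: norm_divide divide_simps mult_ac)
  qed
  define L where "L = integral X (\<lambda>t. deriv (\<lambda>z. f z t) z)"
  have "((\<lambda>z. integral X (f z)) has_field_derivative L) (at z)"
    unfolding has_field_derivative_iff tendsto_at_iff_sequentially comp_def
  proof (intro allI impI)
    fix w assume wz: "\<forall>i. w i \<in> UNIV - {z}" and lim: "w \<longlonglongrightarrow> z"
    have "\<forall>\<^sub>F i in sequentially. w i \<in> ball z r"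
      by (rule topological_tendstoD[OF lim]) (use r in auto)
    then obtain N where N: "\<And>i. i \<ge> N \<Longrightarrow> w i \<in> ball z r"
      unfolding eventually_sequentially by blast
    define w' where "w' i = w (i + N)" for i
    have w': "w' i \<in> ball z r" "w' i \<in> D" "w' i \<noteq> z" for i
      using N[of "i + N"] sub wz by (auto simp: w'_def)
    have lim': "w' \<longlonglongrightarrow> z"
      unfolding w'_def by (rule LIMSEQ_ignore_initial_segment[OF lim])
    have "(\<lambda>i. integral X (\<lambda>t. (f (w' i) t - f z t) / (w' i - z))) \<longlonglongrightarrow> L"
      unfolding L_def
    proof (rule dominated_convergence(2))
      show "(\<lambda>t. (f (w' i) t - f z t) / (w' i - z)) integrable_on X" for i
        using int[OF w'(2)] int[OF z] by (intro integrable_on_divide integrable_diff)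
      show "(\<lambda>t. g t / r) integrable_on X"
        using g by (rule integrable_on_divide)
      show "norm ((f (w' i) t - f z t) / (w' i - z)) \<le> g t / r" if "t \<in> X" for i t
        by (rule quotient[OF that w'(1,3)])
      show "(\<lambda>i. (f (w' i) t - f z t) / (w' i - z)) \<longlonglongrightarrow> deriv (\<lambda>z. f z t) z" if "t \<in> X" for t
      proof -
        have "((\<lambda>z. f z t) has_field_derivative deriv (\<lambda>z. f z t) z) (at z)"
          using hol[OF that] z D holomorphic_derivI by blast
        then have "((\<lambda>w. (f w t - f z t) / (w - z)) \<longlongrightarrow> deriv (\<lambda>z. f z t) z) (at z)"
          by (simp add: has_field_derivative_iff)
        then show ?thesis
          unfolding tendsto_at_iff_sequentially comp_def using w'(3) lim' by simp
      qed
    qed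
    also have "(\<lambda>i. integral X (\<lambda>t. (f (w' i) t - f z t) / (w' i - z))) =
        (\<lambda>i. (integral X (f (w' i)) - integral X (f z)) / (w' i - z))"
      using int w'(2) z by (simp add: hk_integral_diff)
    finally have "(\<lambda>i. (integral X (f (w (i + N))) - integral X (f z)) / (w (i + N) - z)) \<longlonglongrightarrow> L"
      by (simp add: w'_def)
    then show "(\<lambda>i. (integral X (f (w i)) - integral X (f z)) / (w i - z)) \<longlonglongrightarrow> L"
      by (rule LIMSEQ_offset)
  qed
  then show "(\<lambda>z. integral X (f z)) field_differentiable at z within D"
    using field_differentiable_at_within field_differentiable_def by blast
qed

text \<open>
  An estimate of a bounded function in terms of itself becomes an a priori bound, since the supremum
  \<open>B\<close> satisfies \<open>B \<le> m + B / 2\<close>.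
\<close>

lemma halving_bound:
  fixes f :: "'a \<Rightarrow> real"
  assumes bdd: "\<And>x. x \<in> X \<Longrightarrow> f x \<le> B0"
    and step: "\<And>B. (\<And>x. x \<in> X \<Longrightarrow> f x \<le> B) \<Longrightarrow> (\<And>x. x \<in> X \<Longrightarrow> f x \<le> m + B / 2)"
    and x: "x \<in> X"
  shows "f x \<le> 2 * m"
proof -
  have bdd': "bdd_above (f ` X)" using bdd by (auto intro!: bdd_aboveI)
  have "f y \<le> m + Sup (f ` X) / 2" if "y \<in> X" for y
    by (rule step[OF _ that]) (use bdd' in \<open>auto intro: cSup_upper\<close>)
  then have "Sup (f ` X) \<le> m + Sup (f ` X) / 2"
    using x by (intro cSup_least) auto
  moreover have "f x \<le> Sup (f ` X)"
    using x bdd' by (auto intro: cSup_upper)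
  ultimately show ?thesis by simp
qed

text \<open>
  Equations \<open>f = f0 + \<integral> K G f\<close> whose integral operator has norm at most \<open>1/2\<close> on bounded continuous
  functions. The scalar kernel \<open>K\<close> carries the dependence on \<open>x\<close>; the parameter \<open>z\<close> enters through the
  matrix factor \<open>G\<close> alone, with one dominating function \<open>g\<close> for all \<open>z\<close>, which makes the solution
  holomorphic in \<open>z\<close>. After division by a suitable exponential, the Jost equation on the half-line and
  initial value problems on a bounded interval are of this form.
\<close>

locale small_kernel =
  fixes X :: "real set" and K :: "real \<Rightarrow> real \<Rightarrow> complex" and c :: real
    and D :: "complex set" and G :: "complex \<Rightarrow> real \<Rightarrow> complex^'n^'n" and g :: "real \<Rightarrow> real"
    and f0 :: "real \<Rightarrow> complex^'n^'n" and m :: real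
  assumes X: "X \<in> sets lebesgue"
    and K_measurable: "x \<in> X \<Longrightarrow> K x \<in> borel_measurable (lebesgue_on X)"
    and K_bound: "x \<in> X \<Longrightarrow> t \<in> X \<Longrightarrow> norm (K x t) \<le> c"
    and K_continuous: "t \<in> X \<Longrightarrow> continuous_on X (\<lambda>x. K x t)"
    and D: "open D"
    and G_integrable: "z \<in> D \<Longrightarrow> G z absolutely_integrable_on X"
    and G_bound: "z \<in> D \<Longrightarrow> t \<in> X \<Longrightarrow> norm (G z t) \<le> g t"
    and G_holomorphic: "t \<in> X \<Longrightarrow> (\<lambda>z. G z t $ i $ j) holomorphic_on D"
    and g_integrable: "g integrable_on X"
    and small: "c \<ge> 0" "c * integral X g \<le> 1 / 2"
    and f0_continuous: "continuous_on X f0"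
    and f0_bound: "x \<in> X \<Longrightarrow> norm (f0 x) \<le> m"
begin

definition T :: "complex \<Rightarrow> (real \<Rightarrow> complex^'n^'n) \<Rightarrow> real \<Rightarrow> complex^'n^'n"
  where "T z f x = integral X (\<lambda>t. K x t *\<^sub>C (G z t ** f t))"

lemma integrand_integrable:
  fixes f :: "real \<Rightarrow> complex^'n^'n"
  assumes z: "z \<in> D" and x: "x \<in> X" and f: "continuous_on X f" "\<And>t. t \<in> X \<Longrightarrow> norm (f t) \<le> B"
  shows "(\<lambda>t. K x t *\<^sub>C (G z t ** f t)) absolutely_integrable_on X"
proof (rule absolutely_integrable_bilinear[OF bounded_bilinear_cscale X
      K_measurable[OF x] K_bound[OF x]])
  show "(\<lambda>t. G z t ** f t) absolutely_integrable_on X"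
    by (rule absolutely_integrable_bilinear[OF
          bounded_bilinear.flip[OF bounded_bilinear_matrix_mult] X _ f(2) G_integrable[OF z]])
      (rule continuous_imp_measurable_on_sets_lebesgue[OF f(1) X])
qed

lemma integrand_bound:
  fixes f :: "real \<Rightarrow> complex^'n^'n"
  assumes z: "z \<in> D" and x: "x \<in> X" and t: "t \<in> X" and f: "norm (f t) \<le> B"
  shows "norm (K x t *\<^sub>C (G z t ** f t)) \<le> c * B * g t"
proof -
  have "norm (G z t ** f t) \<le> g t * B"
    by (rule order_trans[OF norm_matrix_mult_le])
      (use G_bound[OF z t] f in \<open>auto intro!: mult_mono order_trans[OF norm_ge_zero]\<close>)
  then have "norm (K x t *\<^sub>C (G z t ** f t)) \<le> c * (g t * B)"
    unfolding norm_cscale by (intro mult_mono K_bound x t small) auto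
  then show ?thesis by (simp add: mult_ac)
qed

text \<open>Smallness of the kernel enters here: each application of the operator halves the bound.\<close>

lemma T_bound:
  fixes f :: "real \<Rightarrow> complex^'n^'n"
  assumes z: "z \<in> D" and x: "x \<in> X" and f: "continuous_on X f" "\<And>t. t \<in> X \<Longrightarrow> norm (f t) \<le> B"
  shows "norm (T z f x) \<le> B / 2"
proof -
  have B: "B \<ge> 0" using f(2)[OF x] norm_ge_zero order_trans by blast
  have "norm (T z f x) \<le> integral X (\<lambda>t. c * B * g t)"
    unfolding T_def
    using integrand_bound[OF z x] f(2) g_integrable integrand_integrable[OF z x f]
    by (intro integral_norm_bound_integral integrable_on_mult_right)
      (auto intro: absolutely_integrable_integrable)
  also have "\<dots> = B * (c * integral X g)"
    by (simp add: mult_ac)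
  also have "\<dots> \<le> B * (1 / 2)"
    by (rule mult_left_mono[OF small(2) B])
  finally show ?thesis by simp
qed

lemma T_continuous:
  fixes f :: "real \<Rightarrow> complex^'n^'n"
  assumes z: "z \<in> D" and f: "continuous_on X f" "\<And>t. t \<in> X \<Longrightarrow> norm (f t) \<le> B"
  shows "continuous_on X (T z f)"
  unfolding continuous_on_sequentially comp_def T_def
proof (intro allI ballI impI)
  fix x y assume y: "y \<in> X" and x: "(\<forall>n. x n \<in> X) \<and> x \<longlonglongrightarrow> y"
  show "(\<lambda>n. integral X (\<lambda>t. K (x n) t *\<^sub>C (G z t ** f t))) \<longlonglongrightarrow> integral X (\<lambda>t. K y t *\<^sub>C (G z t ** f t))"
  proof (rule dominated_convergence(2))
    show "(\<lambda>t. K (x n) t *\<^sub>C (G z t ** f t)) integrable_on X" for n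
      using x by (intro absolutely_integrable_integrable integrand_integrable[OF z _ f]) auto
    show "(\<lambda>t. c * B * g t) integrable_on X"
      by (intro integrable_on_mult_right g_integrable)
    show "norm (K (x n) t *\<^sub>C (G z t ** f t)) \<le> c * B * g t" if "t \<in> X" for n t
      using x by (intro integrand_bound z f that) auto
    show "(\<lambda>n. K (x n) t *\<^sub>C (G z t ** f t)) \<longlonglongrightarrow> K y t *\<^sub>C (G z t ** f t)" if "t \<in> X" for t
      using K_continuous[OF that] x y unfolding continuous_on_sequentially comp_def
      by (intro tendsto_intros) auto
  qed
qed

lemma T_diff:
  fixes f f' :: "real \<Rightarrow> complex^'n^'n"
  assumes z: "z \<in> D" and x: "x \<in> X"
    and f: "continuous_on X f" "\<And>t. t \<in> X \<Longrightarrow> norm (f t) \<le> B"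
    and f': "continuous_on X f'" "\<And>t. t \<in> X \<Longrightarrow> norm (f' t) \<le> B'"
  shows "T z (\<lambda>t. f t - f' t) x = T z f x - T z f' x"
  unfolding T_def cmatrix_simps
  by (intro hk_integral_diff absolutely_integrable_integrable integrand_integrable[OF z x f]
      integrand_integrable[OF z x f'])

lemma T_holomorphic:
  fixes f :: "complex \<Rightarrow> real \<Rightarrow> complex^'n^'n"
  assumes x: "x \<in> X" and f: "\<And>z. z \<in> D \<Longrightarrow> continuous_on X (f z)"
    "\<And>z t. z \<in> D \<Longrightarrow> t \<in> X \<Longrightarrow> norm (f z t) \<le> B"
    and hol: "\<And>t i j. t \<in> X \<Longrightarrow> (\<lambda>z. f z t $ i $ j) holomorphic_on D"
  shows "(\<lambda>z. T z (f z) x $ i $ j) holomorphic_on D"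
proof -
  have int: "(\<lambda>t. K x t *\<^sub>C (G z t ** f z t)) integrable_on X" if "z \<in> D" for z
    by (intro absolutely_integrable_integrable integrand_integrable[OF that x f(1) f(2)] that)
  have "(\<lambda>z. integral X (\<lambda>t. (K x t *\<^sub>C (G z t ** f z t)) $ i $ j)) holomorphic_on D"
  proof (rule holomorphic_on_integral[OF D])
    show "(\<lambda>z. (K x t *\<^sub>C (G z t ** f z t)) $ i $ j) holomorphic_on D" if "t \<in> X" for t
      unfolding matrix_matrix_mult_def
      by (simp add: sum_distrib_left) (intro holomorphic_intros G_holomorphic hol that)
    show "(\<lambda>t. (K x t *\<^sub>C (G z t ** f z t)) $ i $ j) integrable_on X" if "z \<in> D" for z
      by (rule integral_entry(1)[OF int[OF that]])
    show "norm ((K x t *\<^sub>C (G z t ** f z t)) $ i $ j) \<le> c * B * g t" if "z \<in> D" "t \<in> X" for z t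
    proof -
      have "norm ((K x t *\<^sub>C (G z t ** f z t)) $ i $ j) \<le> norm (K x t *\<^sub>C (G z t ** f z t))"
        by (rule order_trans[OF Finite_Cartesian_Product.norm_nth_le Finite_Cartesian_Product.norm_nth_le])
      also have "\<dots> \<le> c * B * g t"
        by (rule integrand_bound[where f="f z", OF that(1) x that(2) f(2)[OF that]])
      finally show ?thesis .
    qed
    show "(\<lambda>t. c * B * g t) integrable_on X"
      by (intro integrable_on_mult_right g_integrable)
  qed
  moreover have "integral X (\<lambda>t. (K x t *\<^sub>C (G z t ** f z t)) $ i $ j) = T z (f z) x $ i $ j" if "z \<in> D" for z
    unfolding T_def by (rule integral_entry(2)[OF int[OF that]])
  ultimately show ?thesis
    using holomorphic_transform by (metis (no_types, lifting))
qed

text \<open>The terms of the Neumann series, not its partial sums.\<close>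

primrec picard :: "nat \<Rightarrow> complex \<Rightarrow> real \<Rightarrow> complex^'n^'n" where
  "picard 0 z = f0"
| "picard (Suc k) z = T z (picard k z)"

lemma picard_continuous_bound:
  assumes z: "z \<in> D"
  shows "continuous_on X (picard k z) \<and> (\<forall>x\<in>X. norm (picard k z x) \<le> m * (1 / 2) ^ k)"
proof (induction k)
  case (Suc k)
  show ?case
    using T_continuous[OF z, of "picard k z" "m * (1 / 2) ^ k"]
      T_bound[OF z, of _ "picard k z" "m * (1 / 2) ^ k"] Suc by auto
qed (use f0_continuous f0_bound in auto)

lemma picard_holomorphic: "x \<in> X \<Longrightarrow> (\<lambda>z. picard k z x $ i $ j) holomorphic_on D"
proof (induction k arbitrary: x i j)
  case (Suc k)
  show ?case
    unfolding picard.simps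
    by (rule T_holomorphic[OF Suc.prems _ _ Suc.IH]) (use picard_continuous_bound[of _ k] in auto)
qed simp

definition solution :: "complex \<Rightarrow> real \<Rightarrow> complex^'n^'n"
  where "solution z x = (\<Sum>k. picard k z x)"

text \<open>
  Uniformity in \<open>z\<close> and \<open>x\<close> together passes continuity in \<open>x\<close> and holomorphy in \<open>z\<close> on to the limit.
\<close>

lemma solution_uniform_limit:
  "uniform_limit (D \<times> X) (\<lambda>N (z, x). \<Sum>k<N. picard k z x) (\<lambda>(z, x). solution z x) sequentially"
proof -
  have "uniform_limit (D \<times> X) (\<lambda>N p. \<Sum>k<N. picard k (fst p) (snd p))
      (\<lambda>p. \<Sum>k. picard k (fst p) (snd p)) sequentially"
    by (rule Weierstrass_m_test[where M="\<lambda>k. m * (1 / 2) ^ k"])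
      (use picard_continuous_bound in \<open>auto intro!: summable_mult summable_geometric\<close>)
  then show ?thesis by (simp add: solution_def case_prod_unfold)
qed

lemma solution_uniform_limit_at:
  assumes "z \<in> D"
  shows "uniform_limit X (\<lambda>N x. \<Sum>k<N. picard k z x) (solution z) sequentially"
proof (rule uniform_limitI)
  fix e :: real assume "e > 0"
  then have "\<forall>\<^sub>F N in sequentially. \<forall>p\<in>D \<times> X. dist (case p of (z, x) \<Rightarrow> \<Sum>k<N. picard k z x) (case p of (z, x) \<Rightarrow> solution z x) < e"
    by (rule uniform_limitD[OF solution_uniform_limit])
  then show "\<forall>\<^sub>F N in sequentially. \<forall>x\<in>X. dist (\<Sum>k<N. picard k z x) (solution z x) < e"
    by (rule eventually_mono) (use assms in auto)
qed

lemma solution_continuous: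
  assumes z: "z \<in> D"
  shows "continuous_on X (solution z)"
  by (rule uniform_limit_theorem[OF _ solution_uniform_limit_at[OF z]])
    (use picard_continuous_bound[OF z] in \<open>auto intro!: always_eventually continuous_on_sum\<close>)

lemma picard_sum_bound:
  assumes z: "z \<in> D" and x: "x \<in> X"
  shows "norm (\<Sum>k<N. picard k z x) \<le> 2 * m"
proof -
  have m: "m \<ge> 0" using f0_bound[OF x] norm_ge_zero order_trans by blast
  have geo: "(\<Sum>k<N. (1 / 2 :: real) ^ k) \<le> 2"
    by (subst geometric_sum) (auto simp: field_simps)
  have "norm (\<Sum>k<N. picard k z x) \<le> (\<Sum>k<N. m * (1 / 2) ^ k)"
    by (rule sum_norm_le) (use picard_continuous_bound[OF z] x in auto)
  also have "\<dots> = (\<Sum>k<N. (1 / 2) ^ k) * m"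
    by (simp add: sum_distrib_left mult.commute)
  also have "\<dots> \<le> 2 * m"
    by (rule mult_right_mono[OF geo m])
  finally show ?thesis .
qed

lemma solution_bound:
  assumes z: "z \<in> D" and x: "x \<in> X"
  shows "norm (solution z x) \<le> 2 * m"
proof (rule tendsto_upperbound)
  show "((\<lambda>N. norm (\<Sum>k<N. picard k z x)) \<longlongrightarrow> norm (solution z x)) sequentially"
    by (intro tendsto_norm tendsto_uniform_limitI[OF solution_uniform_limit_at[OF z] x])
qed (use picard_sum_bound[OF z x] in \<open>auto intro!: always_eventually\<close>)

lemma solution_equation:
  assumes z: "z \<in> D" and x: "x \<in> X"
  shows "solution z x = f0 x + integral X (\<lambda>t. K x t *\<^sub>C (G z t ** solution z t))"
proof -
  define S where "S N t = (\<Sum>k<N. picard k z t)" for N t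
  have Sc: "continuous_on X (S N)" and Sb: "t \<in> X \<Longrightarrow> norm (S N t) \<le> 2 * m" for N t
    unfolding S_def using picard_continuous_bound[OF z] picard_sum_bound[OF z] by (auto intro!: continuous_on_sum)
  have rec: "S (Suc N) x = f0 x + T z (S N) x" if "x \<in> X" for N x
  proof (induction N)
    case 0
    then show ?case by (simp add: S_def T_def)
  next
    case (Suc N)
    have "T z (S (Suc N)) x - T z (S N) x = T z (\<lambda>t. S (Suc N) t - S N t) x"
      by (rule T_diff[OF z that Sc Sb Sc Sb, symmetric])
    also have "\<dots> = picard (Suc N) z x" by (simp add: S_def)
    finally have "T z (S (Suc N)) x = T z (S N) x + picard (Suc N) z x"
      by (simp only: diff_eq_eq add.commute)
    moreover have "S (Suc (Suc N)) x = S (Suc N) x + picard (Suc N) z x"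
      unfolding S_def by simp
    ultimately show ?case using Suc.IH by (simp only: add.assoc)
  qed
  have l1: "(\<lambda>N. S N x) \<longlonglongrightarrow> solution z x"
    unfolding S_def by (rule tendsto_uniform_limitI[OF solution_uniform_limit_at[OF z] x])
  have "(\<lambda>N. T z (S N) x) \<longlonglongrightarrow> T z (solution z) x"
  proof (rule LIMSEQ_I)
    fix e :: real assume e: "e > 0"
    have "\<forall>\<^sub>F N in sequentially. \<forall>x\<in>X. dist (S N x) (solution z x) < e"
      unfolding S_def by (rule uniform_limitD[OF solution_uniform_limit_at[OF z] e])
    then obtain M where M: "\<And>N t. N \<ge> M \<Longrightarrow> t \<in> X \<Longrightarrow> dist (S N t) (solution z t) < e"
      unfolding eventually_sequentially by blast
    show "\<exists>M. \<forall>N\<ge>M. norm (T z (S N) x - T z (solution z) x) < e"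
    proof (intro exI allI impI)
      fix N assume N: "N \<ge> M"
      have "norm (T z (\<lambda>t. S N t - solution z t) x) \<le> e / 2"
        by (rule T_bound[OF z x])
          (use M[OF N] in \<open>auto intro!: continuous_intros Sc solution_continuous[OF z] less_imp_le
            simp: dist_norm\<close>)
      also have "T z (\<lambda>t. S N t - solution z t) x = T z (S N) x - T z (solution z) x"
        by (rule T_diff[OF z x Sc Sb solution_continuous[OF z] solution_bound[OF z]])
      finally show "norm (T z (S N) x - T z (solution z) x) < e"
        using e by simp
    qed
  qed
  then have "(\<lambda>N. S (Suc N) x) \<longlonglongrightarrow> f0 x + T z (solution z) x"
    unfolding rec[OF x] by (intro tendsto_intros)
  then have "solution z x = f0 x + T z (solution z) x"
    using LIMSEQ_Suc[OF l1] LIMSEQ_unique by blast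
  then show ?thesis by (simp add: T_def)
qed

text \<open>The difference of two solutions is a fixed point of the operator, which halves every bound.\<close>

lemma solution_unique:
  assumes z: "z \<in> D" and f: "continuous_on X f" "\<And>x. x \<in> X \<Longrightarrow> norm (f x) \<le> B"
    and eq: "\<And>x. x \<in> X \<Longrightarrow> f x = f0 x + integral X (\<lambda>t. K x t *\<^sub>C (G z t ** f t))" and x: "x \<in> X"
  shows "f x = solution z x"
proof -
  note sol = solution_continuous[OF z] solution_bound[OF z]
  define d where "d t = f t - solution z t" for t
  have dc: "continuous_on X d"
    unfolding d_def by (intro continuous_intros f sol)
  have dT: "d y = T z d y" if y: "y \<in> X" for y
  proof -
    have "d y = T z f y - T z (solution z) y"
      unfolding d_def T_def by (subst eq[OF y], subst solution_equation[OF z y]) simp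
    then show ?thesis
      unfolding d_def by (simp only: T_diff[OF z y f sol])
  qed
  have "norm (d x) \<le> 2 * 0"
  proof (rule halving_bound[of X "\<lambda>t. norm (d t)" "B + 2 * m"])
    show "norm (d y) \<le> B + 2 * m" if "y \<in> X" for y
      unfolding d_def by (rule order_trans[OF norm_triangle_ineq4 add_mono[OF f(2) sol(2)]]) fact+
    show "norm (d y) \<le> 0 + B' / 2" if "\<And>t. t \<in> X \<Longrightarrow> norm (d t) \<le> B'" "y \<in> X" for B' y
      using T_bound[OF z that(2) dc that(1)] dT[OF that(2)] by simp
  qed (rule x)
  then show ?thesis by (simp add: d_def)
qed

lemma solution_holomorphic:
  assumes x: "x \<in> X"
  shows "(\<lambda>z. solution z x $ i $ j) holomorphic_on D"
proof (rule holomorphic_uniform_sequence[OF D])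
  show "(\<lambda>z. (\<Sum>k<N. picard k z x) $ i $ j) holomorphic_on D" for N
    by simp (intro holomorphic_intros picard_holomorphic x)
  fix z assume "z \<in> D"
  then obtain d where d: "d > 0" "cball z d \<subseteq> D"
    using D open_contains_cball by blast
  have "uniform_limit (cball z d) (\<lambda>N z. (\<Sum>k<N. picard k z x) $ i $ j) (\<lambda>z. solution z x $ i $ j) sequentially"
  proof (rule uniform_limitI)
    fix e :: real assume "e > 0"
    then have "\<forall>\<^sub>F N in sequentially. \<forall>p\<in>D \<times> X. dist (case p of (z, x) \<Rightarrow> \<Sum>k<N. picard k z x) (case p of (z, x) \<Rightarrow> solution z x) < e"
      by (rule uniform_limitD[OF solution_uniform_limit])
    then show "\<forall>\<^sub>F N in sequentially. \<forall>z\<in>cball z d. dist ((\<Sum>k<N. picard k z x) $ i $ j) (solution z x $ i $ j) < e"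
    proof (rule eventually_mono, intro ballI)
      fix N w
      assume N: "\<forall>p\<in>D \<times> X. dist (case p of (z, x) \<Rightarrow> \<Sum>k<N. picard k z x) (case p of (z, x) \<Rightarrow> solution z x) < e"
        and w: "w \<in> cball z d"
      have "(w, x) \<in> D \<times> X" using w d x by blast
      with N have "dist (\<Sum>k<N. picard k w x) (solution w x) < e" by fastforce
      then show "dist ((\<Sum>k<N. picard k w x) $ i $ j) (solution w x $ i $ j) < e"
        by (meson dist_vec_nth_le order_le_less_trans)
    qed
  qed
  then show "\<exists>d>0. cball z d \<subseteq> D \<and> uniform_limit (cball z d) (\<lambda>N z. (\<Sum>k<N. picard k z x) $ i $ j) (\<lambda>z. solution z x $ i $ j) sequentially"
    using d by blast
qed

end

section \<open>Solutions of the Schroedinger equation\<close>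

text \<open>
  For \<open>\<rho>\<close> in the upper half-plane, \<open>ew\<close> and its square \<open>ew2\<close> decay as \<open>x \<rightarrow> \<infinity>\<close>, while \<open>ew_inv\<close> grows.
\<close>

abbreviation ew :: "complex \<Rightarrow> real \<Rightarrow> complex"
  where "ew \<rho> x \<equiv> exp (\<i> * \<rho> * of_real x)"

abbreviation ew_inv :: "complex \<Rightarrow> real \<Rightarrow> complex"
  where "ew_inv \<rho> x \<equiv> exp (- (\<i> * \<rho>) * of_real x)"

abbreviation ew2 :: "complex \<Rightarrow> real \<Rightarrow> complex"
  where "ew2 \<rho> x \<equiv> exp (2 * \<i> * \<rho> * of_real x)"

text \<open>
  The equation \<open>-Y'' + Q Y = z Y\<close> as a first-order system for the pair \<open>(Y, Y1)\<close>; for integrable \<open>Q\<close> the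
  derivative of \<open>Y1\<close> exists only almost everywhere.
\<close>

definition solves :: "(real \<Rightarrow> complex^'n^'n) \<Rightarrow> complex \<Rightarrow> (real \<Rightarrow> complex^'n^'n) \<Rightarrow>
    (real \<Rightarrow> complex^'n^'n) \<Rightarrow> bool"
  where "solves Q z Y Y1 \<longleftrightarrow>
    has_ac_deriv Y Y1 \<and> has_ac_deriv Y1 (\<lambda>x. Q x ** Y x - z *\<^sub>C Y x)"

text \<open>
  Variation of constants: the densities of \<open>a\<close> and \<open>b\<close> satisfy \<open>ew a' + ew_inv b' = 0\<close> and
  \<open>i\<rho> (ew a' - ew_inv b') = Q Y\<close>.
\<close>

lemma solves_wave:
  fixes a b Y :: "real \<Rightarrow> complex^'n^'n"
  assumes \<rho>: "\<rho> \<noteq> 0"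
    and a: "has_ac_deriv a (\<lambda>x. (ew_inv \<rho> x / (2 * \<i> * \<rho>)) *\<^sub>C (Q x ** Y x))"
    and b: "has_ac_deriv b (\<lambda>x. (- ew \<rho> x / (2 * \<i> * \<rho>)) *\<^sub>C (Q x ** Y x))"
    and Y: "\<And>x. x \<ge> 0 \<Longrightarrow> Y x = ew \<rho> x *\<^sub>C a x + ew_inv \<rho> x *\<^sub>C b x"
    and Y1: "\<And>x. x \<ge> 0 \<Longrightarrow> Y1 x = (\<i> * \<rho>) *\<^sub>C
      (ew \<rho> x *\<^sub>C a x - ew_inv \<rho> x *\<^sub>C b x)"
  shows "solves Q (\<rho>\<^sup>2) Y Y1"
proof -
  note p = has_ac_deriv_cscale[OF has_ac_deriv_exp[of "\<i> * \<rho>"] a]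
  note n = has_ac_deriv_cscale[OF has_ac_deriv_exp[of "- (\<i> * \<rho>)"] b]
  have e: "ew_inv \<rho> x = inverse (ew \<rho> x)" for x
    by (simp add: exp_minus)
  have "has_ac_deriv Y Y1"
    by (rule has_ac_deriv_cong[OF has_ac_deriv_add[OF p n]])
      (use \<rho> in \<open>auto simp: Y Y1 vec_eq_iff e field_simps\<close>)
  moreover have "has_ac_deriv Y1 (\<lambda>x. Q x ** Y x - (\<rho>\<^sup>2) *\<^sub>C Y x)"
  proof (rule has_ac_deriv_cong[OF has_ac_deriv_linear[OF bounded_linear_cscale[of "\<i> * \<rho>"]
          has_ac_deriv_diff[OF p n]]])
    fix x :: real assume x: "x \<ge> 0"
    define V where "V = Q x ** Y x"
    show "(\<i> * \<rho>) *\<^sub>C ((\<i> * \<rho> * ew \<rho> x) *\<^sub>C a x +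
        ew \<rho> x *\<^sub>C (ew_inv \<rho> x / (2 * \<i> * \<rho>)) *\<^sub>C (Q x ** Y x) -
        ((- (\<i> * \<rho>) * ew_inv \<rho> x) *\<^sub>C b x +
        ew_inv \<rho> x *\<^sub>C (- ew \<rho> x / (2 * \<i> * \<rho>)) *\<^sub>C (Q x ** Y x))) =
      Q x ** Y x - \<rho>\<^sup>2 *\<^sub>C Y x"
      unfolding V_def[symmetric] Y[OF x] e
      using \<rho> by (auto simp: vec_eq_iff field_simps power2_eq_square)
  qed (simp add: Y1)
  ultimately show ?thesis by (simp add: solves_def)
qed

section \<open>The Jost solution\<close>

lemma integral_eq_on_support:
  fixes f :: "'a::euclidean_space \<Rightarrow> 'b::banach"
  assumes "S \<subseteq> T" "\<And>t. t \<in> T - S \<Longrightarrow> f t = 0"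
  shows "integral S f = integral T f"
proof -
  have "integral T f = integral T (\<lambda>t. if t \<in> S then f t else 0)"
    by (rule hk_integral_cong) (use assms in auto)
  also have "\<dots> = integral S f"
    using assms(1) by (simp add: integral_restrict_Int Int_absorb2)
  finally show ?thesis by simp
qed

lemma absolutely_integrable_on_Ioi_iff:
  fixes f :: "real \<Rightarrow> 'a::euclidean_space"
  shows "f absolutely_integrable_on {0<..} \<longleftrightarrow> f absolutely_integrable_on {0..}"
  by (rule absolutely_integrable_spike_set_eq; rule negligible_subset[OF negligible_sing[of 0]]; force)

locale potential =
  fixes Q :: "real \<Rightarrow> complex^'n^'n"
  assumes integrable: "Q absolutely_integrable_on {0..}"
begin

definition mass :: real where "mass = integral {0..} (\<lambda>t. norm (Q t))"

lemma norm_integrable: "(\<lambda>t. norm (Q t)) integrable_on {0..}"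
  using integrable by (simp add: absolutely_integrable_on_def)

lemma mass_nonneg: "mass \<ge> 0"
  unfolding mass_def by (intro integral_nonneg norm_integrable) auto

lemma bounded_multiple_integral:
  fixes f :: "real \<Rightarrow> 'b::banach"
  assumes "f integrable_on X" "X \<subseteq> {0..}" "X \<in> sets lebesgue"
    and "\<And>t. t \<in> X \<Longrightarrow> norm (f t) \<le> B * norm (Q t)" "B \<ge> 0"
  shows "norm (integral X f) \<le> B * mass"
proof -
  have i: "(\<lambda>t. norm (Q t)) integrable_on X"
    using set_integrable_subset[OF integrable assms(3,2)] by (simp add: absolutely_integrable_on_def)
  have "norm (integral X f) \<le> integral X (\<lambda>t. B * norm (Q t))"
    using assms i by (intro integral_norm_bound_integral integrable_on_mult_right) auto
  also have "\<dots> = B * integral X (\<lambda>t. norm (Q t))" by simp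
  also have "\<dots> \<le> B * mass"
    unfolding mass_def
    using assms(5,2) i norm_integrable by (intro mult_left_mono integral_subset_le) auto
  finally show ?thesis .
qed

lemma jost_kernel_bound:
  assumes "Im \<rho> > 0" "x \<le> t"
  shows "norm (ew2 \<rho> (t - x)) \<le> 1"
  using assms by (simp add: mult_nonneg_nonneg)

text \<open>
  For \<open>f = ew_inv e\<close> the Jost equation has the kernel \<open>(exp (2i\<rho>(t - x)) - 1) / (2i\<rho>)\<close> on \<open>t > x\<close>, which
  is bounded by \<open>1 / \<bar>\<rho>\<bar>\<close> in the upper half-plane. So the operator has norm at most \<open>1/2\<close> as soon as
  \<open>\<bar>\<rho>\<bar>\<close> is at least twice the integral of \<open>norm Q\<close>.
\<close>

lemma jost_solution_exists:
  assumes \<rho>: "Im \<rho> > 0" "2 * mass \<le> norm \<rho>"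
  shows "\<exists>e. is_jost_solution Q \<rho> e"
proof -
  have \<rho>0: "\<rho> \<noteq> 0" using \<rho>(1) by auto
  define K where "K x t = (if x < t then (ew2 \<rho> (t - x) - 1) / (2 * \<i> * \<rho>) else 0)"
    for x t :: real
  interpret small_kernel "{0..}" K "1 / norm \<rho>" UNIV "\<lambda>_. Q" "\<lambda>t. norm (Q t)" "\<lambda>_. mat 1"
    "norm (mat 1 :: complex^'n^'n)"
  proof
    show "K x \<in> borel_measurable (lebesgue_on {0..})" for x
    proof -
      have "K x \<in> borel_measurable borel"
        unfolding K_def by measurable
      then show ?thesis
        by (intro measurable_restrict_space1 measurable_completion) simp
    qed
    show "norm (K x t) \<le> 1 / norm \<rho>" for x t
    proof (cases "x < t")
      case True
      then have "norm (ew2 \<rho> (t - x) - 1) \<le> 2"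
        using order_trans[OF norm_triangle_ineq4 add_mono[OF jost_kernel_bound[OF \<rho>(1) less_imp_le] order_refl],
            of x t 1]
        by (simp only: norm_one one_add_one)
      then show ?thesis using True \<rho>0
        by (simp add: K_def norm_divide norm_mult divide_simps)
    qed (simp add: K_def)
    show "continuous_on {0..} (\<lambda>x. K x t)" for t
    proof -
      \<comment> \<open>the kernel vanishes on the diagonal, so the cut-off there keeps it continuous\<close>
      have "K x t = (exp (2 * \<i> * \<rho> * of_real (max 0 (t - x))) - 1) / (2 * \<i> * \<rho>)" for x
        by (simp add: K_def max_def)
      then show ?thesis
        using \<rho>0 by (simp only:) (intro continuous_intros; simp)
    qed
    show "1 / norm \<rho> * integral {0..} (\<lambda>t. norm (Q t)) \<le> 1 / 2"
      using \<rho>0 \<rho>(2) by (simp add: mass_def[symmetric] divide_simps)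
  qed (use integrable norm_integrable in auto)
  define f where "f = solution 0"
  define e where "e x = ew \<rho> x *\<^sub>C f x" for x
  have "is_jost_solution Q \<rho> e"
    unfolding is_jost_solution_def
  proof (intro conjI allI impI)
    have "mat (exp (- (\<i> * \<rho> * of_real x))) ** e x = f x" for x
      by (simp add: mat_mult_eq_cscale e_def exp_minus)
    then show "bounded ((\<lambda>x. mat (exp (- (\<i> * \<rho> * of_real x))) ** e x) ` {0..})"
      using solution_bound[of 0] unfolding bounded_iff f_def by auto
    fix x :: real assume x: "x \<ge> 0"
    have I: "(\<lambda>t. K x t *\<^sub>C (Q t ** f t)) absolutely_integrable_on {0..}"
      unfolding f_def
      by (rule integrand_integrable[OF _ _ solution_continuous solution_bound]) (use x in auto)
    have eq: "mat (sin (\<rho> * of_real (t - x)) / \<rho>) ** Q t ** e t =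
        ew \<rho> x *\<^sub>C K x t *\<^sub>C (Q t ** f t)" if "t \<in> {x<..}" for t
    proof -
      have "sin (\<rho> * of_real (t - x)) / \<rho> * ew \<rho> t = ew \<rho> x * K x t"
      proof -
        define u where "u = ew \<rho> x"
        define v where "v = exp (\<i> * (\<rho> * of_real (t - x)))"
        have v0: "v \<noteq> 0" by (simp add: v_def)
        have t: "ew \<rho> t = u * v"
          unfolding u_def v_def by (simp add: exp_add[symmetric] algebra_simps)
        have v2: "ew2 \<rho> (t - x) = v * v"
          unfolding v_def by (simp add: exp_add[symmetric] algebra_simps)
        have s: "sin (\<rho> * of_real (t - x)) = (v - inverse v) / (2 * \<i>)"
          unfolding v_def by (simp add: sin_exp_eq exp_minus)
        have K: "K x t = (v * v - 1) / (2 * \<i> * \<rho>)"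
          using that by (simp only: K_def v2 greaterThan_iff if_True)
        show ?thesis
          unfolding t s K u_def[symmetric] using \<rho>0 v0 by (simp add: field_simps)
      qed
      then show ?thesis
        by (simp add: mat_mult_eq_cscale e_def mult.commute)
    qed
    have I2: "(\<lambda>t. ew \<rho> x *\<^sub>C K x t *\<^sub>C (Q t ** f t)) absolutely_integrable_on {0..}"
      by (rule absolutely_integrable_map[OF I bounded_linear_cscale])
    then have I3: "(\<lambda>t. ew \<rho> x *\<^sub>C K x t *\<^sub>C (Q t ** f t)) absolutely_integrable_on {x<..}"
      by (rule set_integrable_subset) (use x in auto)
    show I4: "(\<lambda>t. mat (sin (\<rho> * of_real (t - x)) / \<rho>) ** Q t ** e t) absolutely_integrable_on {x<..}"
      by (rule absolutely_integrable_spike[OF I3, of "{}"]) (use eq in auto)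
    have "(LINT t:{x<..}|lebesgue. mat (sin (\<rho> * of_real (t - x)) / \<rho>) ** Q t ** e t) =
        integral {x<..} (\<lambda>t. ew \<rho> x *\<^sub>C K x t *\<^sub>C (Q t ** f t))"
      unfolding set_lebesgue_integral_eq_integral(2)[OF I4]
      by (rule hk_integral_cong) (rule eq)
    also have "\<dots> = integral {0..} (\<lambda>t. ew \<rho> x *\<^sub>C K x t *\<^sub>C (Q t ** f t))"
      by (rule integral_eq_on_support) (use x in \<open>auto simp: K_def\<close>)
    also have "\<dots> = ew \<rho> x *\<^sub>C integral {0..} (\<lambda>t. K x t *\<^sub>C (Q t ** f t))"
      by (rule integral_cscale(2)[OF absolutely_integrable_integrable[OF I]])
    finally show "e x = mat (ew \<rho> x) +
        (LINT t:{x<..}|lebesgue. mat (sin (\<rho> * of_real (t - x)) / \<rho>) ** Q t ** e t)"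
      using solution_equation[of 0 x] x
      by (simp add: e_def f_def cscale_distribs mat_eq_cscale[symmetric])
  qed
  then show ?thesis by blast
qed

lemma tail_integral_has_ac_deriv:
  fixes w :: "real \<Rightarrow> 'b::euclidean_space"
  assumes w: "w absolutely_integrable_on {0..}"
  shows "has_ac_deriv (\<lambda>x. integral {x..} w) (\<lambda>x. - w x)"
proof -
  have sub: "w absolutely_integrable_on {0..x}" for x
    by (rule absolutely_integrable_on_subinterval[OF w]) auto
  have eq: "integral {x..} w = integral {0..} w + integral {0..x} (\<lambda>x. - w x)" if x: "x \<ge> 0" for x
  proof -
    have "w integrable_on {x..}"
      using set_integrable_subset[OF w, of "{x..}"] x
      by (intro absolutely_integrable_integrable) auto
    then have "integral ({0..x} \<union> {x..}) w = integral {0..x} w + integral {x..} w"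
      using x by (intro integral_Un absolutely_integrable_integrable[OF sub])
        (auto intro!: negligible_subset[of "{x}"])
    moreover have "{0..x} \<union> {x..} = {0..}" using x by auto
    ultimately show ?thesis by (simp add: algebra_simps)
  qed
  have "has_ac_deriv (\<lambda>x. integral {0..} w + integral {0..x} (\<lambda>x. - w x)) (\<lambda>x. - w x)"
    by (rule has_ac_deriv_integral)
      (rule absolutely_integrable_map[OF sub bounded_linear_minus[OF bounded_linear_ident]])
  then show ?thesis
    by (rule has_ac_deriv_cong[OF _ eq[symmetric] refl])
qed

text \<open>
  The definition of a Jost solution only provides integrability of the integrand of its equation at
  each \<open>x\<close>. At \<open>x = 0\<close> its factor \<open>sin (\<rho>t)\<close> has no zeros for \<open>t > 0\<close>, because \<open>\<rho>\<close> is not real; dividing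
  by it shows that \<open>Q e\<close> is measurable. Boundedness of \<open>ew_inv e\<close> then gives domination by \<open>norm Q\<close>.
\<close>

lemma jost_density_integrable:
  assumes \<rho>: "Im \<rho> > 0" and e: "is_jost_solution Q \<rho> e"
  shows "(\<lambda>t. ew_inv \<rho> t *\<^sub>C (Q t ** e t)) absolutely_integrable_on {0..}"
proof -
  have \<rho>0: "\<rho> \<noteq> 0" using \<rho> by auto
  obtain B where B: "\<And>x. x \<ge> 0 \<Longrightarrow> norm (mat (exp (- (\<i> * \<rho> * of_real x))) ** e x) \<le> B"
  proof -
    obtain B where "\<And>y. y \<in> (\<lambda>x. mat (exp (- (\<i> * \<rho> * of_real x))) ** e x) ` {0..} \<Longrightarrow> norm y \<le> B"
      using e unfolding is_jost_solution_def bounded_iff by blast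
    then show ?thesis by (intro that[of B]) auto
  qed
  define W where "W t = mat (sin (\<rho> * of_real (t - 0)) / \<rho>) ** Q t ** e t" for t
  have "W absolutely_integrable_on {0<..}"
    using e unfolding is_jost_solution_def W_def by blast
  then have Wm: "W \<in> borel_measurable (lebesgue_on {0<..})"
    by (rule absolutely_integrable_imp_borel_measurable) simp
  define k where "k t = ew_inv \<rho> t * (\<rho> / sin (\<rho> * of_real t))" for t :: real
  have sin0: "sin (\<rho> * of_real t) \<noteq> 0" if "t > 0" for t :: real
  proof
    assume "sin (\<rho> * of_real t) = 0"
    then obtain n :: int where "\<rho> * of_real t = of_real n * pi"
      unfolding sin_eq_0 by auto
    then have "Im (\<rho> * of_real t) = 0" by simp
    then show False using \<rho> that by simp
  qed
  have "continuous_on {0<..} k"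
    unfolding k_def by (intro continuous_intros) (use sin0 in auto)
  then have km: "k \<in> borel_measurable (lebesgue_on {0<..})"
    by (rule continuous_imp_measurable_on_sets_lebesgue) simp
  have "(\<lambda>t. k t *\<^sub>C W t) \<in> borel_measurable (lebesgue_on {0<..})"
    by (rule borel_measurable_bilinear[OF _ km Wm])
      (simp_all add: bilinear_conv_bounded_bilinear bounded_bilinear_cscale)
  moreover have kW: "k t *\<^sub>C W t = ew_inv \<rho> t *\<^sub>C (Q t ** e t)" if "t > 0" for t
    using sin0[OF that] \<rho>0 by (simp add: k_def W_def mat_mult_eq_cscale)
  ultimately have "(\<lambda>t. ew_inv \<rho> t *\<^sub>C (Q t ** e t)) \<in> borel_measurable (lebesgue_on {0<..})"
    by (subst measurable_cong[where g="\<lambda>t. k t *\<^sub>C W t"]) auto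
  then have "(\<lambda>t. ew_inv \<rho> t *\<^sub>C (Q t ** e t)) absolutely_integrable_on {0<..}"
  proof (rule measurable_bounded_by_integrable_imp_absolutely_integrable)
    have "(\<lambda>t. norm (Q t)) integrable_on {0<..}"
      using set_integrable_subset[OF integrable, of "{0<..}"]
      by (simp add: absolutely_integrable_on_def subset_iff)
    then show "(\<lambda>t. B * norm (Q t)) integrable_on {0<..}"
      by (rule integrable_on_mult_right)
    fix t :: real assume "t \<in> {0<..}"
    then have t: "t \<ge> 0" by simp
    have "norm (ew_inv \<rho> t *\<^sub>C (Q t ** e t)) =
        norm (Q t ** (ew_inv \<rho> t *\<^sub>C e t))" by simp
    also have "\<dots> \<le> norm (Q t) * norm (ew_inv \<rho> t *\<^sub>C e t)"
      by (rule norm_matrix_mult_le)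
    also have "\<dots> \<le> norm (Q t) * B"
      using B[OF t] by (intro mult_left_mono) (auto simp: mat_mult_eq_cscale)
    finally show "norm (ew_inv \<rho> t *\<^sub>C (Q t ** e t)) \<le> B * norm (Q t)"
      by (simp add: mult.commute)
  qed simp
  then show ?thesis
    by (simp only: absolutely_integrable_on_Ioi_iff)
qed

text \<open>
  Splitting the sine in the kernel into exponentials exhibits a Jost solution as a superposition of
  two waves whose coefficients are tail integrals. The tail integrals are absolutely continuous, and
  any bound \<open>B\<close> for \<open>ew_inv e\<close> keeps the decaying wave close to \<open>ew\<close> and the growing one small.
\<close>

lemma jost_solution_waves:
  assumes \<rho>: "Im \<rho> > 0" and e: "is_jost_solution Q \<rho> e"
  defines "w \<equiv> \<lambda>t. ew_inv \<rho> t *\<^sub>C (Q t ** e t)"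
  defines "a \<equiv> \<lambda>x. mat 1 - (1 / (2 * \<i> * \<rho>)) *\<^sub>C integral {x..} w"
    and "b \<equiv> \<lambda>x. (1 / (2 * \<i> * \<rho>)) *\<^sub>C integral {x..} (\<lambda>t. ew2 \<rho> t *\<^sub>C w t)"
  shows "\<And>x. x \<ge> 0 \<Longrightarrow> e x = ew \<rho> x *\<^sub>C a x + ew_inv \<rho> x *\<^sub>C b x"
    and "has_ac_deriv a (\<lambda>x. (ew_inv \<rho> x / (2 * \<i> * \<rho>)) *\<^sub>C (Q x ** e x))"
    and "has_ac_deriv b (\<lambda>x. (- ew \<rho> x / (2 * \<i> * \<rho>)) *\<^sub>C (Q x ** e x))"
    and "\<And>x B. x \<ge> 0 \<Longrightarrow> (\<And>t. t \<ge> 0 \<Longrightarrow> norm (ew_inv \<rho> t *\<^sub>C e t) \<le> B) \<Longrightarrow>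
      norm (a x - mat 1) \<le> B * mass / (2 * norm \<rho>)"
    and "\<And>x B. x \<ge> 0 \<Longrightarrow> (\<And>t. t \<ge> 0 \<Longrightarrow> norm (ew_inv \<rho> t *\<^sub>C e t) \<le> B) \<Longrightarrow>
      norm (exp (- 2 * \<i> * \<rho> * of_real x) *\<^sub>C b x) \<le> B * mass / (2 * norm \<rho>)"
proof -
  have \<rho>0: "\<rho> \<noteq> 0" using \<rho> by auto
  have w: "w absolutely_integrable_on {0..}"
    unfolding w_def by (rule jost_density_integrable[OF \<rho> e])
  define w2 where "w2 t = ew2 \<rho> t *\<^sub>C w t" for t
  have w2: "w2 absolutely_integrable_on {0..}"
    unfolding w2_def
  proof (rule absolutely_integrable_bilinear[OF bounded_bilinear_cscale _ _ _ w, where B=1])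
    show "(\<lambda>t::real. ew2 \<rho> t) \<in> borel_measurable (lebesgue_on {0..})"
      by (intro continuous_imp_measurable_on_sets_lebesgue continuous_intros) simp
    show "norm (ew2 \<rho> t) \<le> 1" if "t \<in> {0..}" for t :: real
      using jost_kernel_bound[OF \<rho>, of 0 t] that by simp
  qed simp
  have b_eq: "b x = (1 / (2 * \<i> * \<rho>)) *\<^sub>C integral {x..} w2" for x
    unfolding b_def w2_def[abs_def] ..
  have int: "w integrable_on {x..}" "w2 integrable_on {x..}" if "x \<ge> 0" for x
    using set_integrable_subset[OF w, of "{x..}"] set_integrable_subset[OF w2, of "{x..}"] that
    by (auto intro!: absolutely_integrable_integrable)
  show "e x = ew \<rho> x *\<^sub>C a x + ew_inv \<rho> x *\<^sub>C b x" if x: "x \<ge> 0" for x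
  proof -
    define u where "u = ew \<rho> x / (2 * \<i> * \<rho>)"
    define v where "v = ew_inv \<rho> x / (2 * \<i> * \<rho>)"
    have I: "(\<lambda>t. mat (sin (\<rho> * of_real (t - x)) / \<rho>) ** Q t ** e t) absolutely_integrable_on {x<..}"
      and ex: "e x = mat (ew \<rho> x) +
        (LINT t:{x<..}|lebesgue. mat (sin (\<rho> * of_real (t - x)) / \<rho>) ** Q t ** e t)"
      using e x unfolding is_jost_solution_def by blast+
    have "(LINT t:{x<..}|lebesgue. mat (sin (\<rho> * of_real (t - x)) / \<rho>) ** Q t ** e t) =
        integral {x<..} (\<lambda>t. mat (sin (\<rho> * of_real (t - x)) / \<rho>) ** Q t ** e t)"
      by (rule set_lebesgue_integral_eq_integral(2)[OF I])
    also have "\<dots> = integral {x..} (\<lambda>t. mat (sin (\<rho> * of_real (t - x)) / \<rho>) ** Q t ** e t)"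
      by (rule integral_eq_on_support) auto
    also have "\<dots> = integral {x..} (\<lambda>t. v *\<^sub>C w2 t - u *\<^sub>C w t)"
    proof (rule hk_integral_cong)
      fix t
      define p where "p = ew \<rho> x"
      define q where "q = ew \<rho> t"
      have nz: "p \<noteq> 0" "q \<noteq> 0" by (simp_all add: p_def q_def)
      have 1: "exp (\<i> * (\<rho> * of_real (t - x))) = q / p"
        unfolding p_def q_def by (simp add: exp_diff[symmetric] algebra_simps)
      have 2: "ew_inv \<rho> t = inverse q" "ew_inv \<rho> x = inverse p"
        by (simp_all add: p_def q_def exp_minus)
      have 3: "ew2 \<rho> t = q * q"
        unfolding q_def by (simp add: exp_add[symmetric] algebra_simps)
      have s: "sin (\<rho> * of_real (t - x)) = (q / p - p / q) / (2 * \<i>)"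
        unfolding sin_exp_eq 1 exp_minus using nz by (simp add: field_simps)
      show "mat (sin (\<rho> * of_real (t - x)) / \<rho>) ** Q t ** e t = v *\<^sub>C w2 t - u *\<^sub>C w t"
        unfolding s w_def w2_def u_def v_def 2 3 p_def[symmetric] mat_mult_eq_cscale cscale_mult_left
        using nz \<rho>0 by (simp add: vec_eq_iff field_simps)
    qed
    also have "\<dots> = v *\<^sub>C integral {x..} w2 - u *\<^sub>C integral {x..} w"
      using int[OF x] by (simp add: hk_integral_diff integral_cscale)
    finally show ?thesis
      unfolding ex a_def b_eq
      by (simp add: u_def v_def cscale_distribs mat_eq_cscale[of "ew \<rho> x"])
  qed
  show "has_ac_deriv a (\<lambda>x. (ew_inv \<rho> x / (2 * \<i> * \<rho>)) *\<^sub>C (Q x ** e x))"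
    by (rule has_ac_deriv_cong[OF has_ac_deriv_diff[OF has_ac_deriv_const[of "mat 1"]
            has_ac_deriv_linear[OF bounded_linear_cscale[of "1 / (2 * \<i> * \<rho>)"] tail_integral_has_ac_deriv[OF w]]]])
      (auto simp: a_def w_def cscale_distribs)
  have b': "ew2 \<rho> x * ew_inv \<rho> x = ew \<rho> x" for x :: real
    by (simp add: exp_add[symmetric] algebra_simps)
  show "has_ac_deriv b (\<lambda>x. (- ew \<rho> x / (2 * \<i> * \<rho>)) *\<^sub>C (Q x ** e x))"
  proof (rule has_ac_deriv_cong[OF has_ac_deriv_linear[OF bounded_linear_cscale[of "1 / (2 * \<i> * \<rho>)"]
            tail_integral_has_ac_deriv[OF w2]]])
    show "(1 / (2 * \<i> * \<rho>)) *\<^sub>C - w2 x = (- ew \<rho> x / (2 * \<i> * \<rho>)) *\<^sub>C (Q x ** e x)" for x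
      unfolding b'[symmetric] w2_def w_def by (simp add: cscale_distribs)
  qed (simp add: b_eq)
  fix x :: real and B
  assume x: "x \<ge> 0" and B: "\<And>t. t \<ge> 0 \<Longrightarrow> norm (ew_inv \<rho> t *\<^sub>C e t) \<le> B"
  have B0: "B \<ge> 0" using B[OF x] norm_ge_zero order_trans by blast
  have wB: "norm (w t) \<le> B * norm (Q t)" if "t \<ge> 0" for t
  proof -
    have "norm (w t) = norm (Q t ** (ew_inv \<rho> t *\<^sub>C e t))"
      by (simp add: w_def)
    also have "\<dots> \<le> norm (Q t) * norm (ew_inv \<rho> t *\<^sub>C e t)"
      by (rule norm_matrix_mult_le)
    also have "\<dots> \<le> norm (Q t) * B"
      using B[OF that] by (intro mult_left_mono) auto
    finally show ?thesis by (simp add: mult.commute)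
  qed
  have "norm (integral {x..} w) \<le> B * mass"
    by (rule bounded_multiple_integral[OF int(1)[OF x]]) (use x wB B0 in auto)
  then show "norm (a x - mat 1) \<le> B * mass / (2 * norm \<rho>)"
    using \<rho>0 by (simp add: a_def norm_divide norm_mult divide_right_mono)
  have "norm (integral {x..} (\<lambda>t. exp (- 2 * \<i> * \<rho> * of_real x) *\<^sub>C w2 t)) \<le> B * mass"
  proof (rule bounded_multiple_integral)
    show "(\<lambda>t. exp (- 2 * \<i> * \<rho> * of_real x) *\<^sub>C w2 t) integrable_on {x..}"
      by (rule integral_cscale(1)[OF int(2)[OF x]])
    fix t assume t: "t \<in> {x..}"
    have "exp (- 2 * \<i> * \<rho> * of_real x) *\<^sub>C w2 t = ew2 \<rho> (t - x) *\<^sub>C w t"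
      by (simp add: w2_def exp_add[symmetric] algebra_simps)
    moreover have "norm (ew2 \<rho> (t - x) *\<^sub>C w t) \<le> 1 * norm (w t)"
      unfolding norm_cscale by (intro mult_right_mono jost_kernel_bound[OF \<rho>]) (use t in auto)
    ultimately show "norm (exp (- 2 * \<i> * \<rho> * of_real x) *\<^sub>C w2 t) \<le> B * norm (Q t)"
      using wB[of t] t x by simp
  qed (use x B0 in auto)
  moreover have "integral {x..} (\<lambda>t. exp (- 2 * \<i> * \<rho> * of_real x) *\<^sub>C w2 t) =
      exp (- 2 * \<i> * \<rho> * of_real x) *\<^sub>C integral {x..} w2"
    by (rule integral_cscale(2)[OF int(2)[OF x]])
  ultimately have "norm (exp (- 2 * \<i> * \<rho> * of_real x) *\<^sub>C integral {x..} w2) \<le> B * mass" by simp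
  moreover have "exp (- 2 * \<i> * \<rho> * of_real x) *\<^sub>C b x =
      (1 / (2 * \<i> * \<rho>)) *\<^sub>C (exp (- 2 * \<i> * \<rho> * of_real x) *\<^sub>C integral {x..} w2)"
    by (simp add: b_eq mult.commute)
  ultimately show "norm (exp (- 2 * \<i> * \<rho> * of_real x) *\<^sub>C b x) \<le> B * mass / (2 * norm \<rho>)"
    using \<rho>0 by (simp only: norm_cscale) (simp add: norm_divide norm_mult divide_right_mono)
qed

end

definition jost_deriv :: "(real \<Rightarrow> complex^'n^'n) \<Rightarrow> complex \<Rightarrow> real \<Rightarrow> complex^'n^'n"
  where "jost_deriv Q \<rho> x = vector_derivative (jost_solution Q \<rho>) (at x within {0..})"

lemma deriv_at_0_jost_solution: "deriv_at_0 (jost_solution Q \<rho>) = jost_deriv Q \<rho> 0"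
  by (simp add: deriv_at_0_def jost_deriv_def)

context potential
begin

text \<open>
  With \<open>\<nu> = norm (mat 1)\<close>, the estimates of the waves improve a bound \<open>B\<close> for \<open>ew_inv e\<close> to \<open>\<nu> + B / 2\<close>,
  so \<open>B = 2\<nu>\<close> is a bound; inserting it into the same estimates yields the error terms.
\<close>

lemma jost_solution_asymptotics:
  assumes \<rho>: "Im \<rho> > 0" "2 * mass \<le> norm \<rho>"
  shows "solves Q (\<rho>\<^sup>2) (jost_solution Q \<rho>) (jost_deriv Q \<rho>)"
    and "x \<ge> 0 \<Longrightarrow> norm (ew_inv \<rho> x *\<^sub>C jost_solution Q \<rho> x - mat 1)
      \<le> 2 * norm (mat 1 :: complex^'n^'n) * mass / norm \<rho>"
    and "x \<ge> 0 \<Longrightarrow> norm (ew_inv \<rho> x *\<^sub>C jost_deriv Q \<rho> x - (\<i> * \<rho>) *\<^sub>C mat 1)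
      \<le> 2 * norm (mat 1 :: complex^'n^'n) * mass"
proof -
  define N where "N = norm (mat 1 :: complex^'n^'n)"
  have \<rho>0: "\<rho> \<noteq> 0" using \<rho> by auto
  define e where "e = jost_solution Q \<rho>"
  have e: "is_jost_solution Q \<rho> e"
    unfolding e_def jost_solution_def using jost_solution_exists[OF \<rho>] by (rule someI_ex)
  define w where "w t = ew_inv \<rho> t *\<^sub>C (Q t ** e t)" for t
  define a where "a x = mat 1 - (1 / (2 * \<i> * \<rho>)) *\<^sub>C integral {x..} w" for x
  define b where "b x = (1 / (2 * \<i> * \<rho>)) *\<^sub>C integral {x..} (\<lambda>t. ew2 \<rho> t *\<^sub>C w t)" for x
  note waves = jost_solution_waves[OF \<rho>(1) e, folded w_def, folded a_def b_def]
  define f where "f x = ew_inv \<rho> x *\<^sub>C e x" for x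
  have unit: "ew_inv \<rho> x * ew \<rho> x = 1" for x :: real
    by (simp add: exp_minus)
  have sq: "ew_inv \<rho> x * ew_inv \<rho> x = exp (- 2 * \<i> * \<rho> * of_real x)" for x :: real
    by (simp add: exp_add[symmetric] algebra_simps)
  have f_waves: "f x = a x + exp (- 2 * \<i> * \<rho> * of_real x) *\<^sub>C b x" if "x \<ge> 0" for x
    unfolding f_def waves(1)[OF that] cscale_distribs cscale_cscale unit sq by simp
  have est: "norm (f x - mat 1) \<le> B * mass / norm \<rho>"
    if "\<And>t. t \<ge> 0 \<Longrightarrow> norm (f t) \<le> B" "x \<ge> 0" for B x
  proof -
    have "f x - mat 1 = (a x - mat 1) + exp (- 2 * \<i> * \<rho> * of_real x) *\<^sub>C b x"
      using f_waves[OF that(2)] by simp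
    also have "norm \<dots> \<le> B * mass / (2 * norm \<rho>) + B * mass / (2 * norm \<rho>)"
      by (intro order_trans[OF norm_triangle_ineq] add_mono waves(4,5) that(2))
        (use that(1) in \<open>auto simp: f_def\<close>)
    finally show ?thesis by (simp add: field_simps)
  qed
  have ratio: "mass / norm \<rho> \<le> 1 / 2"
    using \<rho>(2) \<rho>0 by (simp add: divide_simps)
  obtain B0 where B0: "\<And>y. y \<in> (\<lambda>x. mat (exp (- (\<i> * \<rho> * of_real x))) ** e x) ` {0..} \<Longrightarrow> norm y \<le> B0"
    using e unfolding is_jost_solution_def bounded_iff by blast
  have bound: "norm (f x) \<le> 2 * N" if x: "x \<ge> 0" for x
  proof (rule halving_bound[of "{0..}" "\<lambda>x. norm (f x)"])
    show "norm (f y) \<le> B0" if "y \<in> {0..}" for y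
      by (rule B0) (use that in \<open>auto simp: f_def mat_mult_eq_cscale\<close>)
    show "norm (f y) \<le> N + B / 2" if "\<And>x. x \<in> {0..} \<Longrightarrow> norm (f x) \<le> B" "y \<in> {0..}" for B y
    proof -
      have B: "B \<ge> 0" by (rule order_trans[OF norm_ge_zero that(1)[of 0]]) simp
      have "norm (f y) \<le> N + norm (f y - mat 1)"
        using norm_triangle_ineq[of "mat 1" "f y - mat 1"] by (simp add: N_def)
      also have "norm (f y - mat 1) \<le> B * (mass / norm \<rho>)"
        using est[of B y] that by simp
      also have "\<dots> \<le> B * (1 / 2)"
        by (rule mult_left_mono[OF ratio B])
      finally show ?thesis by simp
    qed
  qed (use x in auto)
  define e1 where "e1 x = (\<i> * \<rho>) *\<^sub>C
      (ew \<rho> x *\<^sub>C a x - ew_inv \<rho> x *\<^sub>C b x)" for x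
  have sol: "solves Q (\<rho>\<^sup>2) e e1"
    by (rule solves_wave[OF \<rho>0 waves(2,3) waves(1) e1_def])
  then have "continuous_on {0..} e1"
    unfolding solves_def using has_ac_deriv_continuous_on_atLeast by blast
  with sol have e1: "jost_deriv Q \<rho> x = e1 x" if "x \<ge> 0" for x
    unfolding jost_deriv_def e_def[symmetric] solves_def
    using has_ac_deriv_vector_derivative that by blast
  have "has_ac_deriv e (jost_deriv Q \<rho>)"
    using sol unfolding solves_def by (auto intro: has_ac_deriv_cong simp: e1)
  moreover have "has_ac_deriv (jost_deriv Q \<rho>) (\<lambda>x. Q x ** e x - \<rho>\<^sup>2 *\<^sub>C e x)"
    using sol unfolding solves_def by (auto intro: has_ac_deriv_cong simp: e1)
  ultimately show "solves Q (\<rho>\<^sup>2) (jost_solution Q \<rho>) (jost_deriv Q \<rho>)"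
    by (simp add: solves_def e_def)
  assume x: "x \<ge> 0"
  show "norm (ew_inv \<rho> x *\<^sub>C jost_solution Q \<rho> x - mat 1)
      \<le> 2 * norm (mat 1 :: complex^'n^'n) * mass / norm \<rho>"
    using est[OF bound x] by (simp add: f_def e_def N_def)
  have "ew_inv \<rho> x *\<^sub>C jost_deriv Q \<rho> x - (\<i> * \<rho>) *\<^sub>C mat 1 =
      (\<i> * \<rho>) *\<^sub>C ((a x - mat 1) - exp (- 2 * \<i> * \<rho> * of_real x) *\<^sub>C b x)"
  proof -
    have "ew_inv \<rho> x *\<^sub>C jost_deriv Q \<rho> x =
        (\<i> * \<rho>) *\<^sub>C ((ew_inv \<rho> x * ew \<rho> x) *\<^sub>C a x -
        (ew_inv \<rho> x * ew_inv \<rho> x) *\<^sub>C b x)"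
      unfolding e1[OF x] e1_def by (simp add: vec_eq_iff algebra_simps)
    then show ?thesis unfolding unit sq by (simp add: cscale_distribs)
  qed
  also have "norm \<dots> = norm \<rho> * norm ((a x - mat 1) - exp (- 2 * \<i> * \<rho> * of_real x) *\<^sub>C b x)"
    by (simp add: norm_mult)
  also have "\<dots> \<le> norm \<rho> * (2 * N * mass / (2 * norm \<rho>) + 2 * N * mass / (2 * norm \<rho>))"
    by (intro mult_left_mono order_trans[OF norm_triangle_ineq4] add_mono waves(4,5) x)
      (use bound in \<open>auto simp: f_def\<close>)
  also have "\<dots> = 2 * N * mass" using \<rho>0 by (simp add: field_simps)
  finally show "norm (ew_inv \<rho> x *\<^sub>C jost_deriv Q \<rho> x - (\<i> * \<rho>) *\<^sub>C mat 1)
      \<le> 2 * norm (mat 1 :: complex^'n^'n) * mass"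
    by (simp add: N_def)
qed

end

section \<open>Initial value problems\<close>

lemma continuous_on_Icc_bounded:
  fixes f :: "real \<Rightarrow> 'a::real_normed_vector"
  assumes "continuous_on {a..b} f"
  shows "\<exists>B. \<forall>t\<in>{a..b}. norm (f t) \<le> B"
  using compact_imp_bounded[OF compact_continuous_image[OF assms compact_Icc]]
  by (simp add: bounded_iff)

text \<open>
  Taylor's formula with integral remainder translates between the first-order system and a Volterra
  equation with kernel \<open>x - t\<close>.
\<close>

lemma has_ac_deriv_taylor:
  fixes V :: "real \<Rightarrow> complex^'n^'n"
  assumes V: "has_ac_deriv Y1 V"
  shows "has_ac_deriv (\<lambda>x. of_real x *\<^sub>C Y1 0 + integral {0..x} (\<lambda>t. of_real (x - t) *\<^sub>C V t)) Y1"
proof -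
  note p = has_ac_deriv_cscale[OF has_ac_deriv_of_real V]
  have tV: "(\<lambda>t. of_real t *\<^sub>C V t) absolutely_integrable_on {0..x}" if "x \<ge> 0" for x :: real
    by (rule absolutely_integrable_bilinear[OF bounded_bilinear_cscale, where B=x])
      (use has_ac_derivD(1)[OF V that] that in
        \<open>auto intro!: continuous_imp_measurable_on_sets_lebesgue continuous_intros\<close>)
  have eq: "of_real x *\<^sub>C Y1 x - (0 + integral {0..x} (\<lambda>t. of_real t *\<^sub>C V t)) =
      of_real x *\<^sub>C Y1 0 + integral {0..x} (\<lambda>t. of_real (x - t) *\<^sub>C V t)" if x: "x \<ge> 0" for x
  proof -
    have i: "(\<lambda>t. of_real x *\<^sub>C V t) integrable_on {0..x}"
      "integral {0..x} (\<lambda>t. of_real x *\<^sub>C V t) = of_real x *\<^sub>C integral {0..x} V"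
      by (rule integral_cscale[OF has_ac_derivD(2)[OF V x]])+
    have "integral {0..x} (\<lambda>t. of_real (x - t) *\<^sub>C V t) =
        integral {0..x} (\<lambda>t. of_real x *\<^sub>C V t - of_real t *\<^sub>C V t)"
      by (simp add: cscale_distribs)
    also have "\<dots> = of_real x *\<^sub>C integral {0..x} V - integral {0..x} (\<lambda>t. of_real t *\<^sub>C V t)"
      using hk_integral_diff[OF i(1)
          absolutely_integrable_integrable[OF tV[OF x]]] i(2) by simp
    finally show ?thesis
      by (subst has_ac_derivD(3)[OF V x]) (simp add: cscale_distribs)
  qed
  show ?thesis
    by (rule has_ac_deriv_cong[OF has_ac_deriv_diff[OF p has_ac_deriv_integral[OF tV, of 0]] eq]) auto
qed

lemma entire_if_holomorphic_on_balls:
  fixes f :: "complex \<Rightarrow> complex"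
  assumes "\<And>R. R > 0 \<Longrightarrow> f holomorphic_on ball 0 R"
  shows "f holomorphic_on UNIV"
proof -
  have "f field_differentiable at z" for z
    using assms[of "norm z + 1"] by (intro holomorphic_on_imp_differentiable_at[of f "ball 0 (norm z + 1)"])
      (auto simp: add_nonneg_pos)
  then show ?thesis
    by (auto simp: holomorphic_on_def)
qed

context potential
begin

abbreviation coeff :: "complex \<Rightarrow> real \<Rightarrow> complex^'n^'n"
  where "coeff z t \<equiv> Q t - z *\<^sub>C mat 1"

abbreviation volterra :: "complex \<Rightarrow> (real \<Rightarrow> complex^'n^'n) \<Rightarrow> real \<Rightarrow> complex^'n^'n"
  where "volterra z Y x \<equiv> integral {0..x} (\<lambda>t. of_real (x - t) *\<^sub>C (coeff z t ** Y t))"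

text \<open>
  The kernel \<open>x - t\<close> does not involve the spectral parameter, so \<open>z\<close> enters linearly, through the
  coefficient. A bounded interval is needed for the constant \<open>z\<close> to be integrable.
\<close>

definition ivp :: "real \<Rightarrow> complex \<Rightarrow> complex^'n^'n \<Rightarrow> complex^'n^'n \<Rightarrow> (real \<Rightarrow> complex^'n^'n) \<Rightarrow> bool"
  where "ivp b z Y0 Y1 Y \<longleftrightarrow> continuous_on {0..b} Y \<and> (\<forall>x\<in>{0..b}. Y x = Y0 + of_real x *\<^sub>C Y1 +
    volterra z Y x)"

lemma ivp_continuous: "ivp b z Y0 Y1 Y \<Longrightarrow> continuous_on {0..b} Y"
  by (simp only: ivp_def)

lemma ivp_equation:
  "ivp b z Y0 Y1 Y \<Longrightarrow> x \<in> {0..b} \<Longrightarrow> Y x = Y0 + of_real x *\<^sub>C Y1 +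
    volterra z Y x"
  unfolding ivp_def by blast

lemma local_integrable: "Q absolutely_integrable_on {0..b}"
  by (rule absolutely_integrable_on_subinterval[OF integrable]) auto

lemma coefficient_integrable: "coeff z absolutely_integrable_on {0..b}"
  by (intro set_integral_diff(1) local_integrable absolutely_integrable_continuous_real continuous_intros)

text \<open>
  Under the weight \<open>exp (-\<kappa>x)\<close> the Volterra kernel becomes \<open>(x - t) exp (-\<kappa>(x - t))\<close>. As it vanishes on the
  diagonal, it is uniformly small for large \<open>\<kappa>\<close>.
\<close>

lemma ivp_kernel_bound:
  fixes \<kappa> s :: real
  assumes "\<kappa> > 0"
  shows "\<bar>max 0 s * exp (- \<kappa> * s)\<bar> \<le> 1 / \<kappa>"
proof (cases "s > 0")
  case True
  have "\<kappa> * s \<le> exp (\<kappa> * s)" using exp_ge_add_one_self[of "\<kappa> * s"] by linarith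
  then show ?thesis using True assms by (simp add: exp_minus field_simps)
qed (use assms in \<open>auto simp: max_def\<close>)

text \<open>
  One weight \<open>exp (-\<kappa>x)\<close> makes the Volterra operator small for all \<open>z\<close> in a disc, which gives existence,
  uniqueness, a bound and holomorphy on that disc at once.
\<close>

lemma ivp_local:
  assumes b: "b \<ge> 0" and R: "R > 0"
  obtains Y M where "\<And>z. z \<in> ball 0 R \<Longrightarrow> ivp b z Y0 Y1 (Y z)"
    "\<And>z x. z \<in> ball 0 R \<Longrightarrow> x \<in> {0..b} \<Longrightarrow> norm (Y z x) \<le> M"
    "\<And>x i j. x \<in> {0..b} \<Longrightarrow> (\<lambda>z. Y z x $ i $ j) holomorphic_on ball 0 R"
    "\<And>z Z x. z \<in> ball 0 R \<Longrightarrow> ivp b z Y0 Y1 Z \<Longrightarrow> x \<in> {0..b} \<Longrightarrow> Z x = Y z x"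
proof -
  define N where "N = norm (mat 1 :: complex^'n^'n)"
  \<comment> \<open>positive, and at least twice the integral of the dominating function over \<open>[0,b]\<close>\<close>
  define \<kappa> where "\<kappa> = 2 * (mass + R * N * b) + 1"
  have N: "N \<ge> 0" by (simp add: N_def)
  have \<kappa>: "\<kappa> > 0" using mass_nonneg b R N by (auto simp: \<kappa>_def intro!: add_nonneg_pos)
  define K where "K x t = complex_of_real (max 0 (x - t) * exp (- \<kappa> * (x - t)))" for x t
  define f0 where "f0 x = exp (- (of_real \<kappa>) * of_real x) *\<^sub>C (Y0 + of_real x *\<^sub>C Y1)" for x
  interpret small_kernel "{0..b}" K "1 / \<kappa>" "ball 0 R" coeff
    "\<lambda>t. norm (Q t) + R * N" f0 "norm Y0 + b * norm Y1"
  proof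
    show "K x \<in> borel_measurable (lebesgue_on {0..b})" for x
      unfolding K_def by (intro continuous_imp_measurable_on_sets_lebesgue continuous_intros) auto
    show "norm (K x t) \<le> 1 / \<kappa>" for x t
      unfolding K_def norm_of_real by (rule ivp_kernel_bound[OF \<kappa>])
    show "continuous_on {0..b} (\<lambda>x. K x t)" for t
      unfolding K_def by (intro continuous_intros)
    show "coeff z absolutely_integrable_on {0..b}" for z
      by (rule coefficient_integrable)
    show "norm (coeff z t) \<le> norm (Q t) + R * N" if "z \<in> ball 0 R" for z t
    proof -
      have "norm z * N \<le> R * N" using that N by (intro mult_right_mono) auto
      then show ?thesis using norm_triangle_ineq4[of "Q t" "z *\<^sub>C mat 1"] by (simp add: N_def)
    qed
    show "(\<lambda>z. coeff z t $ i $ j) holomorphic_on ball 0 R" for t i j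
      by simp (intro holomorphic_intros)
    have i: "(\<lambda>t. norm (Q t)) integrable_on {0..b}"
      using local_integrable[of b] by (simp add: absolutely_integrable_on_def)
    show "(\<lambda>t. norm (Q t) + R * N) integrable_on {0..b}"
      by (intro integrable_add i integrable_const_ivl)
    have "integral {0..b} (\<lambda>t. norm (Q t) + R * N) = integral {0..b} (\<lambda>t. norm (Q t)) + R * N * b"
      using b i by (simp add: hk_integral_add integrable_const_ivl)
    also have "integral {0..b} (\<lambda>t. norm (Q t)) \<le> mass"
      unfolding mass_def by (rule integral_subset_le[OF _ i norm_integrable]) auto
    finally have "2 * integral {0..b} (\<lambda>t. norm (Q t) + R * N) \<le> \<kappa>"
      unfolding \<kappa>_def by simp
    then show "1 / \<kappa> * integral {0..b} (\<lambda>t. norm (Q t) + R * N) \<le> 1 / 2"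
      using \<kappa> by (simp add: field_simps)
    show "continuous_on {0..b} f0"
      unfolding f0_def by (intro continuous_intros)
    show "norm (f0 x) \<le> norm Y0 + b * norm Y1" if "x \<in> {0..b}" for x
    proof -
      have "norm (f0 x) \<le> 1 * norm (Y0 + of_real x *\<^sub>C Y1)"
        unfolding f0_def norm_cscale using \<kappa> that by (intro mult_right_mono) auto
      also have "\<dots> \<le> norm Y0 + x * norm Y1"
        using norm_triangle_ineq[of Y0 "of_real x *\<^sub>C Y1"] that by simp
      also have "\<dots> \<le> norm Y0 + b * norm Y1"
        using that by (simp add: mult_right_mono)
      finally show ?thesis .
    qed
  qed (use \<kappa> in auto)
  define E where "E x = exp (of_real \<kappa> * of_real x :: complex)" for x :: real
  have E: "exp (- (of_real \<kappa>) * of_real x) = inverse (E x)" "E x \<noteq> 0" for x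
    by (simp_all add: E_def exp_minus)
  have Ec: "continuous_on S E" for S
    unfolding E_def by (intro continuous_intros)
  have volterra_eq: "E x *\<^sub>C integral {0..b} (\<lambda>t. K x t *\<^sub>C (coeff z t ** (inverse (E t) *\<^sub>C Z t))) = volterra z Z x"
    if z: "z \<in> ball 0 R" and x: "x \<in> {0..b}" and Z: "continuous_on {0..b} Z" for z x Z
  proof -
    have c: "continuous_on {0..b} (\<lambda>t. inverse (E t) *\<^sub>C Z t)"
      by (intro continuous_intros Ec Z) (simp add: E)
    obtain B where "\<And>t. t \<in> {0..b} \<Longrightarrow> norm (inverse (E t) *\<^sub>C Z t) \<le> B"
      using continuous_on_Icc_bounded[OF c] by blast
    then have "(\<lambda>t. K x t *\<^sub>C (coeff z t ** (inverse (E t) *\<^sub>C Z t))) absolutely_integrable_on {0..b}"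
      by (rule integrand_integrable[OF z x c])
    then have i: "(\<lambda>t. K x t *\<^sub>C (coeff z t ** (inverse (E t) *\<^sub>C Z t))) integrable_on {0..x}"
      by (intro absolutely_integrable_integrable[OF absolutely_integrable_on_subinterval]) (use x in auto)
    have "integral {0..b} (\<lambda>t. K x t *\<^sub>C (coeff z t ** (inverse (E t) *\<^sub>C Z t))) =
        integral {0..x} (\<lambda>t. K x t *\<^sub>C (coeff z t ** (inverse (E t) *\<^sub>C Z t)))"
      by (rule integral_eq_on_support[symmetric]) (use x in \<open>auto simp: K_def\<close>)
    also have "E x *\<^sub>C \<dots> = integral {0..x} (\<lambda>t. E x *\<^sub>C K x t *\<^sub>C (coeff z t ** (inverse (E t) *\<^sub>C Z t)))"
      by (rule integral_cscale(2)[OF i, symmetric])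
    also have "\<dots> = volterra z Z x"
    proof (rule hk_integral_cong)
      fix t assume t: "t \<in> {0..x}"
      have "complex_of_real (exp (- \<kappa> * (x - t))) = E t / E x"
        by (simp add: E_def exp_of_real[symmetric] exp_diff[symmetric] algebra_simps)
      then have "E x * K x t * inverse (E t) = of_real (x - t)"
        using t E(2) by (simp add: K_def max_def)
      then show "E x *\<^sub>C K x t *\<^sub>C (coeff z t ** (inverse (E t) *\<^sub>C Z t)) = of_real (x - t) *\<^sub>C (coeff z t ** Z t)"
        by (simp add: mult.assoc)
    qed
    finally show ?thesis .
  qed
  have f0: "E x *\<^sub>C f0 x = Y0 + of_real x *\<^sub>C Y1" for x
    unfolding f0_def E(1) using E(2) by simp
  define Y where "Y z x = E x *\<^sub>C solution z x" for z x
  have sol: "solution z x = inverse (E x) *\<^sub>C Y z x" for z x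
    using E(2) by (simp add: Y_def)
  have Yc: "continuous_on {0..b} (Y z)" if "z \<in> ball 0 R" for z
    unfolding Y_def by (intro continuous_intros Ec solution_continuous that)
  show thesis
  proof (rule that)
    fix z :: complex assume z: "z \<in> ball 0 R"
    show "ivp b z Y0 Y1 (Y z)"
      unfolding ivp_def
    proof (intro conjI ballI Yc z)
      fix x assume x: "x \<in> {0..b}"
      have "Y z x = E x *\<^sub>C f0 x + E x *\<^sub>C integral {0..b} (\<lambda>t. K x t *\<^sub>C (coeff z t ** solution z t))"
        unfolding Y_def by (subst solution_equation[OF z x]) (simp only: cscale_distribs)
      then show "Y z x = Y0 + of_real x *\<^sub>C Y1 + volterra z (Y z) x"
        unfolding sol volterra_eq[OF z x Yc[OF z]] f0 .
    qed
    fix x assume x: "x \<in> {0..b}"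
    have "norm (E x) \<le> exp (\<kappa> * b)"
      using x \<kappa> by (simp add: E_def)
    then show "norm (Y z x) \<le> exp (\<kappa> * b) * (2 * (norm Y0 + b * norm Y1))"
      unfolding Y_def norm_cscale by (intro mult_mono solution_bound z x) auto
    fix Z assume Z: "ivp b z Y0 Y1 Z"
    have c: "continuous_on {0..b} (\<lambda>t. inverse (E t) *\<^sub>C Z t)"
      by (intro continuous_intros Ec ivp_continuous[OF Z]) (simp add: E)
    obtain B where B: "\<And>t. t \<in> {0..b} \<Longrightarrow> norm (inverse (E t) *\<^sub>C Z t) \<le> B"
      using continuous_on_Icc_bounded[OF c] by blast
    have "inverse (E x) *\<^sub>C Z x = solution z x"
    proof (rule solution_unique[OF z c B _ x])
      fix y assume y: "y \<in> {0..b}"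
      have "Z y = E y *\<^sub>C (f0 y + integral {0..b} (\<lambda>t. K y t *\<^sub>C (coeff z t ** (inverse (E t) *\<^sub>C Z t))))"
        unfolding cscale_distribs f0 volterra_eq[OF z y ivp_continuous[OF Z]] by (rule ivp_equation[OF Z y])
      then show "inverse (E y) *\<^sub>C Z y =
          f0 y + integral {0..b} (\<lambda>t. K y t *\<^sub>C (coeff z t ** (inverse (E t) *\<^sub>C Z t)))"
        using E(2)[of y] by (simp only: cscale_cscale) simp
    qed
    then show "Z x = Y z x"
      using E(2)[of x] by (simp add: Y_def flip: \<open>inverse (E x) *\<^sub>C Z x = solution z x\<close>)
  next
    show "(\<lambda>z. Y z x $ i $ j) holomorphic_on ball 0 R" if "x \<in> {0..b}" for x i j
      unfolding Y_def by simp (intro holomorphic_intros solution_holomorphic that)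
  qed
qed

lemma ivp_restrict:
  assumes Y: "ivp b z Y0 Y1 Y" and x: "x \<in> {0..b}"
  shows "ivp x z Y0 Y1 Y"
  unfolding ivp_def
proof
  show "continuous_on {0..x} Y"
    by (rule continuous_on_subset[OF ivp_continuous[OF Y]]) (use x in force)
  show "\<forall>x\<in>{0..x}. Y x = Y0 + of_real x *\<^sub>C Y1 + volterra z Y x"
    by (intro ballI ivp_equation[OF Y]) (use x in force)
qed

text \<open>
  The weights that give existence depend on the interval and on the disc for \<open>z\<close>. Taking the value at
  \<open>x\<close> from a solution on \<open>[0,x]\<close> glues all these local solutions together, by uniqueness.
\<close>

definition ivp_solution :: "complex^'n^'n \<Rightarrow> complex^'n^'n \<Rightarrow> complex \<Rightarrow> real \<Rightarrow> complex^'n^'n"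
  where "ivp_solution Y0 Y1 z x = (SOME Y. ivp x z Y0 Y1 Y) x"

definition ivp_deriv :: "complex^'n^'n \<Rightarrow> complex^'n^'n \<Rightarrow> complex \<Rightarrow> real \<Rightarrow> complex^'n^'n"
  where "ivp_deriv Y0 Y1 z x =
    Y1 + integral {0..x} (\<lambda>t. coeff z t ** ivp_solution Y0 Y1 z t)"

lemma ivp_solution_eq:
  assumes Y: "ivp b z Y0 Y1 Y" and x: "x \<in> {0..b}"
  shows "ivp_solution Y0 Y1 z x = Y x"
proof -
  have x0: "x \<ge> 0" and R: "norm z + 1 > 0" and z: "z \<in> ball 0 (norm z + 1)"
    using x by (auto simp: add_nonneg_pos)
  note Yx = ivp_restrict[OF Y x]
  have S: "ivp x z Y0 Y1 (SOME Y. ivp x z Y0 Y1 Y)"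
    by (rule someI[where P="ivp x z Y0 Y1", OF Yx])
  obtain W where W: "\<And>Z. ivp x z Y0 Y1 Z \<Longrightarrow> Z x = W"
    using ivp_local[OF x0 R, of Y0 Y1] z x0 by (metis atLeastAtMost_iff order_refl)
  show ?thesis
    unfolding ivp_solution_def W[OF S] W[OF Yx] ..
qed

lemma ivp_exists: "b \<ge> 0 \<Longrightarrow> \<exists>Y. ivp b z Y0 Y1 Y"
  using ivp_local[of b "norm z + 1" Y0 Y1]
  by (metis add.commute add_pos_nonneg dist_0_norm less_add_one mem_ball norm_ge_zero zero_less_one)

lemma ivp_solution_continuous: "continuous_on {0..b} (ivp_solution Y0 Y1 z)"
proof (cases "b \<ge> 0")
  case True
  then obtain Y where Y: "ivp b z Y0 Y1 Y" using ivp_exists by blast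
  show ?thesis
    by (rule continuous_on_eq[OF ivp_continuous[OF Y]]) (rule ivp_solution_eq[OF Y, symmetric])
qed simp

lemma ivp_solution_equation:
  assumes x: "x \<ge> 0"
  shows "ivp_solution Y0 Y1 z x = Y0 + of_real x *\<^sub>C Y1 +
    volterra z (ivp_solution Y0 Y1 z) x"
proof -
  obtain Y where Y: "ivp x z Y0 Y1 Y" using ivp_exists[OF x] by blast
  have "volterra z (ivp_solution Y0 Y1 z) x =
      volterra z Y x"
    by (rule hk_integral_cong) (simp only: ivp_solution_eq[OF Y])
  then show ?thesis
    using ivp_equation[OF Y, of x] ivp_solution_eq[OF Y, of x] x by simp
qed

lemma ivp_solution_entire:
  assumes x: "x \<ge> 0"
  shows "(\<lambda>z. ivp_solution Y0 Y1 z x $ i $ j) holomorphic_on UNIV"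
    and "(\<lambda>z. ivp_deriv Y0 Y1 z x $ i $ j) holomorphic_on UNIV"
proof -
  have "(\<lambda>z. ivp_solution Y0 Y1 z x $ i $ j) holomorphic_on ball 0 R \<and>
      (\<lambda>z. ivp_deriv Y0 Y1 z x $ i $ j) holomorphic_on ball 0 R" if R: "R > 0" for R
  proof -
    obtain Y M where Y: "\<And>z. z \<in> ball 0 R \<Longrightarrow> ivp x z Y0 Y1 (Y z)"
      and M: "\<And>z t. z \<in> ball 0 R \<Longrightarrow> t \<in> {0..x} \<Longrightarrow> norm (Y z t) \<le> M"
      and hol: "\<And>t i j. t \<in> {0..x} \<Longrightarrow> (\<lambda>z. Y z t $ i $ j) holomorphic_on ball 0 R"
      using ivp_local[OF x R, of Y0 Y1] by metis
    have hol': "(\<lambda>z. ivp_solution Y0 Y1 z t $ i $ j) holomorphic_on ball 0 R" if "t \<in> {0..x}" for t i j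
      by (rule holomorphic_transform[OF hol[OF that]]) (simp add: ivp_solution_eq[OF Y that])
    have M': "norm (ivp_solution Y0 Y1 z t) \<le> M" if "z \<in> ball 0 R" "t \<in> {0..x}" for z t
      unfolding ivp_solution_eq[OF Y[OF that(1)] that(2)] by (rule M[OF that])
    have V: "(\<lambda>t. coeff z t ** ivp_solution Y0 Y1 z t) integrable_on {0..x}"
      if "z \<in> ball 0 R" for z
      by (rule absolutely_integrable_integrable,
          rule absolutely_integrable_bilinear[OF
            bounded_bilinear.flip[OF bounded_bilinear_matrix_mult], where B=M])
        (use M'[OF that] in \<open>auto intro!: continuous_imp_measurable_on_sets_lebesgue[OF ivp_solution_continuous]
          coefficient_integrable\<close>)
    have "(\<lambda>z. integral {0..x} (\<lambda>t. (coeff z t ** ivp_solution Y0 Y1 z t) $ i $ j)) holomorphic_on ball 0 R"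
    proof (rule holomorphic_on_integral)
      show "(\<lambda>z. (coeff z t ** ivp_solution Y0 Y1 z t) $ i $ j) holomorphic_on ball 0 R"
        if "t \<in> {0..x}" for t
        unfolding matrix_matrix_mult_def by simp (intro holomorphic_intros hol'[OF that])
      show "(\<lambda>t. (coeff z t ** ivp_solution Y0 Y1 z t) $ i $ j) integrable_on {0..x}"
        if "z \<in> ball 0 R" for z
        by (rule integral_entry(1)[OF V[OF that]])
      show "(\<lambda>t. (norm (Q t) + R * norm (mat 1 :: complex^'n^'n)) * M) integrable_on {0..x}"
        using local_integrable[of x]
        by (intro integrable_on_mult_left integrable_add integrable_const_ivl)
          (simp add: absolutely_integrable_on_def)
      show "norm ((coeff z t ** ivp_solution Y0 Y1 z t) $ i $ j) \<le>
          (norm (Q t) + R * norm (mat 1 :: complex^'n^'n)) * M" if z: "z \<in> ball 0 R" and t: "t \<in> {0..x}" for z t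
      proof -
        have "norm z * norm (mat 1 :: complex^'n^'n) \<le> R * norm (mat 1 :: complex^'n^'n)"
          using z by (intro mult_right_mono) auto
        then have q: "norm (coeff z t) \<le> norm (Q t) + R * norm (mat 1 :: complex^'n^'n)"
          using norm_triangle_ineq4[of "Q t" "z *\<^sub>C mat 1"] by simp
        have "norm ((coeff z t ** ivp_solution Y0 Y1 z t) $ i $ j) \<le>
            norm (coeff z t ** ivp_solution Y0 Y1 z t)"
          by (rule order_trans[OF Finite_Cartesian_Product.norm_nth_le Finite_Cartesian_Product.norm_nth_le])
        also have "\<dots> \<le> norm (coeff z t) * norm (ivp_solution Y0 Y1 z t)"
          by (rule norm_matrix_mult_le)
        also have "\<dots> \<le> (norm (Q t) + R * norm (mat 1 :: complex^'n^'n)) * M"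
          using R by (intro mult_mono q M' z t) auto
        finally show ?thesis .
      qed
    qed simp
    moreover have "integral {0..x} (\<lambda>t. (coeff z t ** ivp_solution Y0 Y1 z t) $ i $ j) =
        integral {0..x} (\<lambda>t. coeff z t ** ivp_solution Y0 Y1 z t) $ i $ j" if "z \<in> ball 0 R" for z
      by (rule integral_entry(2)[OF V[OF that]])
    ultimately have "(\<lambda>z. integral {0..x} (\<lambda>t. coeff z t ** ivp_solution Y0 Y1 z t) $ i $ j) holomorphic_on ball 0 R"
      by (rule holomorphic_transform)
    then have "(\<lambda>z. ivp_deriv Y0 Y1 z x $ i $ j) holomorphic_on ball 0 R"
      unfolding ivp_deriv_def by simp (intro holomorphic_intros)
    then show ?thesis using hol'[of x] x by simp
  qed
  then show "(\<lambda>z. ivp_solution Y0 Y1 z x $ i $ j) holomorphic_on UNIV"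
    and "(\<lambda>z. ivp_deriv Y0 Y1 z x $ i $ j) holomorphic_on UNIV"
    by (auto intro!: entire_if_holomorphic_on_balls)
qed

lemma ivp_solution_solves: "solves Q z (ivp_solution Y0 Y1 z) (ivp_deriv Y0 Y1 z)"
proof -
  define V where "V t = coeff z t ** ivp_solution Y0 Y1 z t" for t
  have V: "V absolutely_integrable_on {0..x}" for x
  proof -
    obtain B where "\<And>t. t \<in> {0..x} \<Longrightarrow> norm (ivp_solution Y0 Y1 z t) \<le> B"
      using continuous_on_Icc_bounded[OF ivp_solution_continuous] by blast
    then show ?thesis
      unfolding V_def
      by (intro absolutely_integrable_bilinear[OF
            bounded_bilinear.flip[OF bounded_bilinear_matrix_mult], where B=B])
        (auto intro!: continuous_imp_measurable_on_sets_lebesgue[OF ivp_solution_continuous]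
          coefficient_integrable)
  qed
  have d: "has_ac_deriv (ivp_deriv Y0 Y1 z) V"
    unfolding ivp_deriv_def V_def[symmetric] by (rule has_ac_deriv_integral[OF V])
  have "has_ac_deriv (ivp_solution Y0 Y1 z) (ivp_deriv Y0 Y1 z)"
  proof (rule has_ac_deriv_cong[OF has_ac_deriv_add[OF has_ac_deriv_const[of Y0] has_ac_deriv_taylor[OF d]]])
    fix x :: real assume "x \<ge> 0"
    then show "Y0 + (of_real x *\<^sub>C ivp_deriv Y0 Y1 z 0 + integral {0..x} (\<lambda>t. of_real (x - t) *\<^sub>C V t)) =
        ivp_solution Y0 Y1 z x"
      using ivp_solution_equation[of x Y0 Y1 z] by (simp add: ivp_deriv_def V_def add.assoc)
  qed simp
  moreover have "has_ac_deriv (ivp_deriv Y0 Y1 z) (\<lambda>x. Q x ** ivp_solution Y0 Y1 z x - z *\<^sub>C ivp_solution Y0 Y1 z x)"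
    by (rule has_ac_deriv_cong[OF d]) (simp_all add: V_def cmatrix_simps)
  ultimately show ?thesis by (simp add: solves_def)
qed

lemma ivp_initial [simp]: "ivp_solution Y0 Y1 z 0 = Y0" "ivp_deriv Y0 Y1 z 0 = Y1"
  using ivp_solution_equation[of 0 Y0 Y1 z] by (simp_all add: ivp_deriv_def)

lemma solves_imp_ivp_solution:
  assumes Y: "solves Q z Y Y1" and x: "x \<ge> 0"
  shows "Y x = ivp_solution (Y 0) (Y1 0) z x"
proof -
  define V where "V t = coeff z t ** Y t" for t
  have d0: "has_ac_deriv Y Y1" and d1: "has_ac_deriv Y1 V"
    using Y unfolding solves_def by (auto intro: has_ac_deriv_cong simp: V_def cmatrix_simps)
  have "ivp x z (Y 0) (Y1 0) Y"
    unfolding ivp_def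
  proof (intro conjI ballI)
    show "continuous_on {0..x} Y" by (rule has_ac_deriv_continuous_on[OF d0])
    fix y assume "y \<in> {0..x}"
    then have y: "y \<ge> 0" by simp
    have "has_ac_deriv (\<lambda>x. Y x - (of_real x *\<^sub>C Y1 0 + integral {0..x} (\<lambda>t. of_real (x - t) *\<^sub>C V t))) (\<lambda>x. 0)"
      using has_ac_deriv_diff[OF d0 has_ac_deriv_taylor[OF d1]] by simp
    from has_ac_deriv_zero_imp_constant[OF this y]
    show "Y y = Y 0 + of_real y *\<^sub>C Y1 0 + volterra z Y y"
      unfolding V_def by (simp add: diff_eq_eq add.assoc)
  qed
  then show ?thesis
    by (rule ivp_solution_eq[symmetric]) (use x in simp)
qed

end

section \<open>Asymptotics in the upper half-plane\<close>

text \<open>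
  Neighbourhoods of infinity in the open upper half-plane. The square maps this half-plane onto the
  complement of \<open>[0,\<infinity>)\<close>.
\<close>

definition at_upper :: "complex filter"
  where "at_upper = inf at_infinity (principal {\<rho>. Im \<rho> > 0})"

lemma eventually_at_upper:
  "eventually P at_upper \<longleftrightarrow> (\<exists>R. \<forall>\<rho>. Im \<rho> > 0 \<and> R \<le> norm \<rho> \<longrightarrow> P \<rho>)"
  by (auto simp: at_upper_def eventually_inf_principal eventually_at_infinity)

lemma eventually_large: "\<forall>\<^sub>F \<rho> in at_upper. Im \<rho> > 0 \<and> R \<le> norm \<rho>"
  unfolding eventually_at_upper by blast

lemma at_upper_nontrivial: "at_upper \<noteq> bot"
proof -
  have "\<exists>\<rho>. Im \<rho> > 0 \<and> R \<le> norm \<rho>" for R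
    by (rule exI[of _ "\<i> * of_real (\<bar>R\<bar> + 1)"]) (simp add: norm_mult norm_of_real add_nonneg_pos abs_ge_self le_add_same_cancel1
        order_trans[OF abs_ge_self] del: of_real_add)
  then have "\<not> eventually (\<lambda>_. False) at_upper"
    unfolding eventually_at_upper by blast
  then show ?thesis by (auto simp: trivial_limit_def)
qed

lemma tendsto_const_over_norm: "((\<lambda>\<rho>. C / norm \<rho>) \<longlongrightarrow> 0) at_upper"
proof -
  have "((\<lambda>\<rho> :: complex. C / norm \<rho>) \<longlongrightarrow> 0) at_infinity"
    by (intro tendsto_divide_0[OF tendsto_const] filterlim_at_top_imp_at_infinity filterlim_norm_at_top)
  then show ?thesis
    unfolding at_upper_def by (rule tendsto_mono[OF inf_le1])
qed

lemma tendsto_at_upper_bound: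
  fixes f :: "complex \<Rightarrow> 'a::real_normed_vector"
  assumes "\<And>\<rho>. Im \<rho> > 0 \<Longrightarrow> R \<le> norm \<rho> \<Longrightarrow> norm (f \<rho> - l) \<le> C / norm \<rho>"
  shows "(f \<longlongrightarrow> l) at_upper"
proof (rule LIM_zero_cancel, rule Lim_null_comparison[OF _ tendsto_const_over_norm])
  show "\<forall>\<^sub>F \<rho> in at_upper. norm (f \<rho> - l) \<le> C / norm \<rho>"
    using eventually_large[of R] by (rule eventually_mono) (use assms in auto)
qed

text \<open>
  The hypothesis says that \<open>f\<close> tends to \<open>l\<close> at infinity off \<open>[0,\<infinity>)\<close>, uniformly in the direction. By
  continuity the estimate extends to \<open>[0,\<infinity>)\<close>, and Liouville's theorem applies.
\<close>

lemma entire_eq_limit: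
  assumes f: "f holomorphic_on UNIV" and lim: "((\<lambda>\<rho>. f (\<rho>\<^sup>2)) \<longlongrightarrow> l) at_upper"
  shows "f z = l"
proof (rule Liouville_weak[OF f])
  show "(f \<longlongrightarrow> l) at_infinity"
    unfolding tendsto_iff
  proof (intro allI impI)
    fix e :: real assume e: "e > 0"
    have "\<forall>\<^sub>F \<rho> in at_upper. dist (f (\<rho>\<^sup>2)) l < e / 2"
      by (rule tendstoD[OF lim]) (use e in simp)
    then obtain R where R: "\<And>\<rho>. Im \<rho> > 0 \<Longrightarrow> R \<le> norm \<rho> \<Longrightarrow> dist (f (\<rho>\<^sup>2)) l < e / 2"
      unfolding eventually_at_upper by blast
    show "\<forall>\<^sub>F z in at_infinity. dist (f z) l < e"
      unfolding eventually_at_infinity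
    proof (intro exI allI impI)
      fix z :: complex assume z: "R\<^sup>2 \<le> norm z"
      define \<rho> where "\<rho> = (if Im (csqrt z) \<ge> 0 then csqrt z else - csqrt z)"
      have \<rho>: "\<rho>\<^sup>2 = z" "Im \<rho> \<ge> 0" by (auto simp: \<rho>_def)
      have "R \<le> norm \<rho>"
      proof -
        have "R\<^sup>2 \<le> (norm \<rho>)\<^sup>2" using z \<rho>(1) by (metis norm_power)
        then show ?thesis by (rule power2_le_imp_le) simp
      qed
      \<comment> \<open>the root \<open>\<rho>\<close> may be real, so it is approached from inside the half-plane\<close>
      define w where "w n = \<rho> + \<i> * of_real (inverse (real (Suc n)))" for n
      have w: "Im (w n) > 0" "R \<le> norm (w n)" for n
      proof -
        show "Im (w n) > 0" using \<rho>(2) by (simp add: w_def add_nonneg_pos)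
        have "norm \<rho> \<le> norm (w n)"
          unfolding norm_complex_def
          by (intro real_sqrt_le_mono) (use \<rho>(2) in \<open>simp add: w_def power_mono\<close>)
        then show "R \<le> norm (w n)" using \<open>R \<le> norm \<rho>\<close> by simp
      qed
      have "w \<longlonglongrightarrow> \<rho> + \<i> * of_real 0"
        unfolding w_def by (intro tendsto_intros LIMSEQ_inverse_real_of_nat)
      then have "(\<lambda>n. (w n)\<^sup>2) \<longlonglongrightarrow> z"
        using \<rho>(1) by (auto intro!: tendsto_eq_intros)
      moreover have "isCont f z"
        using holomorphic_on_imp_continuous_on[OF f] by (simp add: continuous_on_eq_continuous_at)
      ultimately have "(\<lambda>n. f ((w n)\<^sup>2)) \<longlonglongrightarrow> f z"
        by (rule isCont_tendsto_compose[rotated])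
      then have "(\<lambda>n. dist (f ((w n)\<^sup>2)) l) \<longlonglongrightarrow> dist (f z) l"
        by (intro tendsto_intros)
      then have "dist (f z) l \<le> e / 2"
        by (rule LIMSEQ_le_const2) (use R w in \<open>auto intro!: exI[of _ 0] less_imp_le\<close>)
      then show "dist (f z) l < e" using e by simp
    qed
  qed
qed

lemma matrix_mult_eq_0_imp_invertible:
  fixes X :: "complex^'n^'n"
  assumes "\<And>Y :: complex^'n^'n. X ** Y = 0 \<Longrightarrow> Y = 0"
  shows "invertible X"
proof -
  have "v = 0" if "X *v v = 0" for v
  proof -
    have "X ** (\<chi> i j. v $ i) = 0"
      using that by (simp add: vec_eq_iff matrix_matrix_mult_def matrix_vector_mult_def)
    then show ?thesis using assms by (fastforce simp: vec_eq_iff)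
  qed
  then show ?thesis
    using matrix_left_invertible_ker[of X] invertible_left_inverse by blast
qed

lemma matrix_inv_mult:
  fixes X :: "complex^'n^'n"
  assumes "invertible X"
  shows "X ** matrix_inv X = mat 1" "matrix_inv X ** X = mat 1"
  using someI_ex[OF assms[unfolded invertible_def]] by (simp_all add: matrix_inv_def)

lemma near_identity_invertible:
  fixes X :: "complex^'n^'n"
  assumes X: "norm (X - mat 1) \<le> 1 / 2"
  shows "invertible X" "norm (matrix_inv X - mat 1) \<le> 2 * norm (mat 1 :: complex^'n^'n) * norm (X - mat 1)"
proof -
  have half: "norm ((X - mat 1) ** Y) \<le> norm Y / 2" for Y :: "complex^'n^'n"
    using order_trans[OF norm_matrix_mult_le[of "X - mat 1" Y] mult_right_mono[OF X norm_ge_zero]] by simp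
  show inv: "invertible X"
  proof (rule matrix_mult_eq_0_imp_invertible)
    fix Y :: "complex^'n^'n" assume "X ** Y = 0"
    then have "(X - mat 1) ** Y = - Y" by (simp add: matrix_mult_distribs)
    then show "Y = 0" using half[of Y] by simp
  qed
  define Z where "Z = matrix_inv X"
  have eq: "Z - mat 1 = - ((X - mat 1) ** Z)"
    using matrix_inv_mult(1)[OF inv] by (simp add: matrix_mult_distribs Z_def)
  have "norm Z \<le> norm (mat 1 :: complex^'n^'n) + norm (Z - mat 1)"
    using norm_triangle_ineq[of "mat 1" "Z - mat 1"] by simp
  also have "norm (Z - mat 1) \<le> norm Z / 2"
    unfolding eq using half[of Z] by simp
  finally have Z: "norm Z \<le> 2 * norm (mat 1 :: complex^'n^'n)" by simp
  have "norm (Z - mat 1) \<le> norm (X - mat 1) * norm Z"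
    unfolding eq using norm_matrix_mult_le[of "X - mat 1" Z] by simp
  also have "\<dots> \<le> norm (X - mat 1) * (2 * norm (mat 1 :: complex^'n^'n))"
    by (rule mult_left_mono[OF Z]) simp
  finally show "norm (matrix_inv X - mat 1) \<le> 2 * norm (mat 1 :: complex^'n^'n) * norm (X - mat 1)"
    by (simp add: Z_def mult_ac)
qed

lemma tendsto_identity_invertible:
  fixes f :: "'a \<Rightarrow> complex^'n^'n"
  assumes f: "(f \<longlongrightarrow> mat 1) F"
  shows "\<forall>\<^sub>F x in F. invertible (f x)" "((\<lambda>x. matrix_inv (f x)) \<longlongrightarrow> mat 1) F"
proof -
  have "\<forall>\<^sub>F x in F. dist (f x) (mat 1) < 1 / 2"
    by (rule tendstoD[OF f]) simp
  then have near: "\<forall>\<^sub>F x in F. norm (f x - mat 1) \<le> 1 / 2"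
    by (rule eventually_mono) (simp add: dist_norm)
  then show "\<forall>\<^sub>F x in F. invertible (f x)"
    by (rule eventually_mono) (rule near_identity_invertible)
  show "((\<lambda>x. matrix_inv (f x)) \<longlongrightarrow> mat 1) F"
  proof (rule LIM_zero_cancel, rule Lim_null_comparison)
    show "\<forall>\<^sub>F x in F. norm (matrix_inv (f x) - mat 1) \<le> 2 * norm (mat 1 :: complex^'n^'n) * norm (f x - mat 1)"
      using near by (rule eventually_mono) (rule near_identity_invertible)
    show "((\<lambda>x. 2 * norm (mat 1 :: complex^'n^'n) * norm (f x - mat 1)) \<longlongrightarrow> 0) F"
      using f by (intro tendsto_eq_intros | simp)+
  qed
qed

text \<open>Conversely to \<open>solves_wave\<close>, \<open>Y\<close> and \<open>Y1\<close> determine the coefficients of the two waves.\<close>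

lemma waves_of_solution:
  fixes Y Y1 :: "real \<Rightarrow> complex^'n^'n"
  assumes \<rho>: "\<rho> \<noteq> 0" and Y: "solves Q (\<rho>\<^sup>2) Y Y1"
  shows "has_ac_deriv (\<lambda>x. (ew_inv \<rho> x / 2) *\<^sub>C (Y x + (1 / (\<i> * \<rho>)) *\<^sub>C Y1 x))
      (\<lambda>x. (ew_inv \<rho> x / (2 * \<i> * \<rho>)) *\<^sub>C (Q x ** Y x))" (is ?a)
    and "has_ac_deriv (\<lambda>x. (ew \<rho> x / 2) *\<^sub>C (Y x - (1 / (\<i> * \<rho>)) *\<^sub>C Y1 x))
      (\<lambda>x. (- ew \<rho> x / (2 * \<i> * \<rho>)) *\<^sub>C (Q x ** Y x))" (is ?b)
proof -
  have Y0: "has_ac_deriv Y Y1" and d: "has_ac_deriv Y1 (\<lambda>x. Q x ** Y x - \<rho>\<^sup>2 *\<^sub>C Y x)"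
    using Y by (auto simp: solves_def)
  note Y1 = has_ac_deriv_linear[OF bounded_linear_cscale[of "1 / (\<i> * \<rho>)"] d]
  show ?a
    by (rule has_ac_deriv_cong[OF has_ac_deriv_linear[OF bounded_linear_cscale[of "1 / 2"]
            has_ac_deriv_cscale[OF has_ac_deriv_exp[of "- (\<i> * \<rho>)"] has_ac_deriv_add[OF Y0 Y1]]]])
      (use \<rho> in \<open>auto simp: vec_eq_iff field_simps power2_eq_square\<close>)
  show ?b
    by (rule has_ac_deriv_cong[OF has_ac_deriv_linear[OF bounded_linear_cscale[of "1 / 2"]
            has_ac_deriv_cscale[OF has_ac_deriv_exp[of "\<i> * \<rho>"] has_ac_deriv_diff[OF Y0 Y1]]]])
      (use \<rho> in \<open>auto simp: vec_eq_iff field_simps power2_eq_square\<close>)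
qed

context potential
begin

text \<open>
  The solution with initial data \<open>(0, I)\<close> behaves like \<open>sin (\<rho>x) / \<rho>\<close>. Multiplication by \<open>ew\<close> makes this
  comparison uniform in the half-plane. As for the Jost solution, a bound for the product \<open>ew S\<close>
  improves itself.
\<close>

lemma dirichlet_asymptotics:
  assumes \<rho>: "Im \<rho> > 0" "2 * mass \<le> norm \<rho>" and x: "x \<ge> 0"
  shows "norm (ew \<rho> x *\<^sub>C ivp_solution 0 (mat 1) (\<rho>\<^sup>2) x -
      ((ew2 \<rho> x - 1) / (2 * \<i> * \<rho>)) *\<^sub>C mat 1)
      \<le> 2 * norm (mat 1 :: complex^'n^'n) * mass / (norm \<rho>)\<^sup>2"
    and "norm (ew \<rho> x *\<^sub>C ivp_deriv 0 (mat 1) (\<rho>\<^sup>2) x -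
      ((ew2 \<rho> x + 1) / 2) *\<^sub>C mat 1)
      \<le> 2 * norm (mat 1 :: complex^'n^'n) * mass / norm \<rho>"
proof -
  define N where "N = norm (mat 1 :: complex^'n^'n)"
  have \<rho>0: "\<rho> \<noteq> 0" using \<rho> by auto
  define S where "S = ivp_solution 0 (mat 1) (\<rho>\<^sup>2)"
  define S1 where "S1 = ivp_deriv 0 (mat 1) (\<rho>\<^sup>2)"
  have sol: "solves Q (\<rho>\<^sup>2) S S1"
    unfolding S_def S1_def by (rule ivp_solution_solves)
  define a where "a x = (ew_inv \<rho> x / 2) *\<^sub>C (S x + (1 / (\<i> * \<rho>)) *\<^sub>C S1 x)" for x
  define b where "b x = (ew \<rho> x / 2) *\<^sub>C (S x - (1 / (\<i> * \<rho>)) *\<^sub>C S1 x)" for x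
  note waves = waves_of_solution[OF \<rho>0 sol, folded a_def b_def]
  have a0: "a 0 = (1 / (2 * \<i> * \<rho>)) *\<^sub>C mat 1" and b0: "b 0 = - ((1 / (2 * \<i> * \<rho>)) *\<^sub>C mat 1)"
    by (simp_all add: a_def b_def S_def S1_def cscale_distribs mult.assoc)
  define E where "E x = ew \<rho> x" for x :: real
  define E2 where "E2 x = ew2 \<rho> x" for x :: real
  have E: "ew_inv \<rho> x = inverse (E x)" "E2 x = E x * E x" "E x \<noteq> 0" for x
    by (auto simp: E_def E2_def exp_minus mult.assoc simp flip: exp_add)
  \<comment> \<open>deviations of the wave coefficients from their initial values, in the scale of \<open>ew S\<close>\<close>
  define p where "p x = E2 x *\<^sub>C (a x - (1 / (2 * \<i> * \<rho>)) *\<^sub>C mat 1)" for x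
  define q where "q x = b x + (1 / (2 * \<i> * \<rho>)) *\<^sub>C mat 1" for x
  have S_pq: "E x *\<^sub>C S x - ((E2 x - 1) / (2 * \<i> * \<rho>)) *\<^sub>C mat 1 = p x + q x" for x
    using \<rho>0 E(3)[of x] unfolding p_def q_def a_def b_def E(1,2) E_def[symmetric]
    by (simp add: vec_eq_iff field_simps)
  have S1_pq: "E x *\<^sub>C S1 x - ((E2 x + 1) / 2) *\<^sub>C mat 1 = (\<i> * \<rho>) *\<^sub>C (p x - q x)" for x
    using \<rho>0 E(3)[of x] unfolding p_def q_def a_def b_def E(1,2) E_def[symmetric]
    by (simp add: vec_eq_iff field_simps)
  have pq: "norm (p y) \<le> B * mass / (2 * norm \<rho>)" "norm (q y) \<le> B * mass / (2 * norm \<rho>)"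
    if B: "\<And>t. t \<in> {0..x} \<Longrightarrow> norm (E t *\<^sub>C S t) \<le> B" and y: "y \<in> {0..x}" for B y
  proof -
    have y0: "y \<ge> 0" using y by simp
    have B0: "B \<ge> 0" by (rule order_trans[OF norm_ge_zero B[of 0]]) (use x in auto)
    have QS: "norm ((c / (2 * \<i> * \<rho>)) *\<^sub>C (Q t ** (E t *\<^sub>C S t))) \<le> B / (2 * norm \<rho>) * norm (Q t)"
      if "norm c \<le> 1" "t \<in> {0..y}" for c t
    proof -
      have "norm ((c / (2 * \<i> * \<rho>)) *\<^sub>C (Q t ** (E t *\<^sub>C S t))) =
          norm c * norm (Q t ** (E t *\<^sub>C S t)) / (2 * norm \<rho>)"
        unfolding norm_cscale by (simp add: norm_divide norm_mult)
      also have "\<dots> \<le> 1 * (norm (Q t) * B) / (2 * norm \<rho>)"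
        by (intro divide_right_mono mult_mono order_trans[OF norm_matrix_mult_le] B)
          (use that y in auto)
      finally show ?thesis by (simp add: mult_ac)
    qed
    have "norm (integral {0..y} (\<lambda>t. E2 y *\<^sub>C (ew_inv \<rho> t / (2 * \<i> * \<rho>)) *\<^sub>C (Q t ** S t)))
        \<le> B / (2 * norm \<rho>) * mass"
    proof (rule bounded_multiple_integral)
      show "(\<lambda>t. E2 y *\<^sub>C (ew_inv \<rho> t / (2 * \<i> * \<rho>)) *\<^sub>C (Q t ** S t)) integrable_on {0..y}"
        by (rule integral_cscale(1)[OF has_ac_derivD(2)[OF waves(1) y0]])
      fix t assume t: "t \<in> {0..y}"
      have "E2 y * ew_inv \<rho> t = ew2 \<rho> (y - t) * E t"
        by (simp add: E2_def E_def exp_add[symmetric] algebra_simps)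
      then have "E2 y *\<^sub>C (ew_inv \<rho> t / (2 * \<i> * \<rho>)) *\<^sub>C (Q t ** S t) =
          (ew2 \<rho> (y - t) / (2 * \<i> * \<rho>)) *\<^sub>C (Q t ** (E t *\<^sub>C S t))"
        by (simp add: divide_simps mult_ac)
      then show "norm (E2 y *\<^sub>C (ew_inv \<rho> t / (2 * \<i> * \<rho>)) *\<^sub>C (Q t ** S t))
          \<le> B / (2 * norm \<rho>) * norm (Q t)"
        using QS[OF jost_kernel_bound[OF \<rho>(1), of t y] t] t by (simp only: atLeastAtMost_iff)
    qed (use B0 in auto)
    moreover have "integral {0..y} (\<lambda>t. E2 y *\<^sub>C (ew_inv \<rho> t / (2 * \<i> * \<rho>)) *\<^sub>C (Q t ** S t)) = p y"
    proof -
      have "p y = E2 y *\<^sub>C integral {0..y} (\<lambda>t. (ew_inv \<rho> t / (2 * \<i> * \<rho>)) *\<^sub>C (Q t ** S t))"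
        unfolding p_def has_ac_derivD(3)[OF waves(1) y0] a0 by (simp only: add_diff_cancel_left')
      also have "\<dots> = integral {0..y} (\<lambda>t. E2 y *\<^sub>C (ew_inv \<rho> t / (2 * \<i> * \<rho>)) *\<^sub>C (Q t ** S t))"
        by (rule integral_cscale(2)[OF has_ac_derivD(2)[OF waves(1) y0], symmetric])
      finally show ?thesis by simp
    qed
    ultimately show "norm (p y) \<le> B * mass / (2 * norm \<rho>)" by simp
    have "norm (integral {0..y} (\<lambda>t. (- ew \<rho> t / (2 * \<i> * \<rho>)) *\<^sub>C (Q t ** S t)))
        \<le> B / (2 * norm \<rho>) * mass"
    proof (rule bounded_multiple_integral[OF has_ac_derivD(2)[OF waves(2) y0]])
      fix t assume t: "t \<in> {0..y}"
      have "(- ew \<rho> t / (2 * \<i> * \<rho>)) *\<^sub>C (Q t ** S t) =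
          ((- 1) / (2 * \<i> * \<rho>)) *\<^sub>C (Q t ** (E t *\<^sub>C S t))"
        by (simp add: E_def)
      then show "norm ((- ew \<rho> t / (2 * \<i> * \<rho>)) *\<^sub>C (Q t ** S t))
          \<le> B / (2 * norm \<rho>) * norm (Q t)"
        using QS[OF _ t, of "- 1"] by simp
    qed (use B0 in auto)
    moreover have "integral {0..y} (\<lambda>t. (- ew \<rho> t / (2 * \<i> * \<rho>)) *\<^sub>C (Q t ** S t)) = q y"
      unfolding q_def has_ac_derivD(3)[OF waves(2) y0] b0 by simp
    ultimately show "norm (q y) \<le> B * mass / (2 * norm \<rho>)" by simp
  qed
  have E2_bound: "norm (E2 y) \<le> 1" if "y \<ge> 0" for y
    using jost_kernel_bound[OF \<rho>(1), of 0 y] that by (simp add: E2_def)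
  have ratio: "mass / norm \<rho> \<le> 1 / 2"
    using \<rho>(2) \<rho>0 by (simp add: divide_simps)
  have cont: "continuous_on {0..x} (\<lambda>t. E t *\<^sub>C S t)"
    unfolding E_def S_def by (intro continuous_intros ivp_solution_continuous)
  obtain B0 where B0: "\<And>t. t \<in> {0..x} \<Longrightarrow> norm (E t *\<^sub>C S t) \<le> B0"
    using continuous_on_Icc_bounded[OF cont] by blast
  have bound: "norm (E y *\<^sub>C S y) \<le> 2 * (N / norm \<rho>)" if "y \<in> {0..x}" for y
  proof (rule halving_bound[of "{0..x}" "\<lambda>t. norm (E t *\<^sub>C S t)", OF B0 _ that])
    fix B y
    assume B: "\<And>t. t \<in> {0..x} \<Longrightarrow> norm (E t *\<^sub>C S t) \<le> B" and y: "y \<in> {0..x}"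
    have B_nonneg: "B \<ge> 0" by (rule order_trans[OF norm_ge_zero B[OF y]])
    have "norm (E y *\<^sub>C S y) = norm (((E2 y - 1) / (2 * \<i> * \<rho>)) *\<^sub>C mat 1 + (p y + q y))"
      by (simp only: S_pq[symmetric]) simp
    also have "\<dots> \<le> norm (((E2 y - 1) / (2 * \<i> * \<rho>)) *\<^sub>C (mat 1 :: complex^'n^'n)) + (norm (p y) + norm (q y))"
      by (intro order_trans[OF norm_triangle_ineq] add_left_mono norm_triangle_ineq)
    also have "\<dots> \<le> N / norm \<rho> + (B * mass / (2 * norm \<rho>) + B * mass / (2 * norm \<rho>))"
    proof (intro add_mono pq B y)
      have "norm (E2 y - 1) \<le> 2"
        using norm_triangle_ineq4[of "E2 y" 1] E2_bound[of y] y by simp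
      then have "norm (E2 y - 1) * N / (2 * norm \<rho>) \<le> 2 * N / (2 * norm \<rho>)"
        by (intro divide_right_mono mult_right_mono) (auto simp: N_def)
      then show "norm (((E2 y - 1) / (2 * \<i> * \<rho>)) *\<^sub>C (mat 1 :: complex^'n^'n)) \<le> N / norm \<rho>"
        unfolding norm_cscale by (simp add: norm_divide norm_mult N_def)
    qed
    also have "\<dots> = N / norm \<rho> + B * (mass / norm \<rho>)" using \<rho>0 by (simp add: field_simps)
    also have "\<dots> \<le> N / norm \<rho> + B * (1 / 2)"
      by (intro add_left_mono mult_left_mono ratio B_nonneg)
    finally show "norm (E y *\<^sub>C S y) \<le> N / norm \<rho> + B / 2" by simp
  qed
  have fin: "norm (p x) + norm (q x) \<le> 2 * N * mass / (norm \<rho>)\<^sup>2"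
    using add_mono[OF pq[OF bound, of x]] x \<rho>0 by (simp add: field_simps power2_eq_square)
  show "norm (ew \<rho> x *\<^sub>C ivp_solution 0 (mat 1) (\<rho>\<^sup>2) x -
      ((ew2 \<rho> x - 1) / (2 * \<i> * \<rho>)) *\<^sub>C mat 1)
      \<le> 2 * norm (mat 1 :: complex^'n^'n) * mass / (norm \<rho>)\<^sup>2"
    unfolding S_def[symmetric] E_def[symmetric] E2_def[symmetric] S_pq N_def[symmetric]
    by (rule order_trans[OF norm_triangle_ineq fin])
  have "norm (p x - q x) \<le> 2 * N * mass / (norm \<rho>)\<^sup>2"
    by (rule order_trans[OF norm_triangle_ineq4 fin])
  then have "norm \<rho> * norm (p x - q x) \<le> norm \<rho> * (2 * N * mass / (norm \<rho>)\<^sup>2)"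
    by (rule mult_left_mono) simp
  then show "norm (ew \<rho> x *\<^sub>C ivp_deriv 0 (mat 1) (\<rho>\<^sup>2) x -
      ((ew2 \<rho> x + 1) / 2) *\<^sub>C mat 1)
      \<le> 2 * norm (mat 1 :: complex^'n^'n) * mass / norm \<rho>"
    unfolding S1_def[symmetric] E_def[symmetric] E2_def[symmetric] S1_pq N_def[symmetric]
    using \<rho>0 by (simp add: norm_mult power2_eq_square)
qed

lemma jost_solution_limit:
  assumes "x \<ge> 0"
  shows "((\<lambda>\<rho>. ew_inv \<rho> x *\<^sub>C jost_solution Q \<rho> x) \<longlongrightarrow> mat 1) at_upper"
  by (rule tendsto_at_upper_bound[OF jost_solution_asymptotics(2)[OF _ _ assms]])

lemma jost_deriv_limit:
  assumes "x \<ge> 0"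
  shows "((\<lambda>\<rho>. (ew_inv \<rho> x / (\<i> * \<rho>)) *\<^sub>C jost_deriv Q \<rho> x) \<longlongrightarrow> mat 1) at_upper"
proof (rule tendsto_at_upper_bound)
  fix \<rho> assume \<rho>: "Im \<rho> > 0" "2 * mass \<le> norm \<rho>"
  then have \<rho>0: "\<rho> \<noteq> 0" by auto
  have "(ew_inv \<rho> x / (\<i> * \<rho>)) *\<^sub>C jost_deriv Q \<rho> x - mat 1 =
      (1 / (\<i> * \<rho>)) *\<^sub>C (ew_inv \<rho> x *\<^sub>C jost_deriv Q \<rho> x - (\<i> * \<rho>) *\<^sub>C mat 1)"
    using \<rho>0 by (simp add: vec_eq_iff field_simps)
  then show "norm ((ew_inv \<rho> x / (\<i> * \<rho>)) *\<^sub>C jost_deriv Q \<rho> x - mat 1)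
      \<le> 2 * norm (mat 1 :: complex^'n^'n) * mass / norm \<rho>"
    using divide_right_mono[OF jost_solution_asymptotics(3)[OF \<rho> assms], of "norm \<rho>"]
    by (simp add: norm_divide norm_mult)
qed

lemma dirichlet_solution_limit:
  assumes "x \<ge> 0"
  shows "((\<lambda>\<rho>. (\<i> * \<rho> * ew \<rho> x) *\<^sub>C ivp_solution 0 (mat 1) (\<rho>\<^sup>2) x -
      ((ew2 \<rho> x - 1) / 2) *\<^sub>C mat 1) \<longlongrightarrow> 0) at_upper"
proof (rule tendsto_at_upper_bound)
  fix \<rho> assume \<rho>: "Im \<rho> > 0" "2 * mass \<le> norm \<rho>"
  then have \<rho>0: "\<rho> \<noteq> 0" by auto
  have "(\<i> * \<rho> * ew \<rho> x) *\<^sub>C ivp_solution 0 (mat 1) (\<rho>\<^sup>2) x -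
      ((ew2 \<rho> x - 1) / 2) *\<^sub>C mat 1 - 0 =
      (\<i> * \<rho>) *\<^sub>C (ew \<rho> x *\<^sub>C ivp_solution 0 (mat 1) (\<rho>\<^sup>2) x -
      ((ew2 \<rho> x - 1) / (2 * \<i> * \<rho>)) *\<^sub>C mat 1)"
    using \<rho>0 by (simp add: vec_eq_iff field_simps)
  then show "norm ((\<i> * \<rho> * ew \<rho> x) *\<^sub>C ivp_solution 0 (mat 1) (\<rho>\<^sup>2) x -
      ((ew2 \<rho> x - 1) / 2) *\<^sub>C mat 1 - 0)
      \<le> 2 * norm (mat 1 :: complex^'n^'n) * mass / norm \<rho>"
    using mult_left_mono[OF dirichlet_asymptotics(1)[OF \<rho> assms], of "norm \<rho>"] \<rho>0
    by (simp add: norm_mult power2_eq_square)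
qed

lemma dirichlet_deriv_limit:
  assumes "x \<ge> 0"
  shows "((\<lambda>\<rho>. ew \<rho> x *\<^sub>C ivp_deriv 0 (mat 1) (\<rho>\<^sup>2) x -
      ((ew2 \<rho> x + 1) / 2) *\<^sub>C mat 1) \<longlongrightarrow> 0) at_upper"
  by (rule tendsto_at_upper_bound[of "2 * mass" _ _ "2 * norm (mat 1 :: complex^'n^'n) * mass"])
    (use dirichlet_asymptotics(2)[OF _ _ assms] in simp)

end

section \<open>The adjoint equation and Wronskians\<close>

text \<open>
  The adjoint equation, in which the coefficient acts from the right. Its solutions are the transposes
  of the solutions for the transposed coefficient.
\<close>

definition solves_left :: "(real \<Rightarrow> complex^'n^'n) \<Rightarrow> complex \<Rightarrow> (real \<Rightarrow> complex^'n^'n) \<Rightarrow>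
    (real \<Rightarrow> complex^'n^'n) \<Rightarrow> bool"
  where "solves_left Q z Z Z1 \<longleftrightarrow>
    has_ac_deriv Z Z1 \<and> has_ac_deriv Z1 (\<lambda>x. Z x ** Q x - z *\<^sub>C Z x)"

lemma transpose_component: "transpose X $ i $ j = X $ j $ i"
  by (simp add: transpose_def)

lemma transpose_simps:
  fixes X Y :: "complex^'n^'n"
  shows "transpose (X + Y) = transpose X + transpose Y" "transpose (X - Y) = transpose X - transpose Y"
    "transpose (c *\<^sub>C X) = c *\<^sub>C transpose X"
    "transpose (0 :: complex^'n^'n) = 0"
  by (simp_all add: vec_eq_iff transpose_def)

lemma norm_transpose:
  fixes X :: "complex^'n^'n"
  shows "norm (transpose X) = norm X"
proof -
  have "norm Y = sqrt (\<Sum>i\<in>UNIV. \<Sum>j\<in>UNIV. (norm (Y $ i $ j))\<^sup>2)" for Y :: "complex^'n^'n"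
    by (simp add: norm_vec_def L2_set_def sum_nonneg)
  then show ?thesis
    by (simp add: transpose_def) (subst sum.swap, simp)
qed

lemma solves_left_transpose:
  fixes Q Y Y1 :: "real \<Rightarrow> complex^'n^'n"
  assumes "solves (\<lambda>x. transpose (Q x)) z Y Y1"
  shows "solves_left Q z (\<lambda>x. transpose (Y x)) (\<lambda>x. transpose (Y1 x))"
  using assms has_ac_deriv_linear[OF bounded_linear_transpose, of Y Y1]
    has_ac_deriv_linear[OF bounded_linear_transpose, of Y1 "\<lambda>x. transpose (Q x) ** Y x - z *\<^sub>C Y x"]
  by (simp add: solves_def solves_left_def transpose_simps matrix_transpose_mul)

lemma solves_mult_right:
  fixes Y :: "real \<Rightarrow> complex^'n^'n"
  assumes "solves Q z Y Y1"
  shows "solves Q z (\<lambda>x. Y x ** B) (\<lambda>x. Y1 x ** B)"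
  using assms has_ac_deriv_linear[OF bounded_linear_mult_matrix_right[of B], of Y Y1]
    has_ac_deriv_linear[OF bounded_linear_mult_matrix_right[of B], of Y1 "\<lambda>x. Q x ** Y x - z *\<^sub>C Y x"]
  by (simp add: solves_def cmatrix_simps)

lemma solves_add:
  assumes "solves Q z Y Y1" "solves Q z Z Z1"
  shows "solves Q z (\<lambda>x. Y x + Z x) (\<lambda>x. Y1 x + Z1 x)"
  using assms has_ac_deriv_add[of Y Y1 Z Z1]
    has_ac_deriv_add[of Y1 "\<lambda>x. Q x ** Y x - z *\<^sub>C Y x" Z1 "\<lambda>x. Q x ** Z x - z *\<^sub>C Z x"]
  by (simp add: solves_def cmatrix_simps algebra_simps)

lemma wronskian_constant:
  fixes Z Y :: "real \<Rightarrow> complex^'n^'n"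
  assumes Z: "solves_left Q z Z Z1" and Y: "solves Q z Y Y1" and x: "x \<ge> 0"
  shows "Z x ** Y1 x - Z1 x ** Y x = Z 0 ** Y1 0 - Z1 0 ** Y 0"
proof -
  have "has_ac_deriv (\<lambda>x. Z x ** Y1 x - Z1 x ** Y x)
      (\<lambda>x. (Z1 x ** Y1 x + Z x ** (Q x ** Y x - z *\<^sub>C Y x)) -
        ((Z x ** Q x - z *\<^sub>C Z x) ** Y x + Z1 x ** Y1 x))"
    using Z Y unfolding solves_def solves_left_def
    by (intro has_ac_deriv_diff has_ac_deriv_matrix_mult) auto
  then have "has_ac_deriv (\<lambda>x. Z x ** Y1 x - Z1 x ** Y x) (\<lambda>x. 0)"
    by (simp add: cmatrix_simps)
  then show ?thesis
    using has_ac_deriv_zero_imp_constant[OF _ x] by blast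
qed

lemma (in potential) transpose_potential: "potential (\<lambda>x. transpose (Q x))"
  by unfold_locales (rule absolutely_integrable_map[OF integrable bounded_linear_transpose])

lemma (in potential) jost_solution_bounds:
  assumes "Im \<rho> > 0" "2 * mass \<le> norm \<rho>" "x \<ge> 0"
  shows "norm (ew_inv \<rho> x *\<^sub>C jost_solution Q \<rho> x)
      \<le> norm (mat 1 :: complex^'n^'n) * (1 + 2 * mass / norm \<rho>)"
    and "norm (ew_inv \<rho> x *\<^sub>C jost_deriv Q \<rho> x)
      \<le> norm (mat 1 :: complex^'n^'n) * (norm \<rho> + 2 * mass)"
proof -
  show "norm (ew_inv \<rho> x *\<^sub>C jost_solution Q \<rho> x)
      \<le> norm (mat 1 :: complex^'n^'n) * (1 + 2 * mass / norm \<rho>)"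
    using jost_solution_asymptotics(2)[OF assms]
      norm_triangle_ineq2[of "ew_inv \<rho> x *\<^sub>C jost_solution Q \<rho> x" "mat 1"]
    by (simp add: algebra_simps)
  show "norm (ew_inv \<rho> x *\<^sub>C jost_deriv Q \<rho> x)
      \<le> norm (mat 1 :: complex^'n^'n) * (norm \<rho> + 2 * mass)"
    using jost_solution_asymptotics(3)[OF assms]
      norm_triangle_ineq2[of "ew_inv \<rho> x *\<^sub>C jost_deriv Q \<rho> x" "(\<i> * \<rho>) *\<^sub>C mat 1"]
    by (simp add: algebra_simps norm_mult)
qed

text \<open>
  The Wronskian of the Jost solutions of the equation and of its adjoint is constant, and it decays
  like \<open>exp (2i\<rho>x)\<close>, so it vanishes. In other words, both equations have the same logarithmic
  derivative at \<open>0\<close>.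
\<close>

lemma jost_wronskian:
  fixes Q :: "real \<Rightarrow> complex^'n^'n"
  assumes Q: "potential Q" and \<rho>: "Im \<rho> > 0" "2 * potential.mass Q \<le> norm \<rho>"
    "2 * potential.mass (\<lambda>x. transpose (Q x)) \<le> norm \<rho>"
  shows "transpose (jost_solution (\<lambda>x. transpose (Q x)) \<rho> 0) ** jost_deriv Q \<rho> 0 =
    transpose (jost_deriv (\<lambda>x. transpose (Q x)) \<rho> 0) ** jost_solution Q \<rho> 0"
proof -
  interpret q: potential Q by (rule Q)
  interpret r: potential "\<lambda>x. transpose (Q x)" by (rule q.transpose_potential)
  define e where "e = jost_solution Q \<rho>"
  define e1 where "e1 = jost_deriv Q \<rho>"
  define f where "f x = transpose (jost_solution (\<lambda>x. transpose (Q x)) \<rho> x)" for x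
  define f1 where "f1 x = transpose (jost_deriv (\<lambda>x. transpose (Q x)) \<rho> x)" for x
  define E where "E x = ew_inv \<rho> x" for x :: real
  define W where "W x = f x ** e1 x - f1 x ** e x" for x
  obtain K K1 L L1 where b: "\<And>x. x \<ge> 0 \<Longrightarrow> norm (E x *\<^sub>C e x) \<le> K" "\<And>x. x \<ge> 0 \<Longrightarrow> norm (E x *\<^sub>C e1 x) \<le> K1"
    "\<And>x. x \<ge> 0 \<Longrightarrow> norm (E x *\<^sub>C f x) \<le> L" "\<And>x. x \<ge> 0 \<Longrightarrow> norm (E x *\<^sub>C f1 x) \<le> L1"
    using q.jost_solution_bounds[OF \<rho>(1,2)] r.jost_solution_bounds[OF \<rho>(1,3)]
    unfolding E_def e_def e1_def f_def f1_def norm_cscale norm_transpose by blast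
  have W: "W x = W 0" if "x \<ge> 0" for x
    unfolding W_def f_def f1_def e_def e1_def
    by (rule wronskian_constant[OF solves_left_transpose[OF r.jost_solution_asymptotics(1)[OF \<rho>(1,3)]]
          q.jost_solution_asymptotics(1)[OF \<rho>(1,2)] that])
  have le: "norm (W 0) \<le> exp (- 2 * Im \<rho>) ^ n * (L * K1 + L1 * K)" for n
  proof -
    define x where "x = real n"
    have x: "x \<ge> 0" by (simp add: x_def)
    have "(E x * E x) *\<^sub>C W x = (E x *\<^sub>C f x) ** (E x *\<^sub>C e1 x) - (E x *\<^sub>C f1 x) ** (E x *\<^sub>C e x)"
      by (simp add: W_def cscale_distribs)
    moreover have "norm ((E x *\<^sub>C f x) ** (E x *\<^sub>C e1 x)) \<le> L * K1"
      by (rule order_trans[OF norm_matrix_mult_le mult_mono[OF b(3)[OF x] b(2)[OF x]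
            order_trans[OF norm_ge_zero b(3)[OF x]] norm_ge_zero]])
    moreover have "norm ((E x *\<^sub>C f1 x) ** (E x *\<^sub>C e x)) \<le> L1 * K"
      by (rule order_trans[OF norm_matrix_mult_le mult_mono[OF b(4)[OF x] b(1)[OF x]
            order_trans[OF norm_ge_zero b(4)[OF x]] norm_ge_zero]])
    ultimately have "norm ((E x * E x) *\<^sub>C W x) \<le> L * K1 + L1 * K"
      by (simp only:) (rule order_trans[OF norm_triangle_ineq4 add_mono])
    then have "norm (E x * E x) * norm (W x) \<le> L * K1 + L1 * K"
      by (simp only: norm_cscale)
    then have "norm (W 0) \<le> inverse (norm (E x * E x)) * (L * K1 + L1 * K)"
      unfolding W[OF x] by (simp add: E_def field_simps)
    also have "inverse (norm (E x * E x)) = exp (- 2 * Im \<rho>) ^ n"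
      unfolding E_def x_def
      by (simp add: norm_mult exp_of_nat_mult[symmetric] exp_minus[symmetric] exp_add[symmetric] algebra_simps)
    finally show ?thesis .
  qed
  have "(\<lambda>n. exp (- 2 * Im \<rho>) ^ n * (L * K1 + L1 * K)) \<longlonglongrightarrow> 0 * (L * K1 + L1 * K)"
    by (intro tendsto_intros LIMSEQ_power_zero) (use \<rho>(1) in simp)
  then have "norm (W 0) \<le> 0"
    using LIMSEQ_le_const[of _ _ "norm (W 0)"] le by fastforce
  then show ?thesis
    by (simp add: W_def f_def f1_def e_def e1_def)
qed

section \<open>The potential is determined by the logarithmic derivative of the Jost solution\<close>

context potential
begin

lemma solves_imp_ivp_deriv:
  assumes Y: "solves Q z Y Y1" and x: "x \<ge> 0"
  shows "Y1 x = ivp_deriv (Y 0) (Y1 0) z x"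
proof -
  have "has_ac_deriv Y1 (\<lambda>x. Q x ** Y x - z *\<^sub>C Y x)"
    using Y by (simp add: solves_def)
  then have "Y1 x = Y1 0 + integral {0..x} (\<lambda>x. Q x ** Y x - z *\<^sub>C Y x)"
    using has_ac_derivD(3) x by blast
  also have "integral {0..x} (\<lambda>x. Q x ** Y x - z *\<^sub>C Y x) =
      integral {0..x} (\<lambda>t. coeff z t ** ivp_solution (Y 0) (Y1 0) z t)"
  proof (rule hk_integral_cong)
    fix t assume "t \<in> {0..x}"
    then have "Y t = ivp_solution (Y 0) (Y1 0) z t"
      by (intro solves_imp_ivp_solution[OF Y]) simp
    then show "Q t ** Y t - z *\<^sub>C Y t = coeff z t ** ivp_solution (Y 0) (Y1 0) z t"
      by (simp add: cmatrix_simps)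
  qed
  finally show ?thesis by (simp add: ivp_deriv_def)
qed

lemma solves_decomposition:
  assumes Y: "solves Q z Y Y1" and init: "Y 0 = mat 1" "Y1 0 = H + N" and x: "x \<ge> 0"
  shows "Y x = ivp_solution (mat 1) H z x + ivp_solution 0 (mat 1) z x ** N"
    and "Y1 x = ivp_deriv (mat 1) H z x + ivp_deriv 0 (mat 1) z x ** N"
proof -
  note CS = solves_add[OF ivp_solution_solves[of z "mat 1" H]
      solves_mult_right[OF ivp_solution_solves[of z 0 "mat 1"], of N]]
  show "Y x = ivp_solution (mat 1) H z x + ivp_solution 0 (mat 1) z x ** N"
    using solves_imp_ivp_solution[OF Y x] solves_imp_ivp_solution[OF CS x] init by simp
  show "Y1 x = ivp_deriv (mat 1) H z x + ivp_deriv 0 (mat 1) z x ** N"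
    using solves_imp_ivp_deriv[OF Y x] solves_imp_ivp_deriv[OF CS x] init by simp
qed

lemma eventually_jost_invertible: "\<forall>\<^sub>F \<rho> in at_upper. invertible (jost_solution Q \<rho> 0)"
  and jost_inverse_limit: "((\<lambda>\<rho>. matrix_inv (jost_solution Q \<rho> 0)) \<longlongrightarrow> mat 1) at_upper"
  using tendsto_identity_invertible[OF jost_solution_limit[of 0]] by simp_all

end

lemma tendsto_zero_bounded_cscale:
  fixes f :: "'a \<Rightarrow> complex^'n^'n"
  assumes c: "\<forall>\<^sub>F x in F. norm (c x) \<le> 1" and f: "(f \<longlongrightarrow> 0) F"
  shows "((\<lambda>x. c x *\<^sub>C f x) \<longlongrightarrow> 0) F"
proof (rule Lim_null_comparison)
  show "\<forall>\<^sub>F x in F. norm (c x *\<^sub>C f x) \<le> norm (f x)"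
    using c by (rule eventually_mono) (simp add: mult_left_le_one_le)
  show "((\<lambda>x. norm (f x)) \<longlongrightarrow> 0) F" by (rule tendsto_norm_zero[OF f])
qed

lemma matrix_mult_holomorphic:
  fixes X Y :: "complex \<Rightarrow> complex^'n^'n"
  assumes "\<And>i j. (\<lambda>z. X z $ i $ j) holomorphic_on S" "\<And>i j. (\<lambda>z. Y z $ i $ j) holomorphic_on S"
  shows "(\<lambda>z. (X z ** Y z) $ i $ j) holomorphic_on S"
  unfolding matrix_matrix_mult_def by simp (intro holomorphic_intros assms)

lemma entire_matrix_eq_limit:
  fixes X :: "complex \<Rightarrow> complex^'n^'n"
  assumes "\<And>i j. (\<lambda>z. X z $ i $ j) holomorphic_on UNIV"
    and "((\<lambda>\<rho>. X (\<rho>\<^sup>2)) \<longlongrightarrow> L) at_upper"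
  shows "X z = L"
  using entire_eq_limit[OF assms(1)] assms(2) by (simp add: vec_eq_iff tendsto_matrix_iff)

lemma matrix_mult_right_cancel:
  fixes A B X :: "complex^'n^'n"
  assumes "A ** X = B ** X" "invertible X"
  shows "A = B"
  by (metis assms matrix_inv_mult(1) matrix_mul_assoc matrix_mul_rid)

text \<open>
  Names with a prime belong to the second problem, and the suffix \<open>1\<close> marks \<open>d/dx\<close>. The solutions \<open>\<psi>\<close>,
  \<open>\<psi>'\<close> and \<open>\<phi>\<close> are the decaying ones with value \<open>I\<close> at \<open>0\<close>, where \<open>\<phi>\<close> belongs to the adjoint of the second
  equation, just as \<open>T\<close> and \<open>D\<close> do. The pair \<open>P\<close>, \<open>R\<close> is the first block row of the matrix that takes the
  fundamental system of the second equation to that of the first one.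
\<close>

locale two_potentials =
  q: potential Q + q': potential Q' for Q Q' :: "real \<Rightarrow> complex^'n^'n" +
  fixes h h' :: "complex^'n^'n"
  assumes same_log_deriv: "\<forall>\<^sub>F \<rho> in at_upper.
    jost_deriv Q \<rho> 0 ** matrix_inv (jost_solution Q \<rho> 0) - h =
    jost_deriv Q' \<rho> 0 ** matrix_inv (jost_solution Q' \<rho> 0) - h'"
begin

sublocale r: potential "\<lambda>x. transpose (Q' x)"
  by (rule q'.transpose_potential)

definition N where "N \<rho> = jost_deriv Q \<rho> 0 ** matrix_inv (jost_solution Q \<rho> 0) - h"

definition \<psi> where "\<psi> \<rho> x = jost_solution Q \<rho> x ** matrix_inv (jost_solution Q \<rho> 0)"
definition \<psi>1 where "\<psi>1 \<rho> x = jost_deriv Q \<rho> x ** matrix_inv (jost_solution Q \<rho> 0)"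
definition \<psi>' where "\<psi>' \<rho> x = jost_solution Q' \<rho> x ** matrix_inv (jost_solution Q' \<rho> 0)"
definition \<psi>1' where "\<psi>1' \<rho> x = jost_deriv Q' \<rho> x ** matrix_inv (jost_solution Q' \<rho> 0)"
definition \<phi> where "\<phi> \<rho> x = transpose (jost_solution (\<lambda>x. transpose (Q' x)) \<rho> x **
  matrix_inv (jost_solution (\<lambda>x. transpose (Q' x)) \<rho> 0))"
definition \<phi>1 where "\<phi>1 \<rho> x = transpose (jost_deriv (\<lambda>x. transpose (Q' x)) \<rho> x **
  matrix_inv (jost_solution (\<lambda>x. transpose (Q' x)) \<rho> 0))"

abbreviation "S \<equiv> q.ivp_solution 0 (mat 1)"
abbreviation "C \<equiv> q.ivp_solution (mat 1) h"
definition T where "T z x = transpose (r.ivp_solution 0 (mat 1) z x)"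
definition T1 where "T1 z x = transpose (r.ivp_deriv 0 (mat 1) z x)"
definition D where "D z x = transpose (r.ivp_solution (mat 1) (transpose h') z x)"
definition D1 where "D1 z x = transpose (r.ivp_deriv (mat 1) (transpose h') z x)"

definition P where "P z x = C z x ** T1 z x - S z x ** D1 z x"
definition R where "R z x = S z x ** D z x - C z x ** T z x"

definition good :: "complex \<Rightarrow> bool" where
  "good \<rho> \<longleftrightarrow> Im \<rho> > 0 \<and> 2 * q.mass \<le> norm \<rho> \<and> 2 * q'.mass \<le> norm \<rho> \<and> 2 * r.mass \<le> norm \<rho> \<and>
    invertible (jost_solution Q \<rho> 0) \<and> invertible (jost_solution Q' \<rho> 0) \<and>
    invertible (jost_solution (\<lambda>x. transpose (Q' x)) \<rho> 0) \<and>
    N \<rho> = jost_deriv Q' \<rho> 0 ** matrix_inv (jost_solution Q' \<rho> 0) - h'"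

lemma eventually_good: "\<forall>\<^sub>F \<rho> in at_upper. good \<rho>"
  unfolding good_def N_def
  by (intro eventually_conj q.eventually_jost_invertible q'.eventually_jost_invertible
      r.eventually_jost_invertible same_log_deriv
      eventually_mono[OF eventually_large[of 0]] eventually_mono[OF eventually_large[of "2 * q.mass"]]
      eventually_mono[OF eventually_large[of "2 * q'.mass"]] eventually_mono[OF eventually_large[of "2 * r.mass"]])
    auto

lemma \<psi>_solution:
  assumes "good \<rho>"
  shows "solves Q (\<rho>\<^sup>2) (\<psi> \<rho>) (\<psi>1 \<rho>)" "\<psi> \<rho> 0 = mat 1" "\<psi>1 \<rho> 0 = h + N \<rho>"
proof -
  show "solves Q (\<rho>\<^sup>2) (\<psi> \<rho>) (\<psi>1 \<rho>)"
    using solves_mult_right[OF q.jost_solution_asymptotics(1)] assms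
    by (simp add: \<psi>_def[abs_def] \<psi>1_def[abs_def] good_def)
  show "\<psi> \<rho> 0 = mat 1"
    using assms by (simp add: \<psi>_def good_def matrix_inv_mult)
  show "\<psi>1 \<rho> 0 = h + N \<rho>"
    by (simp add: \<psi>1_def N_def)
qed

lemma \<psi>'_solution:
  assumes "good \<rho>"
  shows "solves Q' (\<rho>\<^sup>2) (\<psi>' \<rho>) (\<psi>1' \<rho>)" "\<psi>' \<rho> 0 = mat 1" "\<psi>1' \<rho> 0 = h' + N \<rho>"
proof -
  show "solves Q' (\<rho>\<^sup>2) (\<psi>' \<rho>) (\<psi>1' \<rho>)"
    using solves_mult_right[OF q'.jost_solution_asymptotics(1)] assms
    by (simp add: \<psi>'_def[abs_def] \<psi>1'_def[abs_def] good_def)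
qed (use assms in \<open>auto simp: \<psi>'_def \<psi>1'_def good_def matrix_inv_mult\<close>)

text \<open>The vanishing Wronskian turns the initial data of the adjoint solution into those of \<open>\<psi>'\<close>.\<close>

lemma \<phi>_solution:
  assumes g: "good \<rho>"
  shows "solves_left Q' (\<rho>\<^sup>2) (\<phi> \<rho>) (\<phi>1 \<rho>)" "\<phi> \<rho> 0 = mat 1" "\<phi>1 \<rho> 0 = h' + N \<rho>"
    and "x \<ge> 0 \<Longrightarrow> \<phi> \<rho> x = D (\<rho>\<^sup>2) x + N \<rho> ** T (\<rho>\<^sup>2) x"
    and "x \<ge> 0 \<Longrightarrow> \<phi>1 \<rho> x = D1 (\<rho>\<^sup>2) x + N \<rho> ** T1 (\<rho>\<^sup>2) x"
proof -
  let ?f = "jost_solution (\<lambda>x. transpose (Q' x)) \<rho>" and ?f1 = "jost_deriv (\<lambda>x. transpose (Q' x)) \<rho>"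
  let ?e = "jost_solution Q' \<rho>" and ?e1 = "jost_deriv Q' \<rho>"
  note sol = solves_mult_right[OF r.jost_solution_asymptotics(1), of \<rho> "matrix_inv (?f 0)"]
  show "solves_left Q' (\<rho>\<^sup>2) (\<phi> \<rho>) (\<phi>1 \<rho>)"
    unfolding \<phi>_def[abs_def] \<phi>1_def[abs_def]
    by (rule solves_left_transpose[OF sol]) (use g in \<open>auto simp: good_def\<close>)
  show \<phi>0: "\<phi> \<rho> 0 = mat 1"
    using g by (simp add: \<phi>_def good_def matrix_inv_mult)
  have w: "transpose (?f 0) ** ?e1 0 = transpose (?f1 0) ** ?e 0"
    by (rule jost_wronskian) (use g q'.potential_axioms in \<open>auto simp: good_def\<close>)
  define F where "F = transpose (matrix_inv (?f 0))"
  have F: "F ** transpose (?f 0) = mat 1"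
    unfolding F_def matrix_transpose_mul[symmetric] using g by (simp add: good_def matrix_inv_mult)
  have "F ** transpose (?f1 0) ** ?e 0 = ?e1 0"
    using arg_cong[OF w, of "\<lambda>X. F ** X"] F by (simp add: matrix_mul_assoc)
  then have "F ** transpose (?f1 0) ** ?e 0 ** matrix_inv (?e 0) = ?e1 0 ** matrix_inv (?e 0)"
    by simp
  then have "F ** transpose (?f1 0) = ?e1 0 ** matrix_inv (?e 0)"
    using g by (simp add: matrix_mul_assoc[symmetric] matrix_inv_mult good_def)
  also have "\<dots> = h' + N \<rho>" using g by (simp add: good_def)
  finally have \<phi>1: "transpose (?f1 0 ** matrix_inv (?f 0)) = h' + N \<rho>"
    by (simp add: F_def matrix_transpose_mul)
  then show "\<phi>1 \<rho> 0 = h' + N \<rho>" by (simp add: \<phi>1_def)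
  have init: "?f 0 ** matrix_inv (?f 0) = mat 1" "?f1 0 ** matrix_inv (?f 0) = transpose h' + transpose (N \<rho>)"
    using g arg_cong[OF \<phi>1, of transpose] by (simp_all add: good_def matrix_inv_mult transpose_simps)
  assume x: "x \<ge> 0"
  note dec = r.solves_decomposition[OF sol init x]
  show "\<phi> \<rho> x = D (\<rho>\<^sup>2) x + N \<rho> ** T (\<rho>\<^sup>2) x"
    unfolding \<phi>_def by (subst dec(1)) (use g in \<open>auto simp: good_def transpose_simps matrix_transpose_mul D_def T_def\<close>)
  show "\<phi>1 \<rho> x = D1 (\<rho>\<^sup>2) x + N \<rho> ** T1 (\<rho>\<^sup>2) x"
    unfolding \<phi>1_def by (subst dec(2)) (use g in \<open>auto simp: good_def transpose_simps matrix_transpose_mul D1_def T1_def\<close>)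
qed

text \<open>Inserting \<open>\<psi> = C + S N\<close> and \<open>\<phi> = D + N T\<close>, the terms with \<open>N\<close> cancel.\<close>

lemma transition_good:
  assumes g: "good \<rho>" and x: "x \<ge> 0"
  shows "P (\<rho>\<^sup>2) x = \<psi> \<rho> x ** T1 (\<rho>\<^sup>2) x - S (\<rho>\<^sup>2) x ** \<phi>1 \<rho> x"
    and "R (\<rho>\<^sup>2) x = S (\<rho>\<^sup>2) x ** \<phi> \<rho> x - \<psi> \<rho> x ** T (\<rho>\<^sup>2) x"
  using q.solves_decomposition(1)[OF \<psi>_solution[OF g] x] \<phi>_solution(4,5)[OF g x]
  by (simp_all add: P_def R_def cmatrix_simps)

lemma transition_entire:
  assumes x: "x \<ge> 0"
  shows "(\<lambda>z. P z x $ i $ j) holomorphic_on UNIV" "(\<lambda>z. R z x $ i $ j) holomorphic_on UNIV"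
proof -
  have "(\<lambda>z. T z x $ i $ j) holomorphic_on UNIV" "(\<lambda>z. T1 z x $ i $ j) holomorphic_on UNIV"
    "(\<lambda>z. D z x $ i $ j) holomorphic_on UNIV" "(\<lambda>z. D1 z x $ i $ j) holomorphic_on UNIV" for i j
    unfolding T_def T1_def D_def D1_def transpose_component by (rule r.ivp_solution_entire[OF x])+
  then show "(\<lambda>z. P z x $ i $ j) holomorphic_on UNIV" "(\<lambda>z. R z x $ i $ j) holomorphic_on UNIV"
    unfolding P_def R_def vector_minus_component
    by (intro holomorphic_on_diff matrix_mult_holomorphic q.ivp_solution_entire[OF x]; simp)+
qed

lemma wave_factor_bounds:
  assumes "x \<ge> 0"
  shows "\<forall>\<^sub>F \<rho> in at_upper. norm ((ew2 \<rho> x + 1) / 2) \<le> 1"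
    and "\<forall>\<^sub>F \<rho> in at_upper. norm ((ew2 \<rho> x - 1) / 2) \<le> 1"
proof -
  have "norm ((ew2 \<rho> x + 1) / 2) \<le> 1 \<and> norm ((ew2 \<rho> x - 1) / 2) \<le> 1"
    if "Im \<rho> > 0 \<and> 0 \<le> norm \<rho>" for \<rho>
  proof -
    have "norm (ew2 \<rho> x) \<le> 1"
      using q.jost_kernel_bound[of \<rho> 0 x] that assms by simp
    moreover have "norm ((X + 1) / 2) \<le> 1 \<and> norm ((X - 1) / 2) \<le> 1" if "norm X \<le> 1" for X :: complex
      using norm_triangle_ineq[of X 1] norm_triangle_ineq4[of X 1] that by (simp add: norm_divide)
    ultimately show ?thesis by blast
  qed
  then show "\<forall>\<^sub>F \<rho> in at_upper. norm ((ew2 \<rho> x + 1) / 2) \<le> 1"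
    and "\<forall>\<^sub>F \<rho> in at_upper. norm ((ew2 \<rho> x - 1) / 2) \<le> 1"
    using eventually_mono[OF eventually_large[of 0]] by auto
qed

text \<open>
  The factors are rescaled by \<open>ew\<close>, \<open>ew_inv\<close> and \<open>i\<rho>\<close> so that each of them stays bounded. Their leading parts
  are \<open>I\<close> for the decaying solutions and, for the others, \<open>c = ew cos (\<rho>x)\<close> and \<open>s = i ew sin (\<rho>x)\<close>, which
  have no limit near the real axis. In the limit of \<open>P\<close> they occur only as \<open>c - s = 1\<close>, and in \<open>R\<close> they
  cancel.
\<close>

lemma transition_limits:
  assumes x: "x \<ge> 0"
  shows "((\<lambda>\<rho>. P (\<rho>\<^sup>2) x) \<longlongrightarrow> mat 1) at_upper"
    and "((\<lambda>\<rho>. R (\<rho>\<^sup>2) x) \<longlongrightarrow> 0) at_upper"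
proof -
  define c where "c \<rho> = (ew2 \<rho> x + 1) / 2" for \<rho> :: complex
  define s where "s \<rho> = (ew2 \<rho> x - 1) / 2" for \<rho> :: complex
  define E where "E \<rho> = ew \<rho> x" for \<rho> :: complex
  have E: "ew_inv \<rho> x = inverse (E \<rho>)" "E \<rho> \<noteq> 0" for \<rho>
    by (simp_all add: E_def exp_minus)
  define u where "u \<rho> = inverse (E \<rho>) *\<^sub>C \<psi> \<rho> x" for \<rho>
  define v where "v \<rho> = (inverse (E \<rho>) / (\<i> * \<rho>)) *\<^sub>C \<phi>1 \<rho> x" for \<rho>
  define w where "w \<rho> = inverse (E \<rho>) *\<^sub>C \<phi> \<rho> x" for \<rho>
  define s2 where "s2 \<rho> = (\<i> * \<rho> * E \<rho>) *\<^sub>C S (\<rho>\<^sup>2) x - s \<rho> *\<^sub>C mat 1" for \<rho>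
  define t1 where "t1 \<rho> = E \<rho> *\<^sub>C T1 (\<rho>\<^sup>2) x - c \<rho> *\<^sub>C mat 1" for \<rho>
  define t2 where "t2 \<rho> = (\<i> * \<rho> * E \<rho>) *\<^sub>C T (\<rho>\<^sup>2) x - s \<rho> *\<^sub>C mat 1" for \<rho>
  note tr = bounded_linear.tendsto[OF bounded_linear_transpose]
  have u: "(u \<longlongrightarrow> mat 1) at_upper"
    using tendsto_matrix_mult[OF q.jost_solution_limit[OF x] q.jost_inverse_limit]
    unfolding u_def[abs_def] \<psi>_def E(1) by simp
  have v: "(v \<longlongrightarrow> mat 1) at_upper"
    using tr[OF tendsto_matrix_mult[OF r.jost_deriv_limit[OF x] r.jost_inverse_limit]]
    unfolding v_def[abs_def] \<phi>1_def E(1) by (simp add: transpose_simps)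
  have w: "(w \<longlongrightarrow> mat 1) at_upper"
    using tr[OF tendsto_matrix_mult[OF r.jost_solution_limit[OF x] r.jost_inverse_limit]]
    unfolding w_def[abs_def] \<phi>_def E(1) by (simp add: transpose_simps)
  have s2: "(s2 \<longlongrightarrow> 0) at_upper"
    using q.dirichlet_solution_limit[OF x] by (simp add: s2_def[abs_def] s_def E_def)
  have t1: "(t1 \<longlongrightarrow> 0) at_upper"
    using tr[OF r.dirichlet_deriv_limit[OF x]] by (simp add: t1_def[abs_def] c_def E_def T1_def transpose_simps)
  have t2: "(t2 \<longlongrightarrow> 0) at_upper"
    using tr[OF r.dirichlet_solution_limit[OF x]] by (simp add: t2_def[abs_def] s_def E_def T_def transpose_simps)
  have c: "\<forall>\<^sub>F \<rho> in at_upper. norm (c \<rho>) \<le> 1" and s: "\<forall>\<^sub>F \<rho> in at_upper. norm (s \<rho>) \<le> 1"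
    unfolding c_def s_def by (rule wave_factor_bounds[OF x])+
  have cs: "c \<rho> *\<^sub>C mat 1 - s \<rho> *\<^sub>C mat 1 = (mat 1 :: complex^'n^'n)" for \<rho>
    by (simp add: c_def s_def cscale_distribs(4)[symmetric] field_simps)
  have nz: "\<rho> \<noteq> 0" if "good \<rho>" for \<rho> using that by (auto simp: good_def)
  have P_eq: "P (\<rho>\<^sup>2) x - mat 1 = c \<rho> *\<^sub>C (u \<rho> - mat 1) + u \<rho> ** t1 \<rho> - s \<rho> *\<^sub>C (v \<rho> - mat 1) - s2 \<rho> ** v \<rho>"
    if g: "good \<rho>" for \<rho>
  proof -
    have "P (\<rho>\<^sup>2) x = u \<rho> ** (E \<rho> *\<^sub>C T1 (\<rho>\<^sup>2) x) - ((\<i> * \<rho> * E \<rho>) *\<^sub>C S (\<rho>\<^sup>2) x) ** v \<rho>"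
      unfolding transition_good(1)[OF g x] u_def v_def using E(2)[of \<rho>] nz[OF g] by simp
    also have "\<dots> = u \<rho> ** (t1 \<rho> + c \<rho> *\<^sub>C mat 1) - (s2 \<rho> + s \<rho> *\<^sub>C mat 1) ** v \<rho>"
      by (simp add: t1_def s2_def)
    finally have "P (\<rho>\<^sup>2) x = u \<rho> ** (t1 \<rho> + c \<rho> *\<^sub>C mat 1) - (s2 \<rho> + s \<rho> *\<^sub>C mat 1) ** v \<rho>" .
    then show ?thesis
      by (subst cs[symmetric, of \<rho>]) (simp add: cmatrix_simps algebra_simps)
  qed
  have "((\<lambda>\<rho>. c \<rho> *\<^sub>C (u \<rho> - mat 1) + u \<rho> ** t1 \<rho> - s \<rho> *\<^sub>C (v \<rho> - mat 1) - s2 \<rho> ** v \<rho>) \<longlongrightarrow>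
      0 + mat 1 ** 0 - 0 - 0 ** mat 1) at_upper"
    using LIM_zero[OF u] LIM_zero[OF v]
    by (intro tendsto_intros tendsto_zero_bounded_cscale c s u v s2 t1)
  then have "((\<lambda>\<rho>. P (\<rho>\<^sup>2) x - mat 1) \<longlongrightarrow> 0 + mat 1 ** 0 - 0 - 0 ** mat 1) at_upper"
    by (rule Lim_transform_eventually[OF _ eventually_mono[OF eventually_good P_eq[symmetric]]])
  then have "((\<lambda>\<rho>. P (\<rho>\<^sup>2) x - mat 1) \<longlongrightarrow> 0) at_upper"
    by simp
  then show "((\<lambda>\<rho>. P (\<rho>\<^sup>2) x) \<longlongrightarrow> mat 1) at_upper"
    by (rule LIM_zero_cancel)
  have R_eq: "R (\<rho>\<^sup>2) x = (1 / (\<i> * \<rho>)) *\<^sub>C (s \<rho> *\<^sub>C (w \<rho> - u \<rho>) + s2 \<rho> ** w \<rho> - u \<rho> ** t2 \<rho>)"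
    if g: "good \<rho>" for \<rho>
  proof -
    have "R (\<rho>\<^sup>2) x = (1 / (\<i> * \<rho>)) *\<^sub>C (((\<i> * \<rho> * E \<rho>) *\<^sub>C S (\<rho>\<^sup>2) x) ** w \<rho> - u \<rho> ** ((\<i> * \<rho> * E \<rho>) *\<^sub>C T (\<rho>\<^sup>2) x))"
      unfolding transition_good(2)[OF g x] u_def w_def using E(2)[of \<rho>] nz[OF g]
      by (simp add: cscale_distribs)
    also have "\<dots> = (1 / (\<i> * \<rho>)) *\<^sub>C ((s2 \<rho> + s \<rho> *\<^sub>C mat 1) ** w \<rho> - u \<rho> ** (t2 \<rho> + s \<rho> *\<^sub>C mat 1))"
      by (simp add: t2_def s2_def)
    finally show ?thesis
      by (simp add: cmatrix_simps algebra_simps)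
  qed
  have small: "\<forall>\<^sub>F \<rho> in at_upper. norm (1 / (\<i> * \<rho>)) \<le> 1"
    using eventually_large[of 1] by (rule eventually_mono) (auto simp: norm_divide norm_mult divide_le_eq_1)
  have wu: "((\<lambda>\<rho>. w \<rho> - u \<rho>) \<longlongrightarrow> 0) at_upper"
    using tendsto_diff[OF w u] by simp
  have "((\<lambda>\<rho>. s \<rho> *\<^sub>C (w \<rho> - u \<rho>) + s2 \<rho> ** w \<rho> - u \<rho> ** t2 \<rho>) \<longlongrightarrow> 0 + 0 ** mat 1 - mat 1 ** 0) at_upper"
    by (intro tendsto_intros tendsto_zero_bounded_cscale s wu s2 w u t2)
  then have "((\<lambda>\<rho>. (1 / (\<i> * \<rho>)) *\<^sub>C (s \<rho> *\<^sub>C (w \<rho> - u \<rho>) + s2 \<rho> ** w \<rho> - u \<rho> ** t2 \<rho>)) \<longlongrightarrow> 0) at_upper"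
    by (intro tendsto_zero_bounded_cscale small) simp
  then show "((\<lambda>\<rho>. R (\<rho>\<^sup>2) x) \<longlongrightarrow> 0) at_upper"
    by (rule Lim_transform_eventually[OF _ eventually_mono[OF eventually_good R_eq[symmetric]]])
qed

lemma transition_trivial: "x \<ge> 0 \<Longrightarrow> P z x = mat 1" "x \<ge> 0 \<Longrightarrow> R z x = 0"
  by (rule entire_matrix_eq_limit[OF transition_entire(1) transition_limits(1)], assumption+)
    (rule entire_matrix_eq_limit[OF transition_entire(2) transition_limits(2)], assumption+)

text \<open>
  The Wronskians of \<open>T\<close> and \<open>\<phi>\<close> with \<open>\<psi>'\<close> have the constant values that turn \<open>\<psi>\<close> into the combination
  \<open>P \<psi>' + R \<psi>1'\<close>.
\<close>

lemma solutions_agree: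
  assumes g: "good \<rho>" and x: "x \<ge> 0"
  shows "\<psi> \<rho> x = \<psi>' \<rho> x"
proof -
  have T: "solves_left Q' (\<rho>\<^sup>2) (T (\<rho>\<^sup>2)) (T1 (\<rho>\<^sup>2))"
    unfolding T_def[abs_def] T1_def[abs_def] by (rule solves_left_transpose[OF r.ivp_solution_solves])
  have "T (\<rho>\<^sup>2) x ** \<psi>1' \<rho> x - T1 (\<rho>\<^sup>2) x ** \<psi>' \<rho> x = - mat 1"
    using wronskian_constant[OF T \<psi>'_solution(1)[OF g] x] \<psi>'_solution(2)[OF g]
    by (simp add: T_def T1_def transpose_simps)
  then have W1: "T1 (\<rho>\<^sup>2) x ** \<psi>' \<rho> x - T (\<rho>\<^sup>2) x ** \<psi>1' \<rho> x = mat 1"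
    by (metis minus_diff_eq neg_equal_iff_equal)
  have W2: "\<phi> \<rho> x ** \<psi>1' \<rho> x - \<phi>1 \<rho> x ** \<psi>' \<rho> x = 0"
    using wronskian_constant[OF \<phi>_solution(1)[OF g] \<psi>'_solution(1)[OF g] x] \<psi>'_solution(2,3)[OF g]
      \<phi>_solution(2,3)[OF g] by simp
  have "\<psi> \<rho> x = \<psi> \<rho> x ** (T1 (\<rho>\<^sup>2) x ** \<psi>' \<rho> x - T (\<rho>\<^sup>2) x ** \<psi>1' \<rho> x) +
      S (\<rho>\<^sup>2) x ** (\<phi> \<rho> x ** \<psi>1' \<rho> x - \<phi>1 \<rho> x ** \<psi>' \<rho> x)"
    by (simp add: W1 W2)
  also have "\<dots> = P (\<rho>\<^sup>2) x ** \<psi>' \<rho> x + R (\<rho>\<^sup>2) x ** \<psi>1' \<rho> x"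
    unfolding transition_good[OF g x] by (simp add: cmatrix_simps algebra_simps)
  finally show ?thesis by (simp add: transition_trivial x)
qed

text \<open>
  A single \<open>\<rho>\<close> suffices: if \<open>\<psi> = \<psi>'\<close>, then both potentials give the same second derivative, so
  \<open>Q \<psi> = Q' \<psi>\<close> almost everywhere, and \<open>\<psi>\<close> is invertible at every \<open>x\<close> when \<open>\<bar>\<rho>\<bar>\<close> is large.
\<close>

theorem potentials_agree: "h = h' \<and> (AE x in lebesgue. x > 0 \<longrightarrow> Q x = Q' x)"
proof -
  \<comment> \<open>the last condition keeps \<open>ew_inv e\<close> within distance \<open>1/2\<close> of the identity for every \<open>x\<close>\<close>
  have "\<forall>\<^sub>F \<rho> in at_upper. good \<rho> \<and>
      (Im \<rho> > 0 \<and> 4 * norm (mat 1 :: complex^'n^'n) * q.mass \<le> norm \<rho>)"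
    by (intro eventually_conj[OF eventually_good eventually_large])
  then obtain \<rho> where g: "good \<rho>" and \<rho>: "Im \<rho> > 0" "4 * norm (mat 1 :: complex^'n^'n) * q.mass \<le> norm \<rho>"
    using at_upper_nontrivial eventually_happens by blast
  have \<rho>0: "\<rho> \<noteq> 0" using \<rho> by auto
  have d: "has_ac_deriv (\<psi> \<rho>) (\<psi>1 \<rho>)" "has_ac_deriv (\<psi>1 \<rho>) (\<lambda>x. Q x ** \<psi> \<rho> x - \<rho>\<^sup>2 *\<^sub>C \<psi> \<rho> x)"
    using \<psi>_solution(1)[OF g] by (auto simp: solves_def)
  have d': "has_ac_deriv (\<psi>' \<rho>) (\<psi>1' \<rho>)" "has_ac_deriv (\<psi>1' \<rho>) (\<lambda>x. Q' x ** \<psi>' \<rho> x - \<rho>\<^sup>2 *\<^sub>C \<psi>' \<rho> x)"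
    using \<psi>'_solution(1)[OF g] by (auto simp: solves_def)
  have d'': "has_ac_deriv (\<psi> \<rho>) (\<psi>1' \<rho>)"
    by (rule has_ac_deriv_cong[OF d'(1)]) (simp_all add: solutions_agree[OF g])
  have \<psi>1: "\<psi>1 \<rho> x = \<psi>1' \<rho> x" if "x \<ge> 0" for x
    using has_ac_deriv_vector_derivative[OF d(1) has_ac_deriv_continuous_on_atLeast[OF d(2)] that]
      has_ac_deriv_vector_derivative[OF d'' has_ac_deriv_continuous_on_atLeast[OF d'(2)] that] by simp
  have h: "h = h'"
    using \<psi>1[of 0] \<psi>_solution(3)[OF g] \<psi>'_solution(3)[OF g] by simp
  have "has_ac_deriv (\<psi>1 \<rho>) (\<lambda>x. Q' x ** \<psi> \<rho> x - \<rho>\<^sup>2 *\<^sub>C \<psi> \<rho> x)"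
    by (rule has_ac_deriv_cong[OF d'(2)]) (simp_all add: solutions_agree[OF g] \<psi>1)
  from has_ac_deriv_unique[OF d(2) this]
  have "AE x in lebesgue. x > 0 \<longrightarrow> Q x = Q' x"
  proof (rule AE_mp, intro AE_I2 impI)
    fix x :: real
    assume eq: "x > 0 \<longrightarrow> Q x ** \<psi> \<rho> x - \<rho>\<^sup>2 *\<^sub>C \<psi> \<rho> x = Q' x ** \<psi> \<rho> x - \<rho>\<^sup>2 *\<^sub>C \<psi> \<rho> x" and x: "x > 0"
    let ?c = "ew_inv \<rho> x" and ?e = "jost_solution Q \<rho> x"
    have "norm (?c *\<^sub>C ?e - mat 1) \<le> 2 * norm (mat 1 :: complex^'n^'n) * q.mass / norm \<rho>"
      by (rule q.jost_solution_asymptotics(2)) (use g x in \<open>auto simp: good_def\<close>)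
    also have "\<dots> \<le> 1 / 2" using \<rho>(2) \<rho>0 by (simp add: divide_simps)
    finally have inv: "invertible (?c *\<^sub>C ?e)" by (rule near_identity_invertible)
    have "Q x ** ?e ** matrix_inv (jost_solution Q \<rho> 0) = Q' x ** ?e ** matrix_inv (jost_solution Q \<rho> 0)"
      using eq x by (simp add: \<psi>_def matrix_mul_assoc)
    then have "Q x ** ?e ** (matrix_inv (jost_solution Q \<rho> 0) ** jost_solution Q \<rho> 0) =
        Q' x ** ?e ** (matrix_inv (jost_solution Q \<rho> 0) ** jost_solution Q \<rho> 0)"
      by (simp add: matrix_mul_assoc)
    then have "Q x ** ?e = Q' x ** ?e"
      using g by (simp add: good_def matrix_inv_mult)
    then have "Q x ** (?c *\<^sub>C ?e) = Q' x ** (?c *\<^sub>C ?e)" by simp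
    then show "Q x = Q' x" using inv by (rule matrix_mult_right_cancel)
  qed
  with h show ?thesis by simp
qed

end

section \<open>The Weyl matrix\<close>

lemma bvp_data_potential:
  fixes Q :: "real \<Rightarrow> complex^'n^'n"
  assumes "bvp_data Q A h"
  shows "potential Q"
proof
  define B :: "'n \<Rightarrow> 'n \<Rightarrow> complex^'n^'n" where "B i j = (\<chi> k l. if k = i \<and> l = j then 1 else 0)" for i j
  have "(\<lambda>x. \<Sum>i\<in>UNIV. \<Sum>j\<in>UNIV. Q x $ i $ j *\<^sub>C B i j) absolutely_integrable_on {0<..}"
  proof (intro absolutely_integrable_sum finite_class.finite_UNIV)
    fix i j
    have "(\<lambda>x. Q x $ i $ j) absolutely_integrable_on {0<..}"
      using assms by (simp add: bvp_data_def)
    then show "(\<lambda>x. Q x $ i $ j *\<^sub>C B i j) absolutely_integrable_on {0<..}"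
      by (rule absolutely_integrable_map[OF _ bounded_bilinear.bounded_linear_left[OF bounded_bilinear_cscale]])
  qed
  moreover have "(\<Sum>i\<in>UNIV. \<Sum>j\<in>UNIV. Q x $ i $ j *\<^sub>C B i j) = Q x" for x
  proof -
    have "(\<Sum>i\<in>UNIV. \<Sum>j\<in>UNIV. Q x $ i $ j *\<^sub>C B i j) $ k $ l = Q x $ k $ l" for k l
    proof -
      have "(\<Sum>i\<in>UNIV. \<Sum>j\<in>UNIV. Q x $ i $ j *\<^sub>C B i j) $ k $ l =
          (\<Sum>i\<in>UNIV. \<Sum>j\<in>UNIV. if l = j then if k = i then Q x $ i $ j else 0 else 0)"
        unfolding sum_component cscale_component by (intro sum.cong refl) (simp add: B_def)
      then show ?thesis by simp
    qed
    then show ?thesis by (simp add: vec_eq_iff)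
  qed
  ultimately show "Q absolutely_integrable_on {0..}"
    by (simp add: absolutely_integrable_on_Ioi_iff)
qed

lemma upper_sqrt_square:
  assumes "Im \<rho> > 0"
  shows "upper_sqrt (\<rho>\<^sup>2) = \<rho>" "\<not> (\<rho>\<^sup>2 \<in> \<real> \<and> 0 \<le> Re (\<rho>\<^sup>2))"
proof -
  show "upper_sqrt (\<rho>\<^sup>2) = \<rho>"
    unfolding upper_sqrt_def by (rule the_equality) (use assms in \<open>auto simp: power2_eq_iff\<close>)
  show "\<not> (\<rho>\<^sup>2 \<in> \<real> \<and> 0 \<le> Re (\<rho>\<^sup>2))"
  proof
    assume r: "\<rho>\<^sup>2 \<in> \<real> \<and> 0 \<le> Re (\<rho>\<^sup>2)"
    then have "Im (\<rho>\<^sup>2) = 0" by (simp add: complex_is_Real_iff)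
    then have "Re \<rho> = 0" using assms by (simp add: power2_eq_square)
    then show False using r assms by (simp add: power2_eq_square mult_le_0_iff)
  qed
qed

lemma jost_matrix_eq:
  "jost_matrix Q A h \<rho> = A ** (jost_deriv Q \<rho> 0 - h ** jost_solution Q \<rho> 0)
    - compl_projection A ** jost_solution Q \<rho> 0"
  by (simp add: jost_matrix_def boundary_form_def deriv_at_0_jost_solution)

lemma compl_projection_simps:
  assumes "A ** A = A"
  shows "A ** compl_projection A = 0" "compl_projection A ** A = 0"
    "compl_projection A ** compl_projection A = compl_projection A"
  using assms by (simp_all add: compl_projection_def cmatrix_simps)

lemma (in potential) weyl_matrix_eq:
  assumes "Im \<rho> > 0" "2 * mass \<le> norm \<rho>"
  shows "weyl_matrix Q A h (\<rho>\<^sup>2) =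
    (A ** jost_solution Q \<rho> 0 + compl_projection A ** jost_deriv Q \<rho> 0) ** matrix_inv (jost_matrix Q A h \<rho>)"
proof -
  define B where "B = matrix_inv (jost_matrix Q A h \<rho>)"
  have s: "solves Q (\<rho>\<^sup>2) (\<lambda>x. jost_solution Q \<rho> x ** B) (\<lambda>x. jost_deriv Q \<rho> x ** B)"
    by (rule solves_mult_right[OF jost_solution_asymptotics(1)[OF assms]])
  have W: "weyl_solution Q A h (\<rho>\<^sup>2) = (\<lambda>x. jost_solution Q \<rho> x ** B)"
    by (rule ext) (simp add: weyl_solution_def upper_sqrt_square[OF assms(1)] B_def)
  have "deriv_at_0 (weyl_solution Q A h (\<rho>\<^sup>2)) = jost_deriv Q \<rho> 0 ** B"
    unfolding W deriv_at_0_def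
    using s has_ac_deriv_vector_derivative[of "\<lambda>x. jost_solution Q \<rho> x ** B" "\<lambda>x. jost_deriv Q \<rho> x ** B" 0]
      has_ac_deriv_continuous_on_atLeast[of "\<lambda>x. jost_deriv Q \<rho> x ** B"]
    unfolding solves_def by blast
  then show ?thesis
    by (simp add: weyl_matrix_def W B_def cmatrix_simps)
qed

text \<open>
  The Jost matrix has leading part \<open>i\<rho>A - B\<close> with \<open>B = I - A\<close>, whose inverse is \<open>A / (i\<rho>) - B\<close>.
  Multiplication by this inverse gives a matrix that tends to the identity.
\<close>

lemma (in potential) jost_matrix_limit:
  assumes A: "A ** A = A"
  shows "\<forall>\<^sub>F \<rho> in at_upper. invertible (jost_matrix Q A h \<rho>)"
    and "((\<lambda>\<rho>. matrix_inv (jost_matrix Q A h \<rho>)) \<longlongrightarrow> - compl_projection A) at_upper"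
proof -
  define B where "B \<rho> = (1 / (\<i> * \<rho>)) *\<^sub>C A - compl_projection A" for \<rho>
  define X where "X \<rho> = B \<rho> ** jost_matrix Q A h \<rho>" for \<rho>
  have inv0: "((\<lambda>\<rho>. 1 / (\<i> * \<rho>)) \<longlongrightarrow> 0) at_upper"
    by (rule tendsto_at_upper_bound[of 0 _ _ 1]) (simp add: norm_divide norm_mult)
  have e: "((\<lambda>\<rho>. jost_solution Q \<rho> 0) \<longlongrightarrow> mat 1) at_upper"
    using jost_solution_limit[of 0] by simp
  have e1: "((\<lambda>\<rho>. (1 / (\<i> * \<rho>)) *\<^sub>C jost_deriv Q \<rho> 0) \<longlongrightarrow> mat 1) at_upper"
    using jost_deriv_limit[of 0] by simp
  have B: "(B \<longlongrightarrow> - compl_projection A) at_upper"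
    unfolding B_def using tendsto_diff[OF tendsto_cscale[OF inv0 tendsto_const[of A]] tendsto_const[of "compl_projection A"]]
    by simp
  have X_eq: "X \<rho> = A ** ((1 / (\<i> * \<rho>)) *\<^sub>C jost_deriv Q \<rho> 0) - (1 / (\<i> * \<rho>)) *\<^sub>C (A ** h ** jost_solution Q \<rho> 0)
      + compl_projection A ** jost_solution Q \<rho> 0" for \<rho>
    using compl_projection_simps[OF A]
    by (simp add: X_def B_def jost_matrix_eq cmatrix_simps A)
  have "(X \<longlongrightarrow> A ** mat 1 - 0 *\<^sub>C (A ** h ** mat 1) + compl_projection A ** mat 1) at_upper"
    unfolding X_eq by (intro tendsto_intros e e1 inv0)
  then have X: "(X \<longlongrightarrow> mat 1) at_upper"
    by (simp add: compl_projection_def)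
  have Jinv: "invertible (jost_matrix Q A h \<rho>) \<and> matrix_inv (jost_matrix Q A h \<rho>) = matrix_inv (X \<rho>) ** B \<rho>"
    if "invertible (X \<rho>)" for \<rho>
  proof -
    have l: "(matrix_inv (X \<rho>) ** B \<rho>) ** jost_matrix Q A h \<rho> = mat 1"
      using matrix_inv_mult(2)[OF that] by (simp add: X_def matrix_mul_assoc)
    then have i: "invertible (jost_matrix Q A h \<rho>)"
      using invertible_left_inverse by blast
    then show ?thesis
      using l matrix_mult_right_cancel[OF _ i] matrix_inv_mult(2)[OF i] by metis
  qed
  show "\<forall>\<^sub>F \<rho> in at_upper. invertible (jost_matrix Q A h \<rho>)"
    using tendsto_identity_invertible(1)[OF X] by (rule eventually_mono) (use Jinv in blast)
  have "((\<lambda>\<rho>. matrix_inv (X \<rho>) ** B \<rho>) \<longlongrightarrow> mat 1 ** (- compl_projection A)) at_upper"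
    by (intro tendsto_intros tendsto_identity_invertible(2)[OF X] B)
  then have "((\<lambda>\<rho>. matrix_inv (jost_matrix Q A h \<rho>)) \<longlongrightarrow> mat 1 ** (- compl_projection A)) at_upper"
    by (rule Lim_transform_eventually)
      (rule eventually_mono[OF tendsto_identity_invertible(1)[OF X]], use Jinv in simp)
  then show "((\<lambda>\<rho>. matrix_inv (jost_matrix Q A h \<rho>)) \<longlongrightarrow> - compl_projection A) at_upper"
    by simp
qed

lemma (in potential) eventually_weyl_domain:
  assumes "A ** A = A"
  shows "\<forall>\<^sub>F \<rho> in at_upper. \<rho>\<^sup>2 \<in> weyl_domain Q A h"
  using eventually_conj[OF eventually_large[of 0] jost_matrix_limit(1)[OF assms, of h]]
  by (rule eventually_mono) (use upper_sqrt_square in \<open>auto simp: weyl_domain_def invertible_det_nz\<close>)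

text \<open>
  After division by \<open>i\<rho>\<close> only the derivative in the rows of \<open>I - A\<close> survives, and it meets the limit of
  the inverse Jost matrix.
\<close>

lemma (in potential) weyl_matrix_limit:
  assumes A: "A ** A = A"
  shows "((\<lambda>\<rho>. (1 / (\<i> * \<rho>)) *\<^sub>C weyl_matrix Q A h (\<rho>\<^sup>2)) \<longlongrightarrow> - compl_projection A) at_upper"
proof -
  have inv0: "((\<lambda>\<rho>. 1 / (\<i> * \<rho>)) \<longlongrightarrow> 0) at_upper"
    by (rule tendsto_at_upper_bound[of 0 _ _ 1]) (simp add: norm_divide norm_mult)
  have e: "((\<lambda>\<rho>. jost_solution Q \<rho> 0) \<longlongrightarrow> mat 1) at_upper"
    using jost_solution_limit[of 0] by simp
  have e1: "((\<lambda>\<rho>. (1 / (\<i> * \<rho>)) *\<^sub>C jost_deriv Q \<rho> 0) \<longlongrightarrow> mat 1) at_upper"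
    using jost_deriv_limit[of 0] by simp
  have "((\<lambda>\<rho>. ((1 / (\<i> * \<rho>)) *\<^sub>C (A ** jost_solution Q \<rho> 0) + compl_projection A ** ((1 / (\<i> * \<rho>)) *\<^sub>C jost_deriv Q \<rho> 0))
      ** matrix_inv (jost_matrix Q A h \<rho>))
      \<longlongrightarrow> (0 *\<^sub>C (A ** mat 1) + compl_projection A ** mat 1) ** (- compl_projection A)) at_upper"
    by (intro tendsto_intros e e1 inv0 jost_matrix_limit(2)[OF A])
  then have "((\<lambda>\<rho>. (1 / (\<i> * \<rho>)) *\<^sub>C weyl_matrix Q A h (\<rho>\<^sup>2))
      \<longlongrightarrow> (0 *\<^sub>C (A ** mat 1) + compl_projection A ** mat 1) ** (- compl_projection A)) at_upper"
    by (rule Lim_transform_eventually) (rule eventually_mono[OF eventually_large[of "2 * mass"]],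
        simp add: weyl_matrix_eq cmatrix_simps)
  then show ?thesis
    using compl_projection_simps(3)[OF A] by (simp add: matrix_mult_distribs)
qed

text \<open>
  The relation arises from \<open>M J = A e + (I - A) e'\<close> by multiplication with \<open>e\<^sup>-\<^sup>1\<close> at \<open>0\<close>. As
  \<open>(I - A) h = 0\<close>, the matrix \<open>h\<close> can be absorbed into \<open>N\<close> on both sides.
\<close>

lemma (in potential) weyl_matrix_log_deriv:
  assumes h: "h = A ** h" and A: "A ** A = A" and \<rho>: "Im \<rho> > 0" "2 * mass \<le> norm \<rho>"
    and inv: "invertible (jost_solution Q \<rho> 0)" "invertible (jost_matrix Q A h \<rho>)"
  defines "N \<equiv> jost_deriv Q \<rho> 0 ** matrix_inv (jost_solution Q \<rho> 0) - h"
  shows "A + compl_projection A ** N = weyl_matrix Q A h (\<rho>\<^sup>2) ** (A ** N - compl_projection A)"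
proof -
  let ?e = "jost_solution Q \<rho> 0" and ?e1 = "jost_deriv Q \<rho> 0"
  have "weyl_matrix Q A h (\<rho>\<^sup>2) ** jost_matrix Q A h \<rho> = A ** ?e + compl_projection A ** ?e1"
    unfolding weyl_matrix_eq[OF \<rho>] by (simp add: matrix_mul_assoc[symmetric] matrix_inv_mult(2)[OF inv(2)])
  then have "weyl_matrix Q A h (\<rho>\<^sup>2) ** (jost_matrix Q A h \<rho> ** matrix_inv ?e) =
      (A ** ?e + compl_projection A ** ?e1) ** matrix_inv ?e"
    by (simp add: matrix_mul_assoc)
  moreover have "jost_matrix Q A h \<rho> ** matrix_inv ?e = A ** N - compl_projection A"
    unfolding jost_matrix_eq N_def
    by (simp add: matrix_mult_distribs matrix_mul_assoc[symmetric] matrix_inv_mult(1)[OF inv(1)])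
  moreover have "compl_projection A ** h = 0"
    using h by (simp add: compl_projection_def matrix_mult_distribs)
  then have "(A ** ?e + compl_projection A ** ?e1) ** matrix_inv ?e = A + compl_projection A ** N"
    unfolding N_def
    by (simp add: matrix_mult_distribs matrix_mul_assoc[symmetric] matrix_inv_mult(1)[OF inv(1)])
  ultimately show ?thesis by simp
qed

text \<open>
  For \<open>\<Delta> = N - N'\<close> and \<open>B = I - A\<close> the hypotheses give \<open>B \<Delta> = M A \<Delta>\<close>, hence \<open>A M A \<Delta> = 0\<close>. Compression of the
  first one to the range of \<open>A\<close> reads \<open>(A M A) (A N A) = A\<close>, so \<open>A M A\<close> is invertible there. It follows
  that \<open>A \<Delta> = 0\<close>, and then \<open>B \<Delta> = 0\<close>.
\<close>

lemma fractional_linear_injective: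
  fixes A M N N' :: "complex^'n^'n"
  assumes A: "A ** A = A"
    and N: "A + compl_projection A ** N = M ** (A ** N - compl_projection A)"
    and N': "A + compl_projection A ** N' = M ** (A ** N' - compl_projection A)"
  shows "N = N'"
proof -
  define B where "B = compl_projection A"
  note AB = compl_projection_simps[OF A, folded B_def]
  have BA: "A + B = mat 1" by (simp add: B_def compl_projection_def)
  define \<Delta> where "\<Delta> = N - N'"
  have d: "B ** \<Delta> = M ** (A ** \<Delta>)"
  proof -
    have "(A + B ** N) - (A + B ** N') = M ** (A ** N - B) - M ** (A ** N' - B)"
      using N N' by (simp add: B_def)
    then show ?thesis by (simp add: \<Delta>_def matrix_mult_distribs)
  qed
  have 1: "A ** M ** A ** \<Delta> = 0"
    using arg_cong[OF d, of "\<lambda>X. A ** X"] AB by (simp add: matrix_mul_assoc)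
  have AMN: "A ** M ** A ** N ** A = A"
  proof -
    have "A ** (A + B ** N) ** A = A ** (M ** (A ** N - B)) ** A"
      using N by (simp add: B_def)
    moreover have "A ** (A + B ** N) ** A = A"
      using A AB by (simp add: cmatrix_simps)
    moreover have "A ** (M ** (A ** N - B)) ** A = A ** M ** A ** N ** A"
      using AB by (simp add: matrix_mult_distribs) (simp add: matrix_mul_assoc[symmetric])
    ultimately show ?thesis by simp
  qed
  have "(A ** M ** A + B) ** (A ** N ** A + B) = mat 1"
  proof -
    have a: "X ** A ** A = X ** A" "X ** A ** B = 0" "X ** B ** A = 0" for X :: "complex^'n^'n"
      using A AB by (simp_all flip: matrix_mul_assoc)
    show ?thesis
      using AMN AB BA by (simp add: cmatrix_simps a)
  qed
  then have l: "(A ** N ** A + B) ** (A ** M ** A + B) = mat 1"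
    by (simp add: matrix_left_right_inverse)
  have "(A ** M ** A + B) ** (A ** \<Delta>) = 0"
    using 1 AB A by (simp add: cmatrix_simps) (metis A matrix_mul_assoc)
  then have "A ** \<Delta> = 0"
    using l by (metis matrix_mul_assoc matrix_mul_lid times0_right)
  moreover from this have "B ** \<Delta> = 0" using d by simp
  ultimately have "(A + B) ** \<Delta> = 0" by (simp add: matrix_mult_distribs)
  then show ?thesis by (simp add: BA \<Delta>_def)
qed

theorem theorem1:
  fixes Q Q' :: "real \<Rightarrow> complex^'n^'n"
    and A A' h h' :: "complex^'n^'n"
  assumes "bvp_data Q A h"
    and "bvp_data Q' A' h'"
    and "\<forall>z \<in> weyl_domain Q A h \<inter> weyl_domain Q' A' h'.
           weyl_matrix Q A h z = weyl_matrix Q' A' h' z"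
  shows "(AE x in lebesgue. x > 0 \<longrightarrow> Q x = Q' x) \<and> h = h' \<and> A = A'"
proof -
  interpret q: potential Q by (rule bvp_data_potential[OF assms(1)])
  interpret q': potential Q' by (rule bvp_data_potential[OF assms(2)])
  have A: "A ** A = A" "A' ** A' = A'" and h: "h = A ** h" "h' = A' ** h'"
    using assms(1,2) by (simp_all only: bvp_data_def orthogonal_projection_def)
  have dom: "\<forall>\<^sub>F \<rho> in at_upper. \<rho>\<^sup>2 \<in> weyl_domain Q A h \<and> \<rho>\<^sup>2 \<in> weyl_domain Q' A' h'"
    by (intro eventually_conj q.eventually_weyl_domain q'.eventually_weyl_domain A)
  then have M: "\<forall>\<^sub>F \<rho> in at_upper. weyl_matrix Q A h (\<rho>\<^sup>2) = weyl_matrix Q' A' h' (\<rho>\<^sup>2)"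
    by (rule eventually_mono) (use assms(3) in blast)
  have "((\<lambda>\<rho>. (1 / (\<i> * \<rho>)) *\<^sub>C weyl_matrix Q' A' h' (\<rho>\<^sup>2)) \<longlongrightarrow> - compl_projection A) at_upper"
    by (rule Lim_transform_eventually[OF q.weyl_matrix_limit[OF A(1), of h]])
      (rule eventually_mono[OF M], simp)
  then have "- compl_projection A = - compl_projection A'"
    using tendsto_unique[OF at_upper_nontrivial _ q'.weyl_matrix_limit[OF A(2)]] by blast
  then have AA: "A = A'" by (simp add: compl_projection_def)
  interpret two_potentials Q Q' h h'
  proof
    have "\<forall>\<^sub>F \<rho> in at_upper.
        weyl_matrix Q A h (\<rho>\<^sup>2) = weyl_matrix Q' A h' (\<rho>\<^sup>2) \<and>
        (invertible (jost_solution Q \<rho> 0) \<and> invertible (jost_solution Q' \<rho> 0)) \<and>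
        (invertible (jost_matrix Q A h \<rho>) \<and> invertible (jost_matrix Q' A h' \<rho>)) \<and>
        (Im \<rho> > 0 \<and> 2 * q.mass \<le> norm \<rho>) \<and> (Im \<rho> > 0 \<and> 2 * q'.mass \<le> norm \<rho>)"
      by (intro eventually_conj M[folded AA] q.eventually_jost_invertible q'.eventually_jost_invertible
          q.jost_matrix_limit(1) q'.jost_matrix_limit(1) A(1) eventually_large)
    then show "\<forall>\<^sub>F \<rho> in at_upper.
        jost_deriv Q \<rho> 0 ** matrix_inv (jost_solution Q \<rho> 0) - h =
        jost_deriv Q' \<rho> 0 ** matrix_inv (jost_solution Q' \<rho> 0) - h'"
    proof (rule eventually_mono, elim conjE)
      fix \<rho>
      assume \<rho>: "Im \<rho> > 0" "2 * q.mass \<le> norm \<rho>" "2 * q'.mass \<le> norm \<rho>"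
        and inv: "invertible (jost_solution Q \<rho> 0)" "invertible (jost_solution Q' \<rho> 0)"
          "invertible (jost_matrix Q A h \<rho>)" "invertible (jost_matrix Q' A h' \<rho>)"
        and W: "weyl_matrix Q A h (\<rho>\<^sup>2) = weyl_matrix Q' A h' (\<rho>\<^sup>2)"
      show "jost_deriv Q \<rho> 0 ** matrix_inv (jost_solution Q \<rho> 0) - h =
          jost_deriv Q' \<rho> 0 ** matrix_inv (jost_solution Q' \<rho> 0) - h'"
        by (rule fractional_linear_injective[OF A(1) q.weyl_matrix_log_deriv[OF h(1) A(1) \<rho>(1,2) inv(1,3)]
              q'.weyl_matrix_log_deriv[OF h(2)[folded AA] A(1) \<rho>(1,3) inv(2,4), folded W]])
    qed
  qed
  show ?thesis using potentials_agree AA by blast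
qed

end
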